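(* Every compact, connected surface $N$ with (nonempty) boundary, orientable or not, admits a submersion with definite folds $F\colon N\to\mathbb{R}$.
   Context: All manifolds and maps are of class $C^\infty$. For a map $f\colon M\to K$ from an $m$-dimensional manifold to a $k$-dimensional manifold, $m\ge k$, a point $p\in M$ is singular if $\operatorname{rank} df_p<k$, and regular otherwise; $f$ is a submersion if every point is regular; $S(f)$ denotes the set of singular points. For $M$ closed, $f$ is a definite fold map if around every $p\in S(f)$ there are local coordinates $(x_1,\dots,x_m)$ of $M$ around $p$ and $(y_1,\dots,y_k)$ of $K$ around $f(p)$ in which $f$ has the form $(x_1,\dots,x_m)\mapsto (x_1,\dots,x_{k-1},\sum_{i=k}^m \pm x_i^2)$ with all signs equal. Let $N$ be a compact, connected $n$-dimensional manifold with boundary and $K$ a $k$-dimensional manifold with $n>k$. A map $F\colon N\to K$ is a submersion with definite folds if $F$ is a submersion and $F|_{\partial N}$ is a definite fold map. *)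

theory Defs
  imports "HOL-Analysis.Analysis"
begin

section \<open>Smooth functions\<close>

primrec higher_differentiable_on ::
  "'e::real_normed_vector set \<Rightarrow> ('e \<Rightarrow> 'f::real_normed_vector) \<Rightarrow> nat \<Rightarrow> bool" where
  "higher_differentiable_on S f 0 \<longleftrightarrow> continuous_on S f"
| "higher_differentiable_on S f (Suc n) \<longleftrightarrow>
     (\<forall>x\<in>S. f differentiable (at x)) \<and>
     (\<forall>v. higher_differentiable_on S (\<lambda>x. frechet_derivative f (at x) v) n)"

text \<open>\<open>smooth_on\<close> below follows the usual convention for functions on arbitrary subsets of Euclidean
  space (needed at boundary points of a half-space): local extendability to a \<open>C\<^sup>\<infinity>\<close> function
  on an open set.\<close>

definition smooth_on :: "'e::euclidean_space set \<Rightarrow> ('e \<Rightarrow> 'f::euclidean_space) \<Rightarrow> bool" where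
  "smooth_on S f \<longleftrightarrow>
     (\<forall>x\<in>S. \<exists>T g. open T \<and> x \<in> T \<and> (\<forall>n. higher_differentiable_on T g n) \<and>
                 (\<forall>y\<in>S \<inter> T. f y = g y))"


section \<open>Smooth manifolds, with or without boundary\<close>

text \<open>A manifold is a topology \<open>X\<close> with an atlas of charts onto relatively open subsets of a
  model set \<open>H\<close> of a Euclidean space: \<open>H = UNIV\<close> for manifolds without boundary, and
  \<open>H = halfspace\<close> for manifolds with (possibly empty) boundary. The half-space is
  \<open>[0,\<infinity>) \<times> 'b\<close>, so that the boundary is modelled on \<open>'b\<close> and the dimension is \<open>DIM('b) + 1\<close>.\<close>

type_synonym ('a, 'e) chart = "'a set \<times> ('a \<Rightarrow> 'e)"

definition halfspace :: "(real \<times> 'b::euclidean_space) set" where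
  "halfspace = {x. 0 \<le> fst x}"

definition is_chart :: "'e::euclidean_space set \<Rightarrow> 'a topology \<Rightarrow> ('a, 'e) chart \<Rightarrow> bool" where
  "is_chart H X = (\<lambda>(U, \<phi>).
     openin X U \<and> openin (top_of_set H) (\<phi> ` U) \<and>
     homeomorphic_map (subtopology X U) (top_of_set (\<phi> ` U)) \<phi>)"

definition rep_dom :: "('a, 'e) chart \<Rightarrow> ('c, 'f) chart \<Rightarrow> ('a \<Rightarrow> 'c) \<Rightarrow> 'e set" where
  "rep_dom c d f = snd c ` (fst c \<inter> f -` fst d)"

definition local_rep :: "('a, 'e) chart \<Rightarrow> ('c, 'f) chart \<Rightarrow> ('a \<Rightarrow> 'c) \<Rightarrow> 'e \<Rightarrow> 'f" where
  "local_rep c d f = (\<lambda>x. snd d (f (inv_into (fst c) (snd c) x)))"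

definition compatible ::
  "('a, 'e::euclidean_space) chart \<Rightarrow> ('a, 'e) chart \<Rightarrow> bool" where
  "compatible c d \<longleftrightarrow>
     smooth_on (rep_dom c d id) (local_rep c d id) \<and>
     smooth_on (rep_dom d c id) (local_rep d c id)"

definition smooth_manifold ::
  "'e::euclidean_space set \<Rightarrow> 'a topology \<Rightarrow> ('a, 'e) chart set \<Rightarrow> bool" where
  "smooth_manifold H X A \<longleftrightarrow>
     Hausdorff_space X \<and> second_countable X \<and>
     (\<forall>c\<in>A. is_chart H X c) \<and> (\<Union>c\<in>A. fst c) = topspace X \<and>
     (\<forall>c\<in>A. \<forall>d\<in>A. compatible c d)"

definition local_coordinates ::
  "'e::euclidean_space set \<Rightarrow> 'a topology \<Rightarrow> ('a, 'e) chart set \<Rightarrow> ('a, 'e) chart set" where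
  "local_coordinates H X A = {c. is_chart H X c \<and> (\<forall>d\<in>A. compatible c d)}"

definition real_line_atlas :: "(real, real) chart set" where
  "real_line_atlas = {(UNIV, id)}"

definition manifold_boundary :: "('a, real \<times> 'b::euclidean_space) chart set \<Rightarrow> 'a set" where
  "manifold_boundary A = {p. \<exists>(U, \<phi>)\<in>A. p \<in> U \<and> fst (\<phi> p) = 0}"

definition boundary_atlas ::
  "('a, real \<times> 'b::euclidean_space) chart set \<Rightarrow> ('a, 'b) chart set" where
  "boundary_atlas A = (\<lambda>(U, \<phi>). (U \<inter> manifold_boundary A, snd \<circ> \<phi>)) ` A"


section \<open>Smooth maps and their singular points\<close>

definition smooth_map ::
  "'a topology \<Rightarrow> ('a, 'e::euclidean_space) chart set \<Rightarrow>
   'c topology \<Rightarrow> ('c, 'f::euclidean_space) chart set \<Rightarrow> ('a \<Rightarrow> 'c) \<Rightarrow> bool" where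
  "smooth_map X A Y B f \<longleftrightarrow>
     continuous_map X Y f \<and> (\<forall>c\<in>A. \<forall>d\<in>B. smooth_on (rep_dom c d f) (local_rep c d f))"

text \<open>The derivative is taken within the chart domain because that domain need not be open at
  boundary points; it is unique there, since chart domains are relatively open in a half-space
  or in the whole space. The rank does not depend on the charts.\<close>

definition rank_in_charts ::
  "('a, 'e::euclidean_space) chart \<Rightarrow> ('c, 'f::euclidean_space) chart \<Rightarrow>
   ('a \<Rightarrow> 'c) \<Rightarrow> 'a \<Rightarrow> nat" where
  "rank_in_charts c d f p =
     dim (range (frechet_derivative (local_rep c d f) (at (snd c p) within rep_dom c d f)))"

definition singular_set ::
  "('a, 'e::euclidean_space) chart set \<Rightarrow> ('c, 'f::euclidean_space) chart set \<Rightarrow>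
   ('a \<Rightarrow> 'c) \<Rightarrow> 'a set" where
  "singular_set A B f =
     {p. \<exists>c\<in>A. \<exists>d\<in>B. p \<in> fst c \<and> f p \<in> fst d \<and> rank_in_charts c d f p < DIM('f)}"

definition submersion ::
  "'a topology \<Rightarrow> ('a, 'e::euclidean_space) chart set \<Rightarrow>
   'c topology \<Rightarrow> ('c, 'f::euclidean_space) chart set \<Rightarrow> ('a \<Rightarrow> 'c) \<Rightarrow> bool" where
  "submersion X A Y B f \<longleftrightarrow> smooth_map X A Y B f \<and> singular_set A B f = {}"


section \<open>Definite folds\<close>

text \<open>The map \<open>(x\<^sub>1,\<dots>,x\<^sub>m) \<mapsto> (x\<^sub>1,\<dots>,x\<^bsub>k-1\<^esub>, s(x\<^sub>k\<^sup>2 + \<dots> + x\<^sub>m\<^sup>2))\<close>, where \<open>b\<close> and \<open>e\<close> enumerate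
  the standard bases of the domain and codomain and \<open>s\<close> is the common sign.\<close>

definition definite_fold_form ::
  "(nat \<Rightarrow> 'e::euclidean_space) \<Rightarrow> (nat \<Rightarrow> 'f::euclidean_space) \<Rightarrow> real \<Rightarrow> 'e \<Rightarrow> 'f" where
  "definite_fold_form b e s x =
     (\<Sum>i\<in>{1..<DIM('f)}. (x \<bullet> b i) *\<^sub>R e i) +
     (s * (\<Sum>i\<in>{DIM('f)..DIM('e)}. (x \<bullet> b i)\<^sup>2)) *\<^sub>R e (DIM('f))"

text \<open>To be used for a closed manifold \<open>(X, A)\<close> and a manifold \<open>(Y, B)\<close> without boundary.\<close>

definition definite_fold_map ::
  "'a topology \<Rightarrow> ('a, 'e::euclidean_space) chart set \<Rightarrow>
   'c topology \<Rightarrow> ('c, 'f::euclidean_space) chart set \<Rightarrow> ('a \<Rightarrow> 'c) \<Rightarrow> bool" where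
  "definite_fold_map X A Y B f \<longleftrightarrow>
     smooth_map X A Y B f \<and>
     (\<forall>p\<in>singular_set A B f.
        \<exists>(U, \<phi>)\<in>local_coordinates UNIV X A. \<exists>(V, \<psi>)\<in>local_coordinates UNIV Y B.
          p \<in> U \<and> \<phi> p = 0 \<and> f p \<in> V \<and> \<psi> (f p) = 0 \<and> f ` U \<subseteq> V \<and>
          (\<exists>b e s. bij_betw b {1..DIM('e)} Basis \<and> bij_betw e {1..DIM('f)} Basis \<and>
                   s \<in> {1, -1} \<and> (\<forall>q\<in>U. \<psi> (f q) = definite_fold_form b e s (\<phi> q))))"

text \<open>To be used for a compact connected manifold \<open>(X, A)\<close> with boundary and a manifold
  \<open>(Y, B)\<close> without boundary, of dimensions \<open>DIM('b) + 1 > DIM('f)\<close>.\<close>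

definition submersion_with_definite_folds ::
  "'a topology \<Rightarrow> ('a, real \<times> 'b::euclidean_space) chart set \<Rightarrow>
   'c topology \<Rightarrow> ('c, 'f::euclidean_space) chart set \<Rightarrow> ('a \<Rightarrow> 'c) \<Rightarrow> bool" where
  "submersion_with_definite_folds X A Y B F \<longleftrightarrow>
     submersion X A Y B F \<and>
     definite_fold_map (subtopology X (manifold_boundary A)) (boundary_atlas A) Y B F"

end

theory Submission
  imports Defs
begin

text \<open>Take a Morse function on the surface, push its finitely many critical points out through
  the boundary, and then perturb the result so that its restriction to the boundary is Morse.

  Morse functions arise by small perturbations. In a chart, adding a linear function \<open>t\<close> (cut
  off by a bump) moves the gradient by \<open>t\<close> and leaves the Hessian alone, so a degenerate critical
  point can only survive if \<open>-t\<close> is a critical value of the gradient map; by Sard's theorem in the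
  plane (\<open>Sard_plane\<close>) there are arbitrarily small \<open>t\<close> for which this does not happen.
  Nondegeneracy on a compact half-disc is the nonvanishing of a continuous function of the second
  order jet, so that it survives further small perturbations (\<open>jet_condition_stable\<close>), and finitely
  many half-discs that cover the surface can be treated one after the other
  (\<open>reachable_simultaneously\<close>). Nondegenerate critical points are isolated, so by compactness
  there are finitely many.

  A critical point \<open>p\<close> of \<open>f\<close> disappears in \<open>f \<circ> h\<close> if \<open>h\<close> is an embedding of the surface into
  itself whose image misses \<open>p\<close>, and \<open>f \<circ> h\<close> has no new critical points because \<open>h\<close> is injective
  and a local diffeomorphism. Pushing a half-disc at the boundary inwards misses all points close
  to its edge, and translating a small disc carries a missed point to any point nearby. The
  points that can be missed therefore form an open and closed set containing the boundary, which is the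
  whole surface when the surface is connected and has a boundary (\<open>all_avoidable\<close>). Induction on
  the number of critical points gives a function without any (\<open>finite_crit_removable\<close>).

  Having no critical points is again a stable condition, so a last round of the perturbation
  argument, now in the direction of the boundary, gives a function without critical points whose
  restriction to the boundary has nonzero second derivative at its critical points
  (\<open>good_function_exists\<close>). By the Morse lemma in dimension one (\<open>Morse_lemma_1d\<close>) that restriction is
  \<open>\<plusminus>x\<^sup>2\<close> up to a constant in suitable coordinates, which is the form of a definite fold.\<close>

section \<open>Calculus of higher differentiability on open sets\<close>

lemma higher_diff_cong:
  assumes "open S" and "\<And>x. x \<in> S \<Longrightarrow> f x = g x"
  shows "higher_differentiable_on S f n \<longleftrightarrow> higher_differentiable_on S g n"
  using assms(2)
proof (induction n arbitrary: f g)
  case 0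
  then show ?case by (simp cong: continuous_on_cong)
next
  case (Suc n)
  have D: "(f has_derivative L) (at x) \<longleftrightarrow> (g has_derivative L) (at x)" if "x \<in> S" for x L
    using has_derivative_transform_within_open[OF _ assms(1) that] Suc.prems by metis
  then have 1: "f differentiable (at x) \<longleftrightarrow> g differentiable (at x)" if "x \<in> S" for x
    using that by (simp add: differentiable_def)
  have 2: "frechet_derivative f (at x) = frechet_derivative g (at x)" if "x \<in> S" for x
    using that by (simp add: frechet_derivative_def D)
  have "higher_differentiable_on S (\<lambda>x. frechet_derivative f (at x) v) n \<longleftrightarrow>
        higher_differentiable_on S (\<lambda>x. frechet_derivative g (at x) v) n" for v
    using 2 by (intro Suc.IH) simp
  then show ?case using 1 by simp
qed

lemma higher_diff_subset:
  "higher_differentiable_on S f n \<Longrightarrow> T \<subseteq> S \<Longrightarrow> higher_differentiable_on T f n"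
  by (induction n arbitrary: f) (auto intro: continuous_on_subset)

lemma higher_diff_SucI:
  assumes "open S" and "\<And>x. x \<in> S \<Longrightarrow> (f has_derivative f' x) (at x)"
    and "\<And>v. higher_differentiable_on S (\<lambda>x. f' x v) n"
  shows "higher_differentiable_on S f (Suc n)"
proof -
  have "frechet_derivative f (at x) = f' x" if "x \<in> S" for x
    using assms(2)[OF that] by (metis frechet_derivative_at)
  then have "higher_differentiable_on S (\<lambda>x. frechet_derivative f (at x) v) n" for v
    using assms(3)[of v] higher_diff_cong[OF assms(1), of "\<lambda>x. frechet_derivative f (at x) v"]
    by simp
  moreover have "\<forall>x\<in>S. f differentiable (at x)"
    using assms(2) differentiableI by blast
  ultimately show ?thesis by simp
qed

lemma higher_diff_has_derivative:
  "higher_differentiable_on S f (Suc n) \<Longrightarrow> x \<in> S \<Longrightarrow>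
     (f has_derivative frechet_derivative f (at x)) (at x)"
  by (simp add: frechet_derivative_works)

lemma higher_diff_SucD:
  "higher_differentiable_on S f (Suc n) \<Longrightarrow> higher_differentiable_on S f n"
proof (induction n arbitrary: f)
  case 0
  then show ?case
    by (auto intro!: continuous_at_imp_continuous_on differentiable_imp_continuous_within)
next
  case (Suc n)
  then show ?case by (metis higher_differentiable_on.simps(2))
qed

lemma higher_diff_const: "higher_differentiable_on S (\<lambda>x. c) n"
  by (induction n arbitrary: c) (auto simp: frechet_derivative_const)

lemma higher_diff_bounded_linear_image:
  assumes "bounded_linear L" "open S" "higher_differentiable_on S f n"
  shows "higher_differentiable_on S (\<lambda>x. L (f x)) n"
  using assms(3)
proof (induction n arbitrary: f)
  case 0
  then show ?case
    using bounded_linear.continuous_on[OF assms(1)] by auto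
next
  case (Suc n)
  show ?case
  proof (rule higher_diff_SucI[OF assms(2)])
    show "((\<lambda>x. L (f x)) has_derivative (\<lambda>v. L (frechet_derivative f (at x) v))) (at x)"
      if "x \<in> S" for x
      using higher_diff_has_derivative[OF Suc.prems that]
        bounded_linear.has_derivative[OF assms(1)] by blast
    show "higher_differentiable_on S (\<lambda>x. L (frechet_derivative f (at x) v)) n" for v
      using Suc by simp
  qed
qed

lemma higher_diff_bounded_linear:
  assumes "bounded_linear L" "open S"
  shows "higher_differentiable_on S L n"
proof (cases n)
  case 0
  then show ?thesis using assms(1) by (simp add: linear_continuous_on)
next
  case (Suc m)
  then show ?thesis
    using higher_diff_SucI[OF assms(2), of L "\<lambda>_. L"]
      bounded_linear_imp_has_derivative[OF assms(1)] higher_diff_const by metis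
qed

lemma higher_diff_add:
  assumes "open S"
  shows "higher_differentiable_on S f n \<Longrightarrow> higher_differentiable_on S g n \<Longrightarrow>
    higher_differentiable_on S (\<lambda>x. f x + g x) n"
proof (induction n arbitrary: f g)
  case 0
  then show ?case by (auto intro: continuous_intros)
next
  case (Suc n)
  show ?case
    by (rule higher_diff_SucI[OF assms
          has_derivative_add[OF higher_diff_has_derivative[OF Suc.prems(1)]
            higher_diff_has_derivative[OF Suc.prems(2)]]])
       (use Suc in auto)
qed

lemma higher_diff_bilinear:
  assumes "bounded_bilinear B" "open S"
  shows "higher_differentiable_on S f n \<Longrightarrow> higher_differentiable_on S g n \<Longrightarrow>
    higher_differentiable_on S (\<lambda>x. B (f x) (g x)) n"
proof (induction n arbitrary: f g)
  case 0
  then show ?case using bounded_bilinear.continuous_on[OF assms(1)] by auto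
next
  case (Suc n)
  show ?case
  proof (rule higher_diff_SucI[OF assms(2)
          bounded_bilinear.FDERIV[OF assms(1) higher_diff_has_derivative[OF Suc.prems(1)]
            higher_diff_has_derivative[OF Suc.prems(2)]]])
    show "higher_differentiable_on S
       (\<lambda>x. B (f x) (frechet_derivative g (at x) v) + B (frechet_derivative f (at x) v) (g x)) n" for v
      using Suc.prems higher_diff_SucD[OF Suc.prems(1)] higher_diff_SucD[OF Suc.prems(2)]
      by (intro higher_diff_add[OF assms(2)] Suc.IH) simp_all
  qed auto
qed

lemma higher_diff_sum:
  assumes "open S" "finite I" "\<And>i. i \<in> I \<Longrightarrow> higher_differentiable_on S (f i) n"
  shows "higher_differentiable_on S (\<lambda>x. \<Sum>i\<in>I. f i x) n"
  using assms(2,3)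
proof (induction I rule: finite_induct)
  case empty
  then show ?case by (simp add: higher_diff_const)
next
  case (insert i I)
  then have "higher_differentiable_on S (\<lambda>x. f i x + (\<Sum>i\<in>I. f i x)) n"
    by (intro higher_diff_add[OF assms(1)]) simp_all
  then show ?case using insert.hyps by simp
qed

text \<open>By the chain rule a directional derivative of \<open>f \<circ> g\<close> is a sum of products of
  directional derivatives of \<open>g\<close> with the maps \<open>\<partial>\<^sub>b f \<circ> g\<close>, to which the induction hypothesis applies.\<close>

lemma higher_diff_compose:
  fixes g :: "'d::real_normed_vector \<Rightarrow> 'e::euclidean_space"
    and f :: "'e \<Rightarrow> 'f::real_normed_vector"
  assumes "open S" "open T" "g ` S \<subseteq> T"
  shows "higher_differentiable_on T f n \<Longrightarrow> higher_differentiable_on S g n \<Longrightarrow>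
    higher_differentiable_on S (\<lambda>x. f (g x)) n"
proof (induction n arbitrary: f)
  case 0
  then show ?case using continuous_on_compose2[OF _ _ assms(3)] by simp
next
  case (Suc n)
  let ?Df = "\<lambda>y. frechet_derivative f (at y)" and ?Dg = "\<lambda>x. frechet_derivative g (at x)"
  have der: "((\<lambda>x. f (g x)) has_derivative (\<lambda>v. \<Sum>b\<in>Basis. (?Dg x v \<bullet> b) *\<^sub>R ?Df (g x) b)) (at x)"
    if "x \<in> S" for x
  proof -
    have f: "(f has_derivative ?Df (g x)) (at (g x))"
      using higher_diff_has_derivative[OF Suc.prems(1)] assms(3) that by blast
    have expand: "?Df (g x) w = (\<Sum>b\<in>Basis. (w \<bullet> b) *\<^sub>R ?Df (g x) b)" for w
    proof -
      have "linear (?Df (g x))" using f has_derivative_linear by blast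
      then have "?Df (g x) (\<Sum>b\<in>Basis. (w \<bullet> b) *\<^sub>R b) = (\<Sum>b\<in>Basis. (w \<bullet> b) *\<^sub>R ?Df (g x) b)"
        by (simp add: linear_sum linear_cmul)
      then show ?thesis by (simp only: euclidean_representation)
    qed
    show ?thesis
      using has_derivative_compose[OF higher_diff_has_derivative[OF Suc.prems(2) that] f]
      by (subst (asm) expand)
  qed
  show ?case
  proof (rule higher_diff_SucI[OF assms(1) der])
    show "higher_differentiable_on S (\<lambda>x. \<Sum>b\<in>Basis. (?Dg x v \<bullet> b) *\<^sub>R ?Df (g x) b) n" for v
    proof (rule higher_diff_sum[OF assms(1) finite_Basis])
      fix b :: 'e
      have "higher_differentiable_on S (\<lambda>x. ?Df (g x) b) n"
        using Suc.prems(1) by (intro Suc.IH[OF _ higher_diff_SucD[OF Suc.prems(2)]]) simp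
      moreover have "higher_differentiable_on S (\<lambda>x. ?Dg x v \<bullet> b) n"
        using Suc.prems(2)
        by (intro higher_diff_bounded_linear_image[OF bounded_linear_inner_left assms(1)]) simp
      ultimately show "higher_differentiable_on S (\<lambda>x. (?Dg x v \<bullet> b) *\<^sub>R ?Df (g x) b) n"
        by (rule higher_diff_bilinear[OF bounded_bilinear_scaleR assms(1), rotated])
    qed
  qed auto
qed

text \<open>Used for families of functions whose derivatives have no convenient closed form of order \<open>n\<close>,
  but stay within the family.\<close>

lemma higher_diff_if_derivative_closed:
  fixes \<F> :: "(real \<Rightarrow> real) set"
  assumes "open S"
    and closed: "\<And>f. f \<in> \<F> \<Longrightarrow> \<exists>f'\<in>\<F>. \<forall>x\<in>S. (f has_real_derivative f' x) (at x)"
  shows "f \<in> \<F> \<Longrightarrow> higher_differentiable_on S f n"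
proof (induction n arbitrary: f)
  case 0
  then obtain f' where "\<forall>x\<in>S. (f has_real_derivative f' x) (at x)" using closed by blast
  then show ?case
    by (auto intro!: continuous_at_imp_continuous_on DERIV_isCont)
next
  case (Suc n)
  then obtain f' where f': "f' \<in> \<F>" "\<forall>x\<in>S. (f has_real_derivative f' x) (at x)"
    using closed by blast
  show ?case
  proof (rule higher_diff_SucI[OF assms(1)])
    show "(f has_derivative (\<lambda>v. f' x * v)) (at x)" if "x \<in> S" for x
      using f'(2) that by (simp add: has_field_derivative_def)
    show "higher_differentiable_on S (\<lambda>x. f' x * v) n" for v
      using higher_diff_bounded_linear_image[OF bounded_linear_mult_left assms(1) Suc.IH[OF f'(1)]] .
  qed
qed

lemma higher_diff_powr: "higher_differentiable_on {0<..} (\<lambda>x::real. x powr a) n"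
proof (rule higher_diff_if_derivative_closed)
  show "(\<lambda>x. x powr a) \<in> {\<lambda>x. c * x powr b | b c. True}"
    unfolding mem_Collect_eq by (rule exI[of _ a], rule exI[of _ 1]) simp
  show "\<exists>f'\<in>{\<lambda>x. c * x powr b | b c. True}. \<forall>x\<in>{0<..}. (f has_real_derivative f' x) (at x)"
    if "f \<in> {\<lambda>x. c * x powr b | b c. True}" for f :: "real \<Rightarrow> real"
  proof -
    obtain b c where f: "f = (\<lambda>x. c * x powr b)" using \<open>f \<in> _\<close> by auto
    have "\<forall>x\<in>{0<..}. (f has_real_derivative (c * b) * x powr (b - 1)) (at x)"
      unfolding f by (auto intro!: derivative_eq_intros)
    then show ?thesis by (intro bexI[of _ "\<lambda>x. (c * b) * x powr (b - 1)"]) blast+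
  qed
qed auto

section \<open>Calculus of smooth functions on arbitrary sets\<close>

text \<open>On open sets \<open>smooth_on\<close> amounts to this stronger-looking property, in which the function
  itself is differentiable; it is the form in which derivatives can be computed.\<close>

definition C_inf :: "'e::real_normed_vector set \<Rightarrow> ('e \<Rightarrow> 'f::real_normed_vector) \<Rightarrow> bool" where
  "C_inf S f \<longleftrightarrow> (\<forall>n. higher_differentiable_on S f n)"

lemma smooth_on_iff_C_inf: "smooth_on S f \<longleftrightarrow>
     (\<forall>x\<in>S. \<exists>T g. open T \<and> x \<in> T \<and> C_inf T g \<and> (\<forall>y\<in>S \<inter> T. f y = g y))"
  by (simp add: smooth_on_def C_inf_def)

lemma smooth_onE:
  assumes "smooth_on S f" "x \<in> S"
  obtains T g where "open T" "x \<in> T" "C_inf T g" "\<forall>y\<in>S \<inter> T. f y = g y"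
proof -
  from assms have "\<exists>T g. open T \<and> x \<in> T \<and> C_inf T g \<and> (\<forall>y\<in>S \<inter> T. f y = g y)"
    unfolding smooth_on_iff_C_inf by (rule bspec)
  then show thesis using that by (elim exE conjE)
qed

lemma smooth_onI:
  assumes "\<And>x. x \<in> S \<Longrightarrow> \<exists>T g. open T \<and> x \<in> T \<and> C_inf T g \<and> (\<forall>y\<in>S \<inter> T. f y = g y)"
  shows "smooth_on S f"
  unfolding smooth_on_iff_C_inf using assms by (rule ballI)

lemma C_inf_subset: "C_inf S f \<Longrightarrow> T \<subseteq> S \<Longrightarrow> C_inf T f"
  by (auto simp: C_inf_def intro: higher_diff_subset)

lemma C_inf_continuous_on: "C_inf S f \<Longrightarrow> continuous_on S f"
  unfolding C_inf_def by (drule spec[of _ 0]) simp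

lemma C_inf_has_derivative:
  "C_inf S f \<Longrightarrow> x \<in> S \<Longrightarrow> (f has_derivative frechet_derivative f (at x)) (at x)"
  unfolding C_inf_def by (rule higher_diff_has_derivative[where n = 0]) (rule spec)

lemma C_inf_derivative: "C_inf S f \<Longrightarrow> C_inf S (\<lambda>x. frechet_derivative f (at x) v)"
  unfolding C_inf_def
proof
  fix n assume "\<forall>n. higher_differentiable_on S f n"
  then have "higher_differentiable_on S f (Suc n)" ..
  then show "higher_differentiable_on S (\<lambda>x. frechet_derivative f (at x) v) n" by simp
qed

lemma C_inf_imp_smooth_on: "open S \<Longrightarrow> C_inf S f \<Longrightarrow> smooth_on S f"
  by (rule smooth_onI) blast

lemma smooth_on_subset:
  assumes "smooth_on S f" "T \<subseteq> S"
  shows "smooth_on T f"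
proof (rule smooth_onI)
  fix x assume "x \<in> T"
  then have "x \<in> S" using assms(2) by blast
  then obtain U g where "open U" "x \<in> U" "C_inf U g" and fg: "\<forall>y\<in>S \<inter> U. f y = g y"
    by (rule smooth_onE[OF assms(1)])
  moreover have "\<forall>y\<in>T \<inter> U. f y = g y" using fg assms(2) by blast
  ultimately show "\<exists>U g. open U \<and> x \<in> U \<and> C_inf U g \<and> (\<forall>y\<in>T \<inter> U. f y = g y)" by blast
qed

lemma smooth_on_cong:
  "(\<And>x. x \<in> S \<Longrightarrow> f x = g x) \<Longrightarrow> smooth_on S f \<longleftrightarrow> smooth_on S g"
  unfolding smooth_on_iff_C_inf by simp

lemma smooth_on_locally:
  assumes "\<And>x. x \<in> S \<Longrightarrow> \<exists>T. open T \<and> x \<in> T \<and> smooth_on (S \<inter> T) f"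
  shows "smooth_on S f"
proof (rule smooth_onI)
  fix x assume "x \<in> S"
  then obtain T where T: "open T" "x \<in> T" "smooth_on (S \<inter> T) f" using assms by blast
  then obtain U g where U: "open U" "x \<in> U" "C_inf U g" "\<forall>y\<in>(S \<inter> T) \<inter> U. f y = g y"
    using \<open>x \<in> S\<close> by (elim smooth_onE[of "S \<inter> T" f x]) blast
  then show "\<exists>T g. open T \<and> x \<in> T \<and> C_inf T g \<and> (\<forall>y\<in>S \<inter> T. f y = g y)"
    using T by (intro exI[of _ "T \<inter> U"] exI[of _ g]) (auto intro: C_inf_subset)
qed

lemma smooth_on_continuous_on: "smooth_on S f \<Longrightarrow> continuous_on S f"
proof -
  assume f: "smooth_on S f"
  have "continuous (at x within S) f" if x: "x \<in> S" for x
  proof -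
    obtain T g where T: "open T" "x \<in> T" "C_inf T g" "\<forall>y\<in>S \<inter> T. f y = g y"
      by (rule smooth_onE[OF f x])
    have "continuous (at x) g"
      using C_inf_continuous_on[OF T(3)] T(1,2) by (simp add: continuous_on_eq_continuous_at)
    then have "continuous (at x within S \<inter> T) g" using continuous_at_imp_continuous_at_within by blast
    then have "continuous (at x within S \<inter> T) f"
      using T x by (auto simp: continuous_within intro: Lim_transform_within[of g _ _ _ 1])
    moreover have "at x within S \<inter> T = at x within S"
      using T(1,2) by (intro at_within_nhd[of x T]) auto
    ultimately show ?thesis by simp
  qed
  then show ?thesis by (simp add: continuous_on_eq_continuous_within)
qed

lemma higher_diff_locally:
  assumes "\<And>x. x \<in> S \<Longrightarrow> \<exists>T. open T \<and> x \<in> T \<and> higher_differentiable_on T f n"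
  shows "higher_differentiable_on S f n"
  using assms
proof (induction n arbitrary: f)
  case 0
  show ?case unfolding higher_differentiable_on.simps
  proof (intro continuous_at_imp_continuous_on ballI)
    fix x assume "x \<in> S"
    then obtain T where "open T" "x \<in> T" "continuous_on T f" using 0[of x] by auto
    then show "isCont f x" by (simp add: continuous_on_eq_continuous_at)
  qed
next
  case (Suc n)
  have "higher_differentiable_on S (\<lambda>x. frechet_derivative f (at x) v) n" for v
  proof (rule Suc.IH)
    fix x assume "x \<in> S"
    then obtain T where "open T" "x \<in> T" "higher_differentiable_on T f (Suc n)"
      using Suc.prems[of x] by blast
    then show "\<exists>T. open T \<and> x \<in> T \<and> higher_differentiable_on T (\<lambda>x. frechet_derivative f (at x) v) n"
      by (intro exI[of _ T]) simp
  qed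
  moreover have "f differentiable at x" if "x \<in> S" for x
    using Suc.prems[OF that] by auto
  ultimately show ?case by simp
qed

lemma smooth_on_imp_C_inf:
  assumes "open S" "smooth_on S f" shows "C_inf S f"
  unfolding C_inf_def
proof
  fix n show "higher_differentiable_on S f n"
  proof (rule higher_diff_locally)
    fix x assume x: "x \<in> S"
    obtain T g where T: "open T" "x \<in> T" "C_inf T g" "\<forall>y\<in>S \<inter> T. f y = g y"
      by (rule smooth_onE[OF assms(2) x])
    have "open (S \<inter> T)" using T(1) assms(1) by blast
    moreover have "higher_differentiable_on (S \<inter> T) g n"
      using C_inf_subset[OF T(3), of "S \<inter> T"] unfolding C_inf_def by blast
    ultimately have "higher_differentiable_on (S \<inter> T) f n"
      by (subst higher_diff_cong[of "S \<inter> T" f g]) (use T(4) in simp_all)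
    then show "\<exists>T. open T \<and> x \<in> T \<and> higher_differentiable_on T f n"
      using \<open>open (S \<inter> T)\<close> x T(2) by (intro exI[of _ "S \<inter> T"]) simp
  qed
qed

lemma smooth_on_bounded_linear: "bounded_linear L \<Longrightarrow> smooth_on S L"
  using smooth_on_subset[OF C_inf_imp_smooth_on[OF open_UNIV]] higher_diff_bounded_linear
  unfolding C_inf_def by blast

lemma smooth_on_const: "smooth_on S (\<lambda>x. c)"
  using smooth_on_subset[OF C_inf_imp_smooth_on[OF open_UNIV]] higher_diff_const
  unfolding C_inf_def by blast

lemma smooth_on_compose:
  assumes f: "smooth_on T f" and g: "smooth_on S g" and gS: "g ` S \<subseteq> T"
  shows "smooth_on S (\<lambda>x. f (g x))"
proof (rule smooth_onI)
  fix x assume x: "x \<in> S"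
  obtain A a where A: "open A" "x \<in> A" "C_inf A a" "\<forall>y\<in>S \<inter> A. g y = a y"
    by (rule smooth_onE[OF g x])
  obtain B b where B: "open B" "g x \<in> B" "C_inf B b" "\<forall>y\<in>T \<inter> B. f y = b y"
    using smooth_onE[OF f] gS x by (metis image_subset_iff)
  let ?A = "A \<inter> a -` B"
  have "open ?A"
    using continuous_open_preimage[OF C_inf_continuous_on[OF A(3)] A(1) B(1)] .
  moreover have "x \<in> ?A" using A B x by auto
  moreover have "C_inf ?A (\<lambda>x. b (a x))"
    unfolding C_inf_def
  proof
    fix n
    have "higher_differentiable_on B b n" "higher_differentiable_on ?A a n"
      using B(3) C_inf_subset[OF A(3), of ?A] unfolding C_inf_def by blast+
    then show "higher_differentiable_on ?A (\<lambda>x. b (a x)) n"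
      by (rule higher_diff_compose[OF \<open>open ?A\<close> B(1), rotated]) blast
  qed
  moreover have "\<forall>y\<in>S \<inter> ?A. f (g y) = b (a y)"
  proof
    fix y assume y: "y \<in> S \<inter> ?A"
    then have "g y = a y" "g y \<in> T \<inter> B" using A(4) gS by auto
    then show "f (g y) = b (a y)" using B(4) by metis
  qed
  ultimately show "\<exists>T h. open T \<and> x \<in> T \<and> C_inf T h \<and> (\<forall>y\<in>S \<inter> T. f (g y) = h y)"
    by blast
qed

lemma smooth_on_Pair:
  assumes f: "smooth_on S f" and g: "smooth_on S g"
  shows "smooth_on S (\<lambda>x. (f x, g x))"
proof (rule smooth_onI)
  fix x assume x: "x \<in> S"
  obtain A a where A: "open A" "x \<in> A" "C_inf A a" "\<forall>y\<in>S \<inter> A. f y = a y"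
    by (rule smooth_onE[OF f x])
  obtain B b where B: "open B" "x \<in> B" "C_inf B b" "\<forall>y\<in>S \<inter> B. g y = b y"
    by (rule smooth_onE[OF g x])
  have AB: "open (A \<inter> B)" using A B by blast
  have l1: "bounded_linear (\<lambda>y::'b. (y, 0::'c))"
    by (intro bounded_linear_Pair bounded_linear_ident bounded_linear_zero)
  have l2: "bounded_linear (\<lambda>y::'c. (0::'b, y))"
    by (intro bounded_linear_Pair bounded_linear_ident bounded_linear_zero)
  have "higher_differentiable_on (A \<inter> B) (\<lambda>x. (a x, 0) + (0, b x)) n" for n
    using C_inf_subset[OF A(3), of "A \<inter> B"] C_inf_subset[OF B(3), of "A \<inter> B"]
    unfolding C_inf_def
    by (intro higher_diff_add[OF AB]
        higher_diff_bounded_linear_image[OF l1 AB]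
        higher_diff_bounded_linear_image[OF l2 AB]) auto
  then have "C_inf (A \<inter> B) (\<lambda>x. (a x, b x))" unfolding C_inf_def by (intro allI) simp
  moreover have "\<forall>y\<in>S \<inter> (A \<inter> B). (f y, g y) = (a y, b y)"
    using A(4) B(4) by simp
  moreover have "x \<in> A \<inter> B" using A(2) B(2) by simp
  ultimately show "\<exists>T h. open T \<and> x \<in> T \<and> C_inf T h \<and> (\<forall>y\<in>S \<inter> T. (f y, g y) = h y)"
    using AB by - (rule exI[of _ "A \<inter> B"], rule exI[of _ "\<lambda>x. (a x, b x)"], intro conjI)
qed

lemma smooth_on_bounded_linear_image:
  "bounded_linear L \<Longrightarrow> smooth_on S f \<Longrightarrow> smooth_on S (\<lambda>x. L (f x))"
  by (rule smooth_on_compose[OF smooth_on_bounded_linear[of L UNIV]]) simp_all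

lemma smooth_on_add:
  assumes "smooth_on S f" "smooth_on S g" shows "smooth_on S (\<lambda>x. f x + g x)"
proof -
  have "bounded_linear (\<lambda>p::'b \<times> 'b. fst p + snd p)"
    by (intro bounded_linear_add bounded_linear_fst bounded_linear_snd)
  from smooth_on_bounded_linear_image[OF this smooth_on_Pair[OF assms]] show ?thesis by simp
qed

lemma smooth_on_bilinear:
  assumes B: "bounded_bilinear B" and "smooth_on S f" "smooth_on S g"
  shows "smooth_on S (\<lambda>x. B (f x) (g x))"
proof -
  have "C_inf UNIV (\<lambda>p. B (fst p) (snd p))"
    unfolding C_inf_def
    by (rule allI, rule higher_diff_bilinear[OF B open_UNIV
          higher_diff_bounded_linear[OF bounded_linear_fst open_UNIV]
          higher_diff_bounded_linear[OF bounded_linear_snd open_UNIV]])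
  then have "smooth_on UNIV (\<lambda>p. B (fst p) (snd p))"
    by (rule C_inf_imp_smooth_on[OF open_UNIV])
  from smooth_on_compose[OF this smooth_on_Pair[OF assms(2,3)]] show ?thesis by simp
qed

lemma smooth_on_mult:
  fixes f g :: "'e::euclidean_space \<Rightarrow> real"
  shows "smooth_on S f \<Longrightarrow> smooth_on S g \<Longrightarrow> smooth_on S (\<lambda>x. f x * g x)"
  by (rule smooth_on_bilinear[OF bounded_bilinear_mult])

lemma smooth_on_fst: "smooth_on S f \<Longrightarrow> smooth_on S (\<lambda>x. fst (f x))"
  by (rule smooth_on_bounded_linear_image[OF bounded_linear_fst])

lemma smooth_on_snd: "smooth_on S f \<Longrightarrow> smooth_on S (\<lambda>x. snd (f x))"
  by (rule smooth_on_bounded_linear_image[OF bounded_linear_snd])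

lemma smooth_on_ident: "smooth_on S (\<lambda>x. x)"
  by (rule smooth_on_bounded_linear[OF bounded_linear_ident])

lemma smooth_on_powr:
  fixes f :: "'e::euclidean_space \<Rightarrow> real"
  assumes "smooth_on S f" "\<And>x. x \<in> S \<Longrightarrow> f x > 0"
  shows "smooth_on S (\<lambda>x. f x powr a)"
proof -
  have "smooth_on {0<..} (\<lambda>x::real. x powr a)"
    by (intro C_inf_imp_smooth_on) (auto simp: C_inf_def higher_diff_powr)
  from smooth_on_compose[OF this assms(1)] show ?thesis using assms(2) by (simp add: image_subset_iff)
qed

section \<open>Directional derivatives within a set\<close>

text \<open>Relatively open subsets of a half-space contain short segments in every coordinate
  direction, which makes derivatives within them unique.\<close>

definition thick :: "'e::euclidean_space set \<Rightarrow> bool" where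
  "thick S \<longleftrightarrow> (\<forall>x\<in>S. \<forall>i\<in>Basis. \<forall>e>0. \<exists>d. 0 < \<bar>d\<bar> \<and> \<bar>d\<bar> < e \<and> x + d *\<^sub>R i \<in> S)"

definition dir_deriv :: "'e::euclidean_space set \<Rightarrow> ('e \<Rightarrow> 'f::euclidean_space) \<Rightarrow> 'e \<Rightarrow> 'e \<Rightarrow> 'f" where
  "dir_deriv S f v x = frechet_derivative f (at x within S) v"

lemma thick_openin:
  assumes "thick H" "openin (top_of_set H) S" shows "thick S"
  unfolding thick_def
proof (intro ballI allI impI)
  fix x i :: 'a and e :: real assume x: "x \<in> S" and i: "i \<in> Basis" and e: "e > 0"
  obtain T where T: "open T" "S = H \<inter> T" using assms(2) by (auto simp: openin_open)
  then obtain r where r: "r > 0" "ball x r \<subseteq> T" using x openE by blast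
  obtain d where d: "0 < \<bar>d\<bar>" "\<bar>d\<bar> < min e r" "x + d *\<^sub>R i \<in> H"
  proof -
    have "x \<in> H" "0 < min e r" using x T e r by auto
    then show thesis using assms(1) i that unfolding thick_def by blast
  qed
  then have "x + d *\<^sub>R i \<in> ball x r" using i by (simp add: dist_norm)
  then show "\<exists>d. 0 < \<bar>d\<bar> \<and> \<bar>d\<bar> < e \<and> x + d *\<^sub>R i \<in> S"
    using d r T by (intro exI[of _ d]) auto
qed

lemma thick_UNIV: "thick UNIV"
  unfolding thick_def
proof (intro ballI allI impI)
  fix x i :: 'a and e :: real assume "e > 0"
  then show "\<exists>d. 0 < \<bar>d\<bar> \<and> \<bar>d\<bar> < e \<and> x + d *\<^sub>R i \<in> UNIV" by (intro exI[of _ "e / 2"]) simp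
qed

lemma thick_open: "open S \<Longrightarrow> thick S"
  using thick_openin[OF thick_UNIV] by simp

lemma thick_halfspace: "thick (halfspace :: (real \<times> 'b::euclidean_space) set)"
  unfolding thick_def
proof (intro ballI allI impI)
  fix x i :: "real \<times> 'b" and e :: real assume x: "x \<in> halfspace" and i: "i \<in> Basis" and "e > 0"
  have "0 \<le> fst i" using i by (auto simp: Basis_prod_def)
  then show "\<exists>d. 0 < \<bar>d\<bar> \<and> \<bar>d\<bar> < e \<and> x + d *\<^sub>R i \<in> halfspace"
    using x \<open>e > 0\<close> by (intro exI[of _ "e / 2"]) (auto simp: halfspace_def)
qed

lemma dir_deriv_eq:
  assumes "thick S" "x \<in> S" "(f has_derivative f') (at x within S)"
  shows "dir_deriv S f v x = f' v"
proof -
  have "(f has_derivative frechet_derivative f (at x within S)) (at x within S)"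
    using assms(3) differentiableI frechet_derivative_works by blast
  then have "frechet_derivative f (at x within S) = f'"
    by (rule frechet_derivative_unique_within[OF _ assms(3)]) (use assms(1,2) in \<open>auto simp: thick_def\<close>)
  then show ?thesis by (simp add: dir_deriv_def)
qed

lemma has_derivative_within_openin_iff:
  assumes "openin (top_of_set S) W" "x \<in> W"
  shows "(f has_derivative f') (at x within W) \<longleftrightarrow> (f has_derivative f') (at x within S)"
proof -
  obtain T where T: "open T" "W = S \<inter> T" using assms(1) by (auto simp: openin_open)
  then have "at x within W = at x within S"
    using assms(2) by (intro at_within_nhd[of x T]) auto
  then show ?thesis by simp
qed

lemma smooth_on_extension_derivative:
  assumes "thick S" "x \<in> S \<inter> T" "open T" "C_inf T g" "\<forall>y\<in>S \<inter> T. f y = g y"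
  shows "(f has_derivative frechet_derivative g (at x)) (at x within S)"
proof -
  have "(g has_derivative frechet_derivative g (at x)) (at x within S \<inter> T)"
    using C_inf_has_derivative[OF assms(4)] assms(2) has_derivative_at_withinI by blast
  then have "(f has_derivative frechet_derivative g (at x)) (at x within S \<inter> T)"
    using assms(2,5) by (intro has_derivative_transform[of x _ f g]) auto
  moreover have "openin (top_of_set S) (S \<inter> T)" using assms(3) by blast
  ultimately show ?thesis
    using has_derivative_within_openin_iff[of S "S \<inter> T" x] assms(2) by blast
qed

lemma smooth_on_has_derivative:
  assumes "thick S" "smooth_on S f" "x \<in> S"
  shows "(f has_derivative (\<lambda>v. dir_deriv S f v x)) (at x within S)"
proof -
  obtain T g where "open T" "x \<in> T" "C_inf T g" "\<forall>y\<in>S \<inter> T. f y = g y"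
    by (rule smooth_onE[OF assms(2,3)])
  then have "f differentiable (at x within S)"
    using smooth_on_extension_derivative[OF assms(1), of x T g f] assms(3) differentiableI by blast
  then show ?thesis unfolding dir_deriv_def using frechet_derivative_works by blast
qed

lemma smooth_on_dir_deriv:
  assumes "thick S" "smooth_on S f"
  shows "smooth_on S (dir_deriv S f v)"
proof (rule smooth_onI)
  fix x assume x: "x \<in> S"
  obtain T g where T: "open T" "x \<in> T" "C_inf T g" "\<forall>y\<in>S \<inter> T. f y = g y"
    by (rule smooth_onE[OF assms(2) x])
  have "dir_deriv S f v y = frechet_derivative g (at y) v" if "y \<in> S \<inter> T" for y
    using dir_deriv_eq[OF assms(1) _ smooth_on_extension_derivative[OF assms(1) that T(1,3,4)]] that
    by blast
  then show "\<exists>T h. open T \<and> x \<in> T \<and> C_inf T h \<and> (\<forall>y\<in>S \<inter> T. dir_deriv S f v y = h y)"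
    using T(1,2) C_inf_derivative[OF T(3), of v]
    by (intro exI[of _ T] exI[of _ "\<lambda>y. frechet_derivative g (at y) v"]) blast
qed

lemma dir_deriv_cong_openin:
  assumes "thick S" "openin (top_of_set S) W" "x \<in> W" "smooth_on W g" "\<And>y. y \<in> W \<Longrightarrow> f y = g y"
  shows "dir_deriv S f v x = dir_deriv W g v x"
proof -
  have W: "thick W" by (rule thick_openin[OF assms(1,2)])
  have "(g has_derivative (\<lambda>v. dir_deriv W g v x)) (at x within W)"
    by (rule smooth_on_has_derivative[OF W assms(4,3)])
  then have "(f has_derivative (\<lambda>v. dir_deriv W g v x)) (at x within W)"
    by (rule has_derivative_transform[OF assms(3), rotated]) (rule assms(5))
  then have "(f has_derivative (\<lambda>v. dir_deriv W g v x)) (at x within S)"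
    using has_derivative_within_openin_iff[OF assms(2,3)] by blast
  moreover have "x \<in> S" using openin_imp_subset[OF assms(2)] assms(3) by blast
  ultimately show ?thesis by (intro dir_deriv_eq[OF assms(1)])
qed

lemma dir_deriv_cong:
  assumes "\<And>y. y \<in> S \<Longrightarrow> f y = g y" "x \<in> S"
  shows "dir_deriv S f v x = dir_deriv S g v x"
proof -
  have "(f has_derivative L) (at x within S) \<longleftrightarrow> (g has_derivative L) (at x within S)" for L
  proof
    show "(g has_derivative L) (at x within S)" if "(f has_derivative L) (at x within S)"
      by (rule has_derivative_transform[OF assms(2) _ that]) (simp add: assms(1))
    show "(f has_derivative L) (at x within S)" if "(g has_derivative L) (at x within S)"
      by (rule has_derivative_transform[OF assms(2) _ that]) (simp add: assms(1))
  qed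
  then show ?thesis by (simp add: dir_deriv_def frechet_derivative_def)
qed

lemma dir_deriv_linear:
  assumes "thick S" "smooth_on S f" "x \<in> S"
  shows "linear (\<lambda>v. dir_deriv S f v x)"
  using smooth_on_has_derivative[OF assms] has_derivative_linear by blast

lemma dir_deriv_plane:
  fixes f :: "real \<times> real \<Rightarrow> 'f::euclidean_space"
  assumes "thick S" "smooth_on S f" "x \<in> S"
  shows "dir_deriv S f v x = fst v *\<^sub>R dir_deriv S f (1, 0) x + snd v *\<^sub>R dir_deriv S f (0, 1) x"
proof -
  have v: "v = fst v *\<^sub>R (1, 0) + snd v *\<^sub>R (0, 1)" by (simp add: prod_eq_iff)
  have "dir_deriv S f (fst v *\<^sub>R (1, 0) + snd v *\<^sub>R (0, 1)) x
      = fst v *\<^sub>R dir_deriv S f (1, 0) x + snd v *\<^sub>R dir_deriv S f (0, 1) x"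
    using linear_add[OF dir_deriv_linear[OF assms], of "fst v *\<^sub>R (1, 0)" "snd v *\<^sub>R (0, 1)"]
      linear_scale[OF dir_deriv_linear[OF assms], of "fst v" "(1, 0)"]
      linear_scale[OF dir_deriv_linear[OF assms], of "snd v" "(0, 1)"]
    by (simp only:)
  then show ?thesis using arg_cong[OF v, of "\<lambda>v. dir_deriv S f v x"] by (rule trans[rotated])
qed

lemma dir_deriv_compose:
  assumes "thick S" "thick T" "smooth_on S g" "smooth_on T f" "g ` S \<subseteq> T" "x \<in> S"
  shows "dir_deriv S (\<lambda>x. f (g x)) v x = dir_deriv T f (dir_deriv S g v x) (g x)"
proof -
  have "g x \<in> T" using assms by blast
  have "(f has_derivative (\<lambda>v. dir_deriv T f v (g x))) (at (g x) within g ` S)"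
    by (rule has_derivative_subset[OF smooth_on_has_derivative[OF assms(2,4) \<open>g x \<in> T\<close>] assms(5)])
  from has_derivative_in_compose[OF smooth_on_has_derivative[OF assms(1,3,6)] this]
  show ?thesis by (rule dir_deriv_eq[OF assms(1,6)])
qed

lemma dir_deriv_open: "open S \<Longrightarrow> x \<in> S \<Longrightarrow> dir_deriv S f v x = frechet_derivative f (at x) v"
  by (simp add: dir_deriv_def at_within_open_NO_MATCH)

section \<open>Bump functions\<close>

text \<open>The functions \<open>x \<mapsto> x\<^sup>-\<^sup>k e\<^sup>-\<^sup>1\<^sup>/\<^sup>x\<close>, extended by \<open>0\<close>: the derivative of each is a linear
  combination of the next two, so that all of them are smooth.\<close>

definition flat_exp :: "nat \<Rightarrow> real \<Rightarrow> real" where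
  "flat_exp k x = (if x > 0 then inverse x ^ k * exp (- inverse x) else 0)"

lemma flat_exp_pos: "x > 0 \<Longrightarrow> flat_exp k x > 0"
  and flat_exp_nonneg: "0 \<le> flat_exp k x"
  and flat_exp_nonpos: "x \<le> 0 \<Longrightarrow> flat_exp k x = 0"
  by (auto simp: flat_exp_def)

lemma flat_exp_DERIV:
  "(flat_exp k has_real_derivative flat_exp (k + 2) x - real k * flat_exp (k + 1) x) (at x)"
proof (cases x "0::real" rule: linorder_cases)
  case less
  then have "((\<lambda>_. 0) has_real_derivative 0) (at x)" by simp
  moreover have "(flat_exp k has_real_derivative 0) (at x)"
    by (rule has_field_derivative_transform_within_open[OF \<open>((\<lambda>_. 0) has_real_derivative 0) (at x)\<close>, of "{..<0}"])
       (use less in \<open>auto simp: flat_exp_def\<close>)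
  ultimately show ?thesis using less by (simp add: flat_exp_def)
next
  case greater
  have "((\<lambda>x. inverse x ^ k * exp (- inverse x)) has_real_derivative
      inverse x ^ (k + 2) * exp (- inverse x) - real k * (inverse x ^ (k + 1) * exp (- inverse x))) (at x)"
  proof -
    have y: "(inverse has_real_derivative - (inverse x ^ 2)) (at x)"
      using greater DERIV_inverse[of x UNIV] by (simp add: numeral_2_eq_2)
    show ?thesis
      by (rule DERIV_cong[OF DERIV_mult[OF DERIV_power[OF y, of k]
              DERIV_chain2[OF DERIV_exp DERIV_minus[OF y]]]])
         (cases k; simp add: algebra_simps power2_eq_square)
  qed
  then have "(flat_exp k has_real_derivative
      inverse x ^ (k + 2) * exp (- inverse x) - real k * (inverse x ^ (k + 1) * exp (- inverse x))) (at x)"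
    by (rule has_field_derivative_transform_within_open[of _ _ _ "{0<..}"])
       (use greater in \<open>auto simp: flat_exp_def\<close>)
  then show ?thesis using greater by (simp add: flat_exp_def)
next
  case equal
  have "((\<lambda>h. flat_exp k h / h) \<longlongrightarrow> 0) (at 0)"
    unfolding filterlim_at_split
  proof
    have "\<forall>\<^sub>F h in at_left 0. (0::real) = flat_exp k h / h"
      unfolding eventually_at_filter by (auto simp: flat_exp_def intro!: always_eventually)
    then show "((\<lambda>h. flat_exp k h / h) \<longlongrightarrow> 0) (at_left 0)"
      by (rule tendsto_eventually[OF eventually_mono]) simp
    have "((\<lambda>h::real. inverse h ^ (k + 1) / exp (inverse h)) \<longlongrightarrow> 0) (at_right 0)"
      by (rule filterlim_compose[OF tendsto_power_div_exp_0 filterlim_inverse_at_top_right])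
    moreover have "\<forall>\<^sub>F h in at_right 0. inverse h ^ (k + 1) / exp (inverse h) = flat_exp k h / h"
      unfolding eventually_at_filter
      by (auto simp: flat_exp_def exp_minus field_simps intro!: always_eventually)
    ultimately show "((\<lambda>h. flat_exp k h / h) \<longlongrightarrow> 0) (at_right 0)"
      by (rule Lim_transform_eventually)
  qed
  then have "(flat_exp k has_real_derivative 0) (at 0)"
    by (simp add: has_field_derivative_iff flat_exp_nonpos)
  then show ?thesis using equal by (simp add: flat_exp_nonpos)
qed

lemma C_inf_flat_exp: "C_inf UNIV (flat_exp k)"
  unfolding C_inf_def
proof
  fix n show "higher_differentiable_on UNIV (flat_exp k) n"
  proof (induction n arbitrary: k)
    case 0
    show ?case unfolding higher_differentiable_on.simps
      using flat_exp_DERIV DERIV_isCont by (intro continuous_at_imp_continuous_on) blast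
  next
    case (Suc n)
    show ?case
    proof (rule higher_diff_SucI[OF open_UNIV])
      show "(flat_exp k has_derivative
          (\<lambda>v. (flat_exp (k + 2) x + (- real k) * flat_exp (k + 1) x) * v)) (at x)" for x
        using flat_exp_DERIV[of k x] by (simp add: has_field_derivative_def)
      have "higher_differentiable_on UNIV (\<lambda>x. flat_exp (k + 2) x + (- real k) * flat_exp (k + 1) x) n"
        by (rule higher_diff_add[OF open_UNIV Suc.IH
              higher_diff_bounded_linear_image[OF bounded_linear_mult_right open_UNIV Suc.IH]])
      from higher_diff_bounded_linear_image[OF bounded_linear_mult_left open_UNIV this]
      show "higher_differentiable_on UNIV
          (\<lambda>x. (flat_exp (k + 2) x + (- real k) * flat_exp (k + 1) x) * v) n" for v .
    qed
  qed
qed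

text \<open>The quotient \<open>p / (p + q)\<close> where \<open>p\<close> vanishes outside the large ball and \<open>q\<close> inside the
  small one; since the small ball lies inside the large one they never vanish together.\<close>

lemma bump_exists:
  fixes z :: "'a::euclidean_space"
  assumes "0 < a" "a < b"
  obtains \<beta> :: "'a \<Rightarrow> real" where "smooth_on UNIV \<beta>" "\<And>x. 0 \<le> \<beta> x"
    "\<And>x. x \<in> cball z a \<Longrightarrow> \<beta> x = 1" "\<And>x. x \<notin> ball z b \<Longrightarrow> \<beta> x = 0"
proof -
  define n where "n x = (x - z) \<bullet> (x - z)" for x
  define p q where "p x = flat_exp 0 (b\<^sup>2 + (- 1) * n x)" and "q x = flat_exp 0 (n x + (- (a\<^sup>2)))" for x
  define \<beta> where "\<beta> x = p x * (p x + q x) powr (- 1)" for x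
  have sub: "smooth_on UNIV (\<lambda>x. x + (- z))"
    by (intro smooth_on_add smooth_on_ident smooth_on_const)
  have n: "smooth_on UNIV n"
    using smooth_on_bilinear[OF bounded_bilinear_inner sub sub] by (simp add: n_def[abs_def])
  have b: "smooth_on UNIV (flat_exp 0)"
    by (rule C_inf_imp_smooth_on[OF open_UNIV C_inf_flat_exp])
  have "smooth_on UNIV (\<lambda>x. b\<^sup>2 + (- 1) * n x)"
    by (rule smooth_on_add[OF smooth_on_const smooth_on_mult[OF smooth_on_const n]])
  from smooth_on_compose[OF b this] have p: "smooth_on UNIV p" by (simp add: p_def[abs_def])
  have "smooth_on UNIV (\<lambda>x. n x + (- (a\<^sup>2)))"
    by (rule smooth_on_add[OF n smooth_on_const])
  from smooth_on_compose[OF b this] have q: "smooth_on UNIV q" by (simp add: q_def[abs_def])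
  have n_dist: "n x = (dist z x)\<^sup>2" for x
    by (simp add: n_def dist_norm norm_minus_commute power2_norm_eq_inner)
  have "a\<^sup>2 < b\<^sup>2" using assms by (simp add: power_strict_mono)
  have pos: "p x + q x > 0" for x
  proof (cases "n x < b\<^sup>2")
    case True
    then show ?thesis using flat_exp_pos[of "b\<^sup>2 + (- 1) * n x" 0] flat_exp_nonneg[of 0]
      by (simp add: p_def q_def add_pos_nonneg)
  next
    case False
    then have "n x + (- (a\<^sup>2)) > 0" using \<open>a\<^sup>2 < b\<^sup>2\<close> by linarith
    then show ?thesis using flat_exp_pos[of "n x + (- (a\<^sup>2))" 0] flat_exp_nonneg[of 0]
      unfolding p_def q_def by (intro add_nonneg_pos) auto
  qed
  show thesis
  proof
    show "smooth_on UNIV \<beta>"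
      unfolding \<beta>_def[abs_def] by (intro smooth_on_mult p smooth_on_powr smooth_on_add q) (use pos in auto)
    show "0 \<le> \<beta> x" for x
      unfolding \<beta>_def p_def using flat_exp_nonneg by simp
    show "\<beta> x = 1" if "x \<in> cball z a" for x
    proof -
      have "n x \<le> a\<^sup>2" unfolding n_dist using that assms(1) by (intro power_mono) auto
      then have "q x = 0" by (simp add: q_def flat_exp_nonpos)
      then show ?thesis using pos[of x] by (simp add: \<beta>_def powr_minus_divide)
    qed
    show "\<beta> x = 0" if "x \<notin> ball z b" for x
    proof -
      have "b\<^sup>2 \<le> n x" unfolding n_dist using that assms by (intro power_mono) auto
      then show ?thesis by (simp add: \<beta>_def p_def flat_exp_nonpos)
    qed
  qed
qed

lemma bounded_dir_deriv_if_compact_support: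
  fixes f :: "'a::euclidean_space \<Rightarrow> real"
  assumes f: "smooth_on UNIV f" and supp: "\<And>x. x \<notin> ball z b \<Longrightarrow> f x = 0"
  obtains L where "L > 0" "\<And>x v. \<bar>dir_deriv UNIV f v x\<bar> \<le> L * norm v"
proof -
  have "\<exists>M. \<forall>x. \<bar>dir_deriv UNIV f i x\<bar> \<le> M" for i
  proof -
    have "continuous_on (cball z b) (dir_deriv UNIV f i)"
      using smooth_on_continuous_on[OF smooth_on_dir_deriv[OF thick_UNIV f]] continuous_on_subset by blast
    then have "bounded (dir_deriv UNIV f i ` cball z b)"
      using compact_continuous_image compact_imp_bounded compact_cball by blast
    then obtain M where M: "\<forall>x\<in>cball z b. \<bar>dir_deriv UNIV f i x\<bar> \<le> M"
      unfolding bounded_iff by auto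
    have "\<bar>dir_deriv UNIV f i x\<bar> \<le> max M 0" for x
    proof (cases "x \<in> cball z b")
      case False
      have "openin (top_of_set UNIV) (- cball z b)" by (simp add: open_Compl)
      then have "dir_deriv UNIV f i x = dir_deriv (- cball z b) (\<lambda>_. 0) i x"
        by (rule dir_deriv_cong_openin[OF thick_UNIV _ _ smooth_on_const])
           (use False supp ball_subset_cball in \<open>auto simp: subset_iff\<close>)
      also have "\<dots> = 0"
        by (rule dir_deriv_eq[OF thick_open]) (use False in \<open>auto simp: open_Compl\<close>)
      finally show ?thesis by simp
    qed (use M in force)
    then show ?thesis by blast
  qed
  then obtain M where M: "\<And>i x. \<bar>dir_deriv UNIV f i x\<bar> \<le> M i" by metis
  define L where "L = (\<Sum>i\<in>Basis. M i) + 1"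
  have M0: "0 \<le> M i" for i using M[of i 0] by linarith
  show thesis
  proof
    show "L > 0" unfolding L_def using M0 by (simp add: add_nonneg_pos sum_nonneg)
    fix x v
    have lin: "linear (\<lambda>v. dir_deriv UNIV f v x)"
      by (rule dir_deriv_linear[OF thick_UNIV f UNIV_I])
    have "dir_deriv UNIV f v x = dir_deriv UNIV f (\<Sum>i\<in>Basis. (v \<bullet> i) *\<^sub>R i) x"
      by (simp only: euclidean_representation)
    also have "\<dots> = (\<Sum>i\<in>Basis. (v \<bullet> i) * dir_deriv UNIV f i x)"
      using linear_sum[OF lin, of "\<lambda>i. (v \<bullet> i) *\<^sub>R i" Basis] by (simp add: linear_cmul[OF lin])
    finally have "\<bar>dir_deriv UNIV f v x\<bar> \<le> (\<Sum>i\<in>Basis. \<bar>(v \<bullet> i) * dir_deriv UNIV f i x\<bar>)"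
      using sum_abs by metis
    also have "\<dots> \<le> (\<Sum>i\<in>Basis. norm v * M i)"
      unfolding abs_mult using M Basis_le_norm by (intro sum_mono mult_mono) auto
    also have "\<dots> = norm v * (\<Sum>i\<in>Basis. M i)" by (simp only: sum_distrib_left)
    also have "\<dots> \<le> L * norm v" unfolding L_def by (simp add: algebra_simps)
    finally show "\<bar>dir_deriv UNIV f v x\<bar> \<le> L * norm v" .
  qed
qed

lemma contraction_zero:
  assumes "norm x \<le> q * norm x" "q < 1" shows "x = 0"
proof (rule ccontr)
  assume "x \<noteq> 0"
  then have "q * norm x < 1 * norm x" by (intro mult_strict_right_mono assms(2)) simp
  then show False using assms(1) by simp
qed

text \<open>A bump with small gradient perturbs the identity to a diffeomorphism: the displacement
  is a contraction, and so is its derivative.\<close>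

lemma bump_translation:
  fixes \<psi> :: "'a::euclidean_space \<Rightarrow> real"
  assumes \<psi>: "smooth_on UNIV \<psi>" and L: "\<And>x v. \<bar>dir_deriv UNIV \<psi> v x\<bar> \<le> L * norm v"
    and v: "L * norm v < 1"
  defines "k \<equiv> \<lambda>x. x + \<psi> x *\<^sub>R v"
  shows "smooth_on UNIV k" "inj k" "\<And>x. surj (\<lambda>w. dir_deriv UNIV k w x)"
proof -
  have der: "(\<psi> has_derivative (\<lambda>w. dir_deriv UNIV \<psi> w x)) (at x)" for x
    using smooth_on_has_derivative[OF thick_UNIV \<psi> UNIV_I] .
  show "smooth_on UNIV k"
    unfolding k_def
    by (rule smooth_on_add[OF smooth_on_ident
          smooth_on_bounded_linear_image[OF bounded_linear_scaleR_left \<psi>]])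
  have lipschitz: "\<bar>\<psi> x - \<psi> y\<bar> \<le> L * norm (x - y)" for x y
    using differentiable_bound[OF convex_UNIV der, of L x y] L
    by (simp add: onorm_le)
  show "inj k"
  proof (rule injI)
    fix x y assume "k x = k y"
    then have "x - y = (\<psi> y - \<psi> x) *\<^sub>R v" unfolding k_def by (simp add: algebra_simps)
    then have "norm (x - y) = \<bar>\<psi> y - \<psi> x\<bar> * norm v" by (metis norm_scaleR)
    also have "\<dots> \<le> (L * norm (x - y)) * norm v"
      using lipschitz[of x y] by (intro mult_right_mono) (auto simp: abs_minus_commute)
    finally have "norm (x - y) \<le> (L * norm v) * norm (x - y)" by (simp add: mult.commute mult.left_commute)
    then have "x - y = 0" by (rule contraction_zero[OF _ v])
    then show "x = y" by simp
  qed
  fix x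
  have dk: "dir_deriv UNIV k w x = w + dir_deriv UNIV \<psi> w x *\<^sub>R v" for w
    unfolding k_def
    by (rule dir_deriv_eq[OF thick_UNIV UNIV_I]) (auto intro!: derivative_eq_intros der)
  have lin: "linear (\<lambda>w. dir_deriv UNIV k w x)"
    by (rule dir_deriv_linear[OF thick_UNIV \<open>smooth_on UNIV k\<close> UNIV_I])
  have "inj (\<lambda>w. dir_deriv UNIV k w x)"
  proof (rule linear_injective_0[OF lin, THEN iffD2], intro allI impI)
    fix w assume "dir_deriv UNIV k w x = 0"
    then have "norm w = norm (dir_deriv UNIV \<psi> w x *\<^sub>R v)"
      unfolding dk by (metis add_eq_0_iff norm_minus_cancel)
    also have "\<dots> \<le> (L * norm w) * norm v"
      using L[of w x] by (simp add: mult_right_mono)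
    finally have "norm w \<le> (L * norm v) * norm w" by (simp add: mult.commute mult.left_commute)
    then show "w = 0" by (rule contraction_zero[OF _ v])
  qed
  then show "surj (\<lambda>w. dir_deriv UNIV k w x)"
    by (rule linear_injective_imp_surjective[OF lin]) (rule refl)
qed

section \<open>Sard's theorem in the plane, isolated zeros\<close>

text \<open>Sard's theorem for maps between spaces of equal dimension, transported from \<open>real ^ 2\<close>. A negligible set contains no disc, hence small regular values exist.\<close>

lemma Sard_plane:
  fixes G :: "real \<times> real \<Rightarrow> real \<times> real"
  assumes der: "\<And>x. x \<in> S \<Longrightarrow> (G has_derivative G' x) (at x within S)"
    and sing: "\<And>x. x \<in> S \<Longrightarrow> \<exists>w. w \<noteq> 0 \<and> G' x w = 0" and "e > 0"
  obtains t where "norm t < e" "t \<notin> G ` S"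
proof -
  define j :: "real^2 \<Rightarrow> real \<times> real" where "j w = (w $ 1, w $ 2)" for w
  define h :: "real \<times> real \<Rightarrow> real^2" where "h p = (\<chi> i. if i = 1 then fst p else snd p)" for p
  have jh: "j (h p) = p" and hj: "h (j w) = w" for p w
    by (auto simp: j_def h_def vec_eq_iff forall_2)
  have j: "bounded_linear j" unfolding j_def[abs_def] linear_conv_bounded_linear[symmetric]
    by (rule linearI) auto
  have h: "bounded_linear h" unfolding h_def[abs_def] linear_conv_bounded_linear[symmetric]
    by (rule linearI) (auto simp: vec_eq_iff)
  define F where "F w = h (G (j w))" for w
  define F' where "F' w u = h (G' (j w) (j u))" for w u
  have derF: "(F has_derivative F' w) (at w within h ` S)" if "w \<in> h ` S" for w
  proof -
    have "j w \<in> S" and jS: "j ` h ` S = S" using that jh by (auto simp: image_image)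
    then have "(G has_derivative G' (j w)) (at (j w) within j ` h ` S)" using der by simp
    from has_derivative_in_compose[OF bounded_linear_imp_has_derivative[OF j] this]
    have "((\<lambda>w. G (j w)) has_derivative (\<lambda>u. G' (j w) (j u))) (at w within h ` S)" .
    from bounded_linear.has_derivative[OF h this]
    show ?thesis unfolding F_def[abs_def] F'_def[abs_def] .
  qed
  have "negligible (F ` h ` S)"
  proof (rule baby_Sard[OF _ derF])
    fix w assume w: "w \<in> h ` S"
    then obtain u where u: "u \<noteq> 0" "G' (j w) u = 0" using sing[of "j w"] jh by auto
    have lin: "linear (F' w)" using derF[OF w] has_derivative_linear by blast
    have "h 0 = 0" "j 0 = 0"
      using linear_0[OF bounded_linear.linear[OF h]] linear_0[OF bounded_linear.linear[OF j]] .
    have "F' w (h u) = 0" unfolding F'_def jh u(2) by (rule \<open>h 0 = 0\<close>)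
    moreover have "h u \<noteq> 0"
    proof
      assume "h u = 0"
      then have "j (h u) = j 0" by (rule arg_cong)
      then show False using u(1) \<open>j 0 = 0\<close> by (simp only: jh)
    qed
    ultimately have "\<not> inj (F' w)" unfolding linear_injective_0[OF lin] by blast
    moreover have "(*v) (matrix (F' w)) = F' w" by (rule ext, rule matrix_works) (use lin in \<open>simp add: linear_matrix_vector_mul_eq\<close>)
    ultimately have "\<not> inj ((*v) (matrix (F' w)))" by simp
    then show "rank (matrix (F' w)) < CARD(2)" by (rule less_rank_noninjective[THEN iffD2])
  qed simp
  moreover have "\<not> negligible {w. norm (j w) < e}"
  proof (rule open_not_negligible)
    have "continuous_on UNIV (\<lambda>w. norm (j w))"
      by (rule continuous_on_norm[OF linear_continuous_on[OF j]])
    then show "open {w. norm (j w) < e}"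
      by (rule open_Collect_less[OF _ continuous_on_const])
    have "norm (j 0) < e" using \<open>e > 0\<close> linear_0[OF bounded_linear.linear[OF j]] by simp
    then show "{w. norm (j w) < e} \<noteq> {}" by blast
  qed
  ultimately have "\<not> {w. norm (j w) < e} \<subseteq> F ` h ` S"
    using negligible_subset[of "F ` h ` S" "{w. norm (j w) < e}"] by blast
  then obtain w where w: "norm (j w) < e" "w \<notin> F ` h ` S" by blast
  have "j w \<notin> G ` S"
  proof
    assume "j w \<in> G ` S"
    then obtain x where "x \<in> S" "j w = G x" by blast
    then have "w = F (h x)" unfolding F_def jh by (metis hj)
    then show False using w(2) \<open>x \<in> S\<close> by blast
  qed
  then show thesis using that w(1) by blast
qed

lemma singular_2x2:
  fixes a b a' b' :: real
  shows "(\<exists>w. w \<noteq> 0 \<and> fst w * a + snd w * b = 0 \<and> fst w * a' + snd w * b' = 0) \<longleftrightarrow> a * b' - b * a' = 0"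
    (is "?L \<longleftrightarrow> ?R")
proof
  assume ?L
  then obtain w where w: "w \<noteq> 0" "fst w * a + snd w * b = 0" "fst w * a' + snd w * b' = 0" by blast
  have "fst w * (a * b' - b * a') = b' * (fst w * a + snd w * b) - b * (fst w * a' + snd w * b')"
    "snd w * (a * b' - b * a') = a * (fst w * a' + snd w * b') - a' * (fst w * a + snd w * b)"
    by (simp_all add: algebra_simps)
  then have "fst w * (a * b' - b * a') = 0" "snd w * (a * b' - b * a') = 0"
    unfolding w(2,3) by simp_all
  then show ?R using w(1) by (auto simp: prod_eq_iff)
next
  assume det: ?R
  show ?L
  proof (cases "a = 0 \<and> b = 0")
    case True
    then show ?thesis
      by (intro exI[of _ "if a' = 0 \<and> b' = 0 then (1, 0) else (b', - a')"]) (auto simp: zero_prod_def)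
  next
    case False
    then show ?thesis using det
      by (intro exI[of _ "(b, - a)"]) (auto simp: zero_prod_def algebra_simps)
  qed
qed

text \<open>An injective derivative is bounded below by a multiple of the norm, and this dominates the error of the
  linear approximation near the zero.\<close>

lemma isolated_zero:
  fixes G :: "'a::euclidean_space \<Rightarrow> 'b::euclidean_space"
  assumes "(G has_derivative G') (at x within S)" "inj G'" "G x = 0"
  obtains d where "d > 0" "\<And>y. y \<in> S \<Longrightarrow> y \<noteq> x \<Longrightarrow> dist y x < d \<Longrightarrow> G y \<noteq> 0"
proof -
  obtain B where B: "B > 0" "\<And>w. B * norm w \<le> norm (G' w)"
    using linear_inj_bounded_below_pos[OF has_derivative_linear[OF assms(1)] assms(2)] by blast
  from assms(1)[unfolded has_derivative_within_alt, THEN conjunct2, rule_format, of "B / 2"] B(1)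
  obtain d where d: "d > 0" "\<And>y. y \<in> S \<Longrightarrow> norm (y - x) < d \<Longrightarrow>
      norm (G y - G x - G' (y - x)) \<le> B / 2 * norm (y - x)"
    by auto
  show thesis
  proof
    fix y assume y: "y \<in> S" "y \<noteq> x" "dist y x < d"
    show "G y \<noteq> 0"
    proof
      assume "G y = 0"
      then have "norm (G' (y - x)) \<le> B / 2 * norm (y - x)"
        using d(2)[of y] y assms(3) by (simp add: dist_norm)
      then have "B * norm (y - x) \<le> B / 2 * norm (y - x)" using B(2) order_trans by blast
      then show False using B(1) y(2) by simp
    qed
  qed (rule d(1))
qed

section \<open>The Morse lemma in dimension one\<close>

lemma C_inf_DERIV:
  fixes f :: "real \<Rightarrow> real"
  assumes "C_inf S f" "x \<in> S"
  shows "(f has_real_derivative frechet_derivative f (at x) 1) (at x)"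
proof -
  have D: "(f has_derivative frechet_derivative f (at x)) (at x)"
    by (rule C_inf_has_derivative[OF assms])
  have "frechet_derivative f (at x) v = frechet_derivative f (at x) 1 * v" for v
    using linear_scale[OF has_derivative_linear[OF D], of v 1] by simp
  then have "frechet_derivative f (at x) = (*) (frechet_derivative f (at x) 1)" by (rule ext)
  then show ?thesis using D unfolding has_field_derivative_def by simp
qed

lemma segment_in_ball:
  fixes y :: real
  assumes "y \<in> ball y0 d" "t \<in> {0..1}" shows "y0 + t * (y - y0) \<in> ball y0 d"
proof -
  have "\<bar>t * (y - y0)\<bar> \<le> \<bar>y - y0\<bar>" using assms(2) by (simp add: abs_mult mult_left_le_one_le)
  then show ?thesis using assms(1) by (simp add: dist_real_def)
qed

text \<open>Differentiating under the integral sign replaces the weight \<open>w t\<close> by \<open>w t * t\<close> and \<open>q\<close> by its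
  derivative, so that the integrals of this form are closed under differentiation.\<close>

lemma C_inf_parametric_integral:
  fixes q :: "real \<Rightarrow> real"
  assumes q: "C_inf (ball y0 d) q" and w: "continuous_on {0..1} w"
  shows "C_inf (ball y0 d) (\<lambda>y. integral {0..1} (\<lambda>t. w t * q (y0 + t * (y - y0))))"
  unfolding C_inf_def
proof
  fix n
  let ?J = "\<lambda>w q y. integral {0..1} (\<lambda>t. w t * q (y0 + t * (y - y0)))"
  let ?F = "{?J w q | w q. continuous_on {0..1} w \<and> C_inf (ball y0 d) q}"
  have closed: "\<exists>f'\<in>?F. \<forall>y\<in>ball y0 d. (f has_real_derivative f' y) (at y)" if "f \<in> ?F" for f
  proof -
    obtain w q where f: "f = ?J w q" and w: "continuous_on {0..1} w" and q: "C_inf (ball y0 d) q"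
      using \<open>f \<in> ?F\<close> unfolding mem_Collect_eq by (elim exE conjE)
    define q' where "q' x = frechet_derivative q (at x) 1" for x
    have q': "C_inf (ball y0 d) q'" unfolding q'_def[abs_def] by (rule C_inf_derivative[OF q])
    have w': "continuous_on {0..1} (\<lambda>t. w t * t)" by (intro continuous_intros w)
    have "(f has_real_derivative ?J (\<lambda>t. w t * t) q' y) (at y)" if y: "y \<in> ball y0 d" for y
    proof -
      have "((\<lambda>y. integral (cbox 0 1) (\<lambda>t. w t * q (y0 + t * (y - y0)))) has_field_derivative
          integral (cbox 0 1) (\<lambda>t. w t * t * q' (y0 + t * (y - y0)))) (at y within ball y0 d)"
      proof (rule leibniz_rule_field_derivative[OF _ _ _ y convex_ball])
        fix x t :: real assume x: "x \<in> ball y0 d" and t: "t \<in> cbox 0 1"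
        have "(q has_real_derivative q' (y0 + t * (x - y0))) (at (y0 + t * (x - y0)))"
          unfolding q'_def by (rule C_inf_DERIV[OF q]) (use segment_in_ball[OF x] t in simp)
        moreover have "((\<lambda>x. y0 + t * (x - y0)) has_real_derivative t) (at x)"
          by (auto intro!: derivative_eq_intros)
        ultimately have "((\<lambda>x. q (y0 + t * (x - y0))) has_real_derivative q' (y0 + t * (x - y0)) * t) (at x)"
          by (rule DERIV_chain2)
        from DERIV_cmult[OF this, of "w t"]
        show "((\<lambda>x. w t * q (y0 + t * (x - y0))) has_real_derivative w t * t * q' (y0 + t * (x - y0)))
            (at x within ball y0 d)"
          by (rule DERIV_cong[OF DERIV_subset]) (simp_all add: mult_ac)
      next
        fix x :: real assume x: "x \<in> ball y0 d"
        have "continuous_on {0..1} (\<lambda>t. q (y0 + t * (x - y0)))"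
          by (rule continuous_on_compose2[OF C_inf_continuous_on[OF q]])
             (use segment_in_ball[OF x] in \<open>auto intro!: continuous_intros\<close>)
        then have "continuous_on {0..1} (\<lambda>t. w t * q (y0 + t * (x - y0)))"
          by (intro continuous_on_mult w)
        then show "(\<lambda>t. w t * q (y0 + t * (x - y0))) integrable_on cbox 0 1"
          using integrable_continuous by (simp add: integrable_continuous_real)
      next
        have "continuous_on (ball y0 d \<times> {0..1}) (\<lambda>z. q' (y0 + snd z * (fst z - y0)))"
          by (rule continuous_on_compose2[OF C_inf_continuous_on[OF q']])
             (use segment_in_ball in \<open>auto intro!: continuous_intros\<close>)
        moreover have "continuous_on (ball y0 d \<times> {0..1}) (\<lambda>z. w (snd z) * snd z)"
          by (rule continuous_on_compose2[OF w']) (auto intro!: continuous_intros)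
        ultimately have "continuous_on (ball y0 d \<times> {0..1})
            (\<lambda>z. w (snd z) * snd z * q' (y0 + snd z * (fst z - y0)))"
          by (rule continuous_on_mult[rotated])
        then show "continuous_on (ball y0 d \<times> cbox 0 1) (\<lambda>(x, t). w t * t * q' (y0 + t * (x - y0)))"
          by (simp add: split_beta)
      qed
      then show ?thesis unfolding f using y by (simp add: at_within_open_NO_MATCH)
    qed
    moreover have "?J (\<lambda>t. w t * t) q' \<in> ?F"
      unfolding mem_Collect_eq by (rule exI[of _ "\<lambda>t. w t * t"], rule exI[of _ q'], intro conjI refl w' q')
    ultimately show ?thesis by (intro bexI[of _ "?J (\<lambda>t. w t * t) q'"] ballI)
  qed
  have "?J w q \<in> ?F"
    unfolding mem_Collect_eq by (rule exI[of _ w], rule exI[of _ q], intro conjI refl w q)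
  then show "higher_differentiable_on (ball y0 d) (?J w q) n"
    by (rule higher_diff_if_derivative_closed[OF open_ball closed, rotated])
qed

text \<open>The cofactor is \<open>a y = \<integral> g' (y0 + t (y - y0)) dt\<close> over \<open>[0, 1]\<close>.\<close>

lemma Hadamard_factorization:
  fixes g :: "real \<Rightarrow> real"
  assumes g: "C_inf (ball y0 d) g"
  obtains a where "C_inf (ball y0 d) a" "\<And>y. y \<in> ball y0 d \<Longrightarrow> g y = g y0 + (y - y0) * a y"
proof -
  define g' where "g' x = frechet_derivative g (at x) 1" for x
  define a where "a y = integral {0..1} (\<lambda>t. 1 * g' (y0 + t * (y - y0)))" for y
  have g': "C_inf (ball y0 d) g'" unfolding g'_def[abs_def] by (rule C_inf_derivative[OF g])
  show thesis
  proof
    show "C_inf (ball y0 d) a" unfolding a_def[abs_def]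
      by (rule C_inf_parametric_integral[OF g' continuous_on_const])
    fix y assume y: "y \<in> ball y0 d"
    have "((\<lambda>t. g (y0 + t * (y - y0))) has_vector_derivative (y - y0) * g' (y0 + t * (y - y0)))
        (at t within {0..1})" if t: "t \<in> {0..1}" for t
    proof -
      have "(g has_real_derivative g' (y0 + t * (y - y0))) (at (y0 + t * (y - y0)))"
        unfolding g'_def by (rule C_inf_DERIV[OF g segment_in_ball[OF y t]])
      moreover have "((\<lambda>t. y0 + t * (y - y0)) has_real_derivative (y - y0)) (at t)"
        by (auto intro!: derivative_eq_intros)
      ultimately have "((\<lambda>t. g (y0 + t * (y - y0))) has_real_derivative g' (y0 + t * (y - y0)) * (y - y0)) (at t)"
        by (rule DERIV_chain2)
      then show ?thesis
        by (simp add: has_real_derivative_iff_has_vector_derivative has_vector_derivative_at_within mult.commute)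
    qed
    from fundamental_theorem_of_calculus[OF _ this]
    have "((\<lambda>t. (y - y0) * g' (y0 + t * (y - y0))) has_integral g y - g y0) {0..1}" by simp
    then have "integral {0..1} (\<lambda>t. (y - y0) * g' (y0 + t * (y - y0))) = g y - g y0"
      by (rule integral_unique)
    then show "g y = g y0 + (y - y0) * a y" by (simp add: a_def)
  qed
qed

text \<open>The derivative of the inverse \<open>v\<close> is \<open>1 / (u' \<circ> v)\<close>: if \<open>v\<close> is \<open>n\<close> times differentiable then so
  is its derivative.\<close>

lemma C_inf_inverse:
  fixes u :: "real \<Rightarrow> real"
  assumes I: "open I" and u: "C_inf I u" and inj: "inj_on u I"
    and pos: "\<And>x. x \<in> I \<Longrightarrow> frechet_derivative u (at x) 1 > 0"
  shows "open (u ` I)" "C_inf (u ` I) (inv_into I u)"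
proof -
  define v where "v = inv_into I u"
  define u' where "u' x = frechet_derivative u (at x) 1" for x
  have u': "C_inf I u'" unfolding u'_def[abs_def] by (rule C_inf_derivative[OF u])
  have vu: "v (u x) = x" if "x \<in> I" for x unfolding v_def using inj that by (rule inv_into_f_f)
  show "open (u ` I)"
    by (rule injective_into_1d_imp_open_map_UNIV[OF I C_inf_continuous_on[OF u] inj order_refl])
  have derv: "(v has_derivative (\<lambda>w. u' (v y) powr (- 1) * w)) (at y)" if y: "y \<in> u ` I" for y
  proof -
    obtain x where x: "x \<in> I" "y = u x" using y by blast
    have "u' x > 0" using pos[OF x(1)] unfolding u'_def .
    have "(u has_derivative (*) (u' x)) (at x)"
      using C_inf_DERIV[OF u x(1)] unfolding has_field_derivative_def u'_def .
    moreover have "(*) (u' x) \<circ> (\<lambda>w. u' x powr (- 1) * w) = id"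
      using \<open>u' x > 0\<close> by (auto simp: fun_eq_iff powr_minus)
    ultimately have "(v has_derivative (\<lambda>w. u' x powr (- 1) * w)) (at (u x))"
      using has_derivative_inverse_strong[OF I x(1) C_inf_continuous_on[OF u], of v] vu by blast
    then show ?thesis using vu[OF x(1)] x(2) by simp
  qed
  have v_in: "v ` u ` I \<subseteq> I" using vu by auto
  have "higher_differentiable_on (u ` I) v n" for n
  proof (induction n)
    case 0
    show ?case unfolding higher_differentiable_on.simps
      by (intro continuous_at_imp_continuous_on ballI) (rule has_derivative_continuous[OF derv])
  next
    case (Suc n)
    show ?case
    proof (rule higher_diff_SucI[OF \<open>open (u ` I)\<close> derv])
      have "higher_differentiable_on I u' n" using u' unfolding C_inf_def by blast
      then have 1: "higher_differentiable_on (u ` I) (\<lambda>y. u' (v y)) n"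
        by (rule higher_diff_compose[OF \<open>open (u ` I)\<close> I v_in _ Suc.IH])
      have "u' (v y) > 0" if "y \<in> u ` I" for y
        using pos[of "v y"] v_in that unfolding u'_def by blast
      then have "(\<lambda>y. u' (v y)) ` u ` I \<subseteq> {0<..}" by (simp add: image_subset_iff)
      from higher_diff_compose[OF \<open>open (u ` I)\<close> _ this higher_diff_powr 1, of "-1"]
      have "higher_differentiable_on (u ` I) (\<lambda>y. u' (v y) powr (- 1)) n" by simp
      from higher_diff_bounded_linear_image[OF bounded_linear_mult_left \<open>open (u ` I)\<close> this]
      show "higher_differentiable_on (u ` I) (\<lambda>y. u' (v y) powr (- 1) * w) n" for w .
    qed
  qed
  then show "C_inf (u ` I) (inv_into I u)" unfolding C_inf_def v_def[symmetric] by (intro allI)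
qed

text \<open>Factoring twice gives \<open>e y = e y0 + (y - y0)\<^sup>2 * a2 y\<close> where \<open>a2 y0\<close> is half the second
  derivative. With \<open>s\<close> the sign of \<open>a2 y0\<close>, the coordinate is \<open>u y = (y - y0) * sqrt (s * a2 y)\<close>.\<close>

lemma Morse_lemma_1d:
  fixes e :: "real \<Rightarrow> real"
  assumes B: "open B" and e: "smooth_on B e" and y0: "y0 \<in> B"
    and d1: "dir_deriv B e 1 y0 = 0" and d2: "dir_deriv B (dir_deriv B e 1) 1 y0 \<noteq> 0"
  obtains I u s where "open I" "y0 \<in> I" "I \<subseteq> B" "C_inf I u" "inj_on u I" "open (u ` I)"
    "C_inf (u ` I) (inv_into I u)" "u y0 = 0" "s \<in> {1, -1}"
    "\<And>y. y \<in> I \<Longrightarrow> e y = e y0 + s * (u y)\<^sup>2"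
proof -
  obtain d where "d > 0" "ball y0 d \<subseteq> B" using B y0 openE by blast
  let ?U = "ball y0 d"
  have y0U: "y0 \<in> ?U" using \<open>d > 0\<close> by simp
  have eU: "C_inf ?U e" using C_inf_subset[OF smooth_on_imp_C_inf[OF B e] \<open>?U \<subseteq> B\<close>] .
  obtain a1 where a1: "C_inf ?U a1" "\<And>y. y \<in> ?U \<Longrightarrow> e y = e y0 + (y - y0) * a1 y"
    using Hadamard_factorization[OF eU] by blast
  obtain a2 where a2: "C_inf ?U a2" "\<And>y. y \<in> ?U \<Longrightarrow> a1 y = a1 y0 + (y - y0) * a2 y"
    using Hadamard_factorization[OF a1(1)] by blast
  define D where "D f x = frechet_derivative f (at x) 1" for f :: "real \<Rightarrow> real" and x
  have e'D: "dir_deriv B e 1 y = D e y" if "y \<in> ?U" for y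
    unfolding D_def using that \<open>?U \<subseteq> B\<close> by (intro dir_deriv_open[OF B]) blast
  have e1: "(e has_real_derivative D e y) (at y)" if "y \<in> ?U" for y
    unfolding D_def by (rule C_inf_DERIV[OF eU that])
  have "((\<lambda>y. e y0 + (y - y0) * a1 y) has_real_derivative a1 y0) (at y0)"
    using C_inf_DERIV[OF a1(1) y0U] by (auto intro!: derivative_eq_intros)
  then have "(e has_real_derivative a1 y0) (at y0)"
    by (rule has_field_derivative_transform_within_open[OF _ open_ball y0U]) (rule a1(2)[symmetric])
  then have "a1 y0 = 0" using DERIV_unique[OF e1[OF y0U]] e'D[OF y0U] d1 by simp
  then have e2: "e y = e y0 + (y - y0)\<^sup>2 * a2 y" if "y \<in> ?U" for y
    using a1(2)[OF that] a2(2)[OF that] by (simp add: power2_eq_square)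
  have De: "D e y = 2 * (y - y0) * a2 y + (y - y0)\<^sup>2 * D a2 y" if y: "y \<in> ?U" for y
  proof -
    have "((\<lambda>y. e y0 + (y - y0)\<^sup>2 * a2 y) has_real_derivative
        2 * (y - y0) * a2 y + (y - y0)\<^sup>2 * D a2 y) (at y)"
      using C_inf_DERIV[OF a2(1) y] unfolding D_def by (auto intro!: derivative_eq_intros)
    then have "(e has_real_derivative 2 * (y - y0) * a2 y + (y - y0)\<^sup>2 * D a2 y) (at y)"
      by (rule has_field_derivative_transform_within_open[OF _ open_ball y]) (rule e2[symmetric])
    then show ?thesis by (rule DERIV_unique[OF e1[OF y]])
  qed
  have Da2: "C_inf ?U (D a2)" unfolding D_def[abs_def] by (rule C_inf_derivative[OF a2(1)])
  have "((\<lambda>y. 2 * (y - y0) * a2 y + (y - y0)\<^sup>2 * D a2 y) has_real_derivative 2 * a2 y0) (at y0)"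
    using C_inf_DERIV[OF a2(1) y0U] C_inf_DERIV[OF Da2 y0U] by (auto intro!: derivative_eq_intros)
  then have "(dir_deriv B e 1 has_real_derivative 2 * a2 y0) (at y0)"
    by (rule has_field_derivative_transform_within_open[OF _ open_ball y0U]) (simp add: e'D De)
  then have "(dir_deriv B e 1 has_derivative (\<lambda>v. 2 * a2 y0 * v)) (at y0 within B)"
    unfolding has_field_derivative_def by (rule has_derivative_at_withinI)
  from dir_deriv_eq[OF thick_open[OF B] y0 this, of 1] d2 have "a2 y0 \<noteq> 0" by simp
  define s :: real where "s = (if a2 y0 > 0 then 1 else -1)"
  have s: "s \<in> {1, -1}" "s * a2 y0 > 0" "s * s = 1" using \<open>a2 y0 \<noteq> 0\<close> unfolding s_def by auto
  define V where "V = {y\<in>?U. s * a2 y > 0}"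
  have "open V"
  proof -
    have "V = ?U \<inter> (\<lambda>y. s * a2 y) -` {0<..}" unfolding V_def by auto
    moreover have "continuous_on ?U (\<lambda>y. s * a2 y)"
      by (intro continuous_intros C_inf_continuous_on[OF a2(1)])
    ultimately show ?thesis using continuous_open_preimage[of ?U "\<lambda>y. s * a2 y" "{0<..}"] by simp
  qed
  have y0V: "y0 \<in> V" unfolding V_def using y0U s by simp
  define u where "u y = (y - y0) * (s * a2 y) powr (1 / 2)" for y
  have "V \<subseteq> ?U" unfolding V_def by blast
  have "smooth_on V (\<lambda>y. (s * a2 y) powr (1 / 2))"
  proof (rule smooth_on_powr[OF smooth_on_mult[OF smooth_on_const]])
    show "smooth_on V a2" using C_inf_imp_smooth_on[OF \<open>open V\<close> C_inf_subset[OF a2(1) \<open>V \<subseteq> ?U\<close>]] .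
  qed (simp add: V_def)
  moreover have "smooth_on V (\<lambda>y. y + (- y0))" by (rule smooth_on_add[OF smooth_on_ident smooth_on_const])
  ultimately have "smooth_on V (\<lambda>y. (y + (- y0)) * (s * a2 y) powr (1 / 2))"
    by (rule smooth_on_mult[rotated])
  then have uV: "C_inf V u" using smooth_on_imp_C_inf[OF \<open>open V\<close>] by (simp add: u_def[abs_def])
  have "(u has_real_derivative (s * a2 y0) powr (1 / 2)) (at y0)"
    unfolding u_def[abs_def] using C_inf_DERIV[OF a2(1) y0U] s(2) by (auto intro!: derivative_eq_intros)
  then have "D u y0 = (s * a2 y0) powr (1 / 2)"
    unfolding D_def by (rule DERIV_unique[OF C_inf_DERIV[OF uV y0V]])
  then have "D u y0 > 0" using s(2) by auto
  have Du: "C_inf V (D u)" unfolding D_def[abs_def] by (rule C_inf_derivative[OF uV])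
  define W where "W = {y\<in>V. D u y > 0}"
  have "open W"
  proof -
    have "W = V \<inter> D u -` {0<..}" unfolding W_def by auto
    then show ?thesis
      using continuous_open_preimage[OF C_inf_continuous_on[OF Du] \<open>open V\<close>, of "{0<..}"] by simp
  qed
  have "y0 \<in> W" unfolding W_def using y0V \<open>D u y0 > 0\<close> by simp
  then obtain c where "c > 0" "ball y0 c \<subseteq> W" using \<open>open W\<close> openE by blast
  let ?I = "ball y0 c"
  have IV: "?I \<subseteq> V" using \<open>?I \<subseteq> W\<close> unfolding W_def by blast
  have uI: "C_inf ?I u" by (rule C_inf_subset[OF uV IV])
  have pos: "frechet_derivative u (at y) 1 > 0" if "y \<in> ?I" for y
    using that \<open>?I \<subseteq> W\<close> unfolding W_def D_def by blast
  have less: "u x < u y" if "x \<in> ?I" "y \<in> ?I" "x < y" for x y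
  proof (rule DERIV_pos_imp_increasing[OF \<open>x < y\<close>])
    fix z assume "x \<le> z" "z \<le> y"
    then have "z \<in> ?I" using that by (auto simp: dist_real_def)
    then show "\<exists>l. (u has_real_derivative l) (at z) \<and> 0 < l"
      using C_inf_DERIV[OF uI] pos by blast
  qed
  have inj: "inj_on u ?I"
  proof (rule inj_onI)
    fix x y assume "x \<in> ?I" "y \<in> ?I" "u x = u y"
    then show "x = y" using less[of x y] less[of y x] by (cases x y rule: linorder_cases) auto
  qed
  show thesis
  proof (rule that[of ?I u s])
    show "u y0 = 0" by (simp add: u_def)
    show "e y = e y0 + s * (u y)\<^sup>2" if "y \<in> ?I" for y
    proof -
      have y: "y \<in> ?U" "s * a2 y > 0" using that IV unfolding V_def by auto
      have "((s * a2 y) powr (1 / 2))\<^sup>2 = s * a2 y"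
        using y(2) by (simp add: powr_half_sqrt)
      then have "s * (u y)\<^sup>2 = (y - y0)\<^sup>2 * (s * s * a2 y)"
        by (simp add: u_def power_mult_distrib)
      then show ?thesis using e2[OF y(1)] s(3) by simp
    qed
    show "?I \<subseteq> B" using IV \<open>V \<subseteq> ?U\<close> \<open>?U \<subseteq> B\<close> by blast
  qed (use \<open>c > 0\<close> s uI inj C_inf_inverse[OF open_ball uI inj pos] in simp_all)
qed

section \<open>Smooth functions and critical points on a surface\<close>

definition chart_image :: "('a, 'e) chart \<Rightarrow> 'e set" where
  "chart_image c = snd c ` fst c"

definition chart_inv :: "('a, 'e) chart \<Rightarrow> 'e \<Rightarrow> 'a" where
  "chart_inv c = inv_into (fst c) (snd c)"

definition pull :: "('a, 'e) chart \<Rightarrow> ('a \<Rightarrow> 'b) \<Rightarrow> 'e \<Rightarrow> 'b" where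
  "pull c f x = f (chart_inv c x)"

abbreviation chart_deriv ::
  "('a, 'e::euclidean_space) chart \<Rightarrow> ('a \<Rightarrow> 'f::euclidean_space) \<Rightarrow> 'e \<Rightarrow> 'e \<Rightarrow> 'f" where
  "chart_deriv c f \<equiv> dir_deriv (chart_image c) (pull c f)"

locale compact_surface =
  fixes X :: "'a topology" and A :: "('a, real \<times> real) chart set"
  assumes manifold: "smooth_manifold halfspace X A"
    and compact: "compact_space X"
begin

lemma Hausdorff: "Hausdorff_space X"
  using manifold by (simp add: smooth_manifold_def)

lemma chart_at:
  assumes "p \<in> topspace X" obtains c where "c \<in> A" "p \<in> fst c"
  using assms manifold unfolding smooth_manifold_def by blast

lemma chart_openin_dom: "c \<in> A \<Longrightarrow> openin X (fst c)"
  and chart_openin_image: "c \<in> A \<Longrightarrow> openin (top_of_set halfspace) (chart_image c)"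
  and chart_homeomorphic:
    "c \<in> A \<Longrightarrow> homeomorphic_map (subtopology X (fst c)) (top_of_set (chart_image c)) (snd c)"
  using manifold by (auto simp: smooth_manifold_def is_chart_def split_beta chart_image_def)

lemma chart_dom_subset: "c \<in> A \<Longrightarrow> fst c \<subseteq> topspace X"
  using chart_openin_dom openin_subset by blast

lemma chart_image_subset: "c \<in> A \<Longrightarrow> chart_image c \<subseteq> halfspace"
  using chart_openin_image openin_imp_subset by blast

lemma thick_chart_image: "c \<in> A \<Longrightarrow> thick (chart_image c)"
  by (rule thick_openin[OF thick_halfspace chart_openin_image])

lemma chart_inj: "c \<in> A \<Longrightarrow> inj_on (snd c) (fst c)"
  using homeomorphic_imp_injective_map[OF chart_homeomorphic] chart_dom_subset
  by (metis topspace_subtopology_subset)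

lemma chart_in_image: "p \<in> fst c \<Longrightarrow> snd c p \<in> chart_image c"
  by (simp add: chart_image_def)

lemma chart_inv_in: "x \<in> chart_image c \<Longrightarrow> chart_inv c x \<in> fst c"
  by (simp add: chart_image_def chart_inv_def inv_into_into)

lemma chart_chart_inv: "x \<in> chart_image c \<Longrightarrow> snd c (chart_inv c x) = x"
  by (simp add: chart_image_def chart_inv_def f_inv_into_f)

lemma chart_inv_chart: "c \<in> A \<Longrightarrow> p \<in> fst c \<Longrightarrow> chart_inv c (snd c p) = p"
  by (simp add: chart_inv_def chart_inj)

lemma chart_continuous_inv:
  assumes "c \<in> A" shows "continuous_map (top_of_set (chart_image c)) X (chart_inv c)"
proof -
  obtain g where g: "homeomorphic_maps (subtopology X (fst c)) (top_of_set (chart_image c)) (snd c) g"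
    using chart_homeomorphic[OF assms] homeomorphic_map_maps by blast
  have "continuous_map (top_of_set (chart_image c)) X g"
    using g continuous_map_into_fulltopology unfolding homeomorphic_maps_def by blast
  moreover have "g x = chart_inv c x" if "x \<in> chart_image c" for x
  proof -
    have "g (snd c p) = p" if "p \<in> fst c" for p
      using g that chart_dom_subset[OF assms] unfolding homeomorphic_maps_def by auto
    from this[OF chart_inv_in[OF that]] show ?thesis by (simp add: chart_chart_inv[OF that])
  qed
  ultimately show ?thesis by (rule continuous_map_eq) simp
qed

lemma chart_openin_image_of:
  assumes "c \<in> A" "openin X W" "W \<subseteq> fst c"
  shows "openin (top_of_set (chart_image c)) (snd c ` W)"
proof -
  have "openin (subtopology X (fst c)) W"
    using assms by (metis openin_subtopology inf.absorb_iff1)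
  then show ?thesis
    using homeomorphic_imp_open_map[OF chart_homeomorphic[OF assms(1)]] unfolding open_map_def by blast
qed

lemma chart_openin_preimage:
  assumes "c \<in> A" "open T"
  shows "openin X {p \<in> fst c. snd c p \<in> T}"
proof -
  have "continuous_map (subtopology X (fst c)) (top_of_set (chart_image c)) (snd c)"
    by (rule homeomorphic_imp_continuous_map[OF chart_homeomorphic[OF assms(1)]])
  then have "openin (subtopology X (fst c))
      {p \<in> topspace (subtopology X (fst c)). snd c p \<in> chart_image c \<inter> T}"
    by (rule openin_continuous_map_preimage) (use assms(2) in blast)
  moreover have "{p \<in> topspace (subtopology X (fst c)). snd c p \<in> chart_image c \<inter> T} = {p \<in> fst c. snd c p \<in> T}"
    using chart_dom_subset[OF assms(1)] chart_in_image[of _ c] by auto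
  ultimately show ?thesis
    using openin_trans_full chart_openin_dom[OF assms(1)] by metis
qed

lemma transition_smooth:
  assumes "c \<in> A" "d \<in> A"
  shows "smooth_on (snd c ` (fst c \<inter> fst d)) (\<lambda>x. snd d (chart_inv c x))"
proof -
  have "compatible c d" using assms manifold unfolding smooth_manifold_def by blast
  then show ?thesis
    unfolding compatible_def rep_dom_def local_rep_def chart_inv_def by simp
qed

definition smoothM :: "('a \<Rightarrow> real) \<Rightarrow> bool" where
  "smoothM f \<longleftrightarrow> (\<forall>c\<in>A. smooth_on (chart_image c) (pull c f))"

lemma smoothM_pull: "smoothM f \<Longrightarrow> c \<in> A \<Longrightarrow> smooth_on (chart_image c) (pull c f)"
  by (simp add: smoothM_def)

lemma pull_change_chart:
  assumes "c \<in> A" "d \<in> A" "y \<in> snd d ` (fst c \<inter> fst d)"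
  shows "pull d f y = pull c f (snd c (chart_inv d y))"
proof -
  obtain p where "p \<in> fst c" "p \<in> fst d" "y = snd d p" using assms(3) by blast
  then show ?thesis by (simp add: pull_def chart_inv_chart assms)
qed

text \<open>It suffices to look at one chart near each point, because the transition maps are smooth.\<close>

lemma smoothM_locally:
  assumes "\<And>p. p \<in> topspace X \<Longrightarrow>
    \<exists>c\<in>A. \<exists>W. openin X W \<and> p \<in> W \<and> W \<subseteq> fst c \<and> smooth_on (snd c ` W) (pull c f)"
  shows "smoothM f"
  unfolding smoothM_def
proof
  fix d assume d: "d \<in> A"
  show "smooth_on (chart_image d) (pull d f)"
  proof (rule smooth_on_locally)
    fix x assume x: "x \<in> chart_image d"
    let ?p = "chart_inv d x"
    have p: "?p \<in> fst d" "?p \<in> topspace X" using chart_inv_in[OF x] chart_dom_subset[OF d] by auto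
    obtain c W where c: "c \<in> A" and W: "openin X W" "?p \<in> W" "W \<subseteq> fst c"
      and f: "smooth_on (snd c ` W) (pull c f)"
      using assms[OF p(2)] by blast
    let ?V = "snd d ` (fst d \<inter> W)"
    have "openin (top_of_set (chart_image d)) ?V"
      by (rule chart_openin_image_of[OF d openin_Int[OF chart_openin_dom[OF d] W(1)]]) blast
    then obtain T where T: "open T" "?V = chart_image d \<inter> T" by (auto simp: openin_open)
    have "x \<in> ?V" using p W(2) chart_chart_inv[OF x] by (metis IntI imageI)
    have sub: "?V \<subseteq> snd d ` (fst d \<inter> fst c)" using W(3) by blast
    have "(\<lambda>y. snd c (chart_inv d y)) ` ?V \<subseteq> snd c ` W"
      by (auto simp: chart_inv_chart[OF d])
    then have "smooth_on ?V (\<lambda>y. pull c f (snd c (chart_inv d y)))"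
      by (rule smooth_on_compose[OF f smooth_on_subset[OF transition_smooth[OF d c] sub]])
    then have "smooth_on ?V (pull d f)"
    proof (rule smooth_on_cong[THEN iffD1, rotated])
      fix y assume "y \<in> ?V"
      then have "y \<in> snd d ` (fst c \<inter> fst d)" using W(3) by blast
      then show "pull c f (snd c (chart_inv d y)) = pull d f y"
        by (rule pull_change_chart[OF c d, symmetric])
    qed
    then show "\<exists>T. open T \<and> x \<in> T \<and> smooth_on (chart_image d \<inter> T) (pull d f)"
      using T \<open>x \<in> ?V\<close> by (intro exI[of _ T]) auto
  qed
qed

lemma smoothM_const: "smoothM (\<lambda>p. a)"
  unfolding smoothM_def pull_def[abs_def] by (simp add: smooth_on_const)

lemma smoothM_add: "smoothM f \<Longrightarrow> smoothM g \<Longrightarrow> smoothM (\<lambda>p. f p + g p)"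
  unfolding smoothM_def pull_def[abs_def] by (simp add: smooth_on_add)

lemma smoothM_cmult: "smoothM f \<Longrightarrow> smoothM (\<lambda>p. a * f p)"
  unfolding smoothM_def pull_def[abs_def] by (simp add: smooth_on_mult smooth_on_const)

text \<open>One chart is enough: the condition does not depend on it, by \<open>crit_iff\<close> below.\<close>

definition crit :: "('a \<Rightarrow> real) \<Rightarrow> 'a set" where
  "crit f = {p \<in> topspace X. \<exists>c\<in>A. p \<in> fst c \<and>
     (\<forall>v. chart_deriv c f v (snd c p) = 0)}"

lemma dir_deriv_change_chart:
  assumes f: "smoothM f" and c: "c \<in> A" and d: "d \<in> A" and p: "p \<in> fst c \<inter> fst d"
  shows "chart_deriv d f v (snd d p) =
    chart_deriv c f
      (dir_deriv (snd d ` (fst c \<inter> fst d)) (\<lambda>y. snd c (chart_inv d y)) v (snd d p)) (snd c p)"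
proof -
  let ?V = "snd d ` (fst c \<inter> fst d)" and ?\<tau> = "\<lambda>y. snd c (chart_inv d y)"
  have V: "openin (top_of_set (chart_image d)) ?V"
    by (rule chart_openin_image_of[OF d openin_Int[OF chart_openin_dom[OF c] chart_openin_dom[OF d]]]) blast
  have thV: "thick ?V" by (rule thick_openin[OF thick_chart_image[OF d] V])
  have \<tau>: "smooth_on ?V ?\<tau>" using transition_smooth[OF d c] by (simp add: Int_commute)
  have im: "?\<tau> ` ?V \<subseteq> chart_image c" by (auto simp: chart_inv_chart[OF d] chart_in_image)
  have xV: "snd d p \<in> ?V" using p by blast
  have "chart_deriv d f v (snd d p) = dir_deriv ?V (\<lambda>y. pull c f (?\<tau> y)) v (snd d p)"
    by (rule dir_deriv_cong_openin[OF thick_chart_image[OF d] V xV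
          smooth_on_compose[OF smoothM_pull[OF f c] \<tau> im] pull_change_chart[OF c d]])
  also have "\<dots> = chart_deriv c f (dir_deriv ?V ?\<tau> v (snd d p)) (?\<tau> (snd d p))"
    by (rule dir_deriv_compose[OF thV thick_chart_image[OF c] \<tau> smoothM_pull[OF f c] im xV])
  finally show ?thesis using p by (simp add: chart_inv_chart[OF d])
qed

lemma crit_iff:
  assumes "smoothM f" "c \<in> A" "p \<in> fst c"
  shows "p \<in> crit f \<longleftrightarrow> (\<forall>v. chart_deriv c f v (snd c p) = 0)"
proof
  assume "p \<in> crit f"
  then obtain d where d: "d \<in> A" "p \<in> fst d"
    "\<forall>v. chart_deriv d f v (snd d p) = 0" unfolding crit_def by blast
  show "\<forall>v. chart_deriv c f v (snd c p) = 0"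
    unfolding dir_deriv_change_chart[OF assms(1) d(1) assms(2) IntI[OF d(2) assms(3)]]
    using d(3) by (intro allI) (rule spec)
next
  assume "\<forall>v. chart_deriv c f v (snd c p) = 0"
  then show "p \<in> crit f" unfolding crit_def using assms(2,3) chart_dom_subset[OF assms(2)] by blast
qed

subsection \<open>Extending functions from a chart\<close>

text \<open>Closed half-discs inside a chart: the supports of the bumps used below.\<close>

definition cell :: "('a, real \<times> real) chart \<Rightarrow> real \<times> real \<Rightarrow> real \<Rightarrow> bool" where
  "cell c z r \<longleftrightarrow> c \<in> A \<and> cball z r \<inter> halfspace \<subseteq> chart_image c"

definition half_disc :: "real \<times> real \<Rightarrow> real \<Rightarrow> (real \<times> real) set" where
  "half_disc z r = cball z r \<inter> halfspace"

lemma compact_half_disc: "compact (half_disc z r)"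
proof -
  have "closed (halfspace :: (real \<times> real) set)"
    unfolding halfspace_def by (intro closed_Collect_le continuous_intros)
  then show ?thesis unfolding half_disc_def by (intro compact_Int_closed) auto
qed

lemma cell_exists:
  assumes "c \<in> A" "p \<in> fst c"
  obtains r where "r > 0" "cell c (snd c p) r"
proof -
  obtain T where T: "open T" "chart_image c = halfspace \<inter> T"
    using chart_openin_image[OF assms(1)] unfolding openin_open by blast
  have "snd c p \<in> T" using T(2) chart_in_image[OF assms(2)] by blast
  then obtain r where r: "r > 0" "cball (snd c p) r \<subseteq> T"
    using T(1) unfolding open_contains_cball by blast
  have "cball (snd c p) r \<inter> halfspace \<subseteq> chart_image c" unfolding T(2) using r(2) by blast
  then have "cell c (snd c p) r" unfolding cell_def using assms(1) by (intro conjI)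
  then show thesis using that r(1) by blast
qed

lemma cell_mono:
  assumes "cell c z r" "s \<le> r" shows "cell c z s"
proof -
  have "cball z s \<subseteq> cball z r" by (rule subset_cball[OF assms(2)])
  then show ?thesis using assms(1) unfolding cell_def by blast
qed

text \<open>Compactness of the closed half-disc and the Hausdorff property make its preimage closed in
  the whole surface, not only in the chart domain.\<close>

lemma cell_closed:
  assumes "cell c z r" shows "closedin X {p \<in> fst c. snd c p \<in> cball z r}"
proof -
  have c: "c \<in> A" using assms by (simp add: cell_def)
  let ?K = "cball z r \<inter> halfspace"
  have "compact ?K" using compact_half_disc unfolding half_disc_def .
  then have "compactin (top_of_set (chart_image c)) ?K"
    using assms by (simp add: compactin_subtopology cell_def)
  then have "compactin X (chart_inv c ` ?K)"
    by (rule image_compactin[OF _ chart_continuous_inv[OF c]])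
  moreover have "chart_inv c ` ?K = {p \<in> fst c. snd c p \<in> cball z r}"
  proof
    show "chart_inv c ` ?K \<subseteq> {p \<in> fst c. snd c p \<in> cball z r}"
    proof
      fix p assume "p \<in> chart_inv c ` ?K"
      then obtain x where x: "x \<in> ?K" "p = chart_inv c x" by blast
      then have "x \<in> chart_image c" using assms unfolding cell_def by blast
      then show "p \<in> {p \<in> fst c. snd c p \<in> cball z r}"
        using x chart_inv_in[of x c] chart_chart_inv[of x c] by simp
    qed
    show "{p \<in> fst c. snd c p \<in> cball z r} \<subseteq> chart_inv c ` ?K"
    proof
      fix p assume p: "p \<in> {p \<in> fst c. snd c p \<in> cball z r}"
      then have "snd c p \<in> ?K" using chart_in_image[of p c] chart_image_subset[OF c] by blast
      moreover have "p = chart_inv c (snd c p)" using p chart_inv_chart[OF c] by simp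
      ultimately show "p \<in> chart_inv c ` ?K" by blast
    qed
  qed
  ultimately show ?thesis using compactin_imp_closedin[OF Hausdorff] by simp
qed

lemma chart_avoiding_cell:
  assumes "cell c z r" "p \<in> topspace X" "p \<notin> fst c"
  obtains d W where "d \<in> A" "openin X W" "p \<in> W" "W \<subseteq> fst d"
    "\<And>q. q \<in> W \<Longrightarrow> q \<in> fst c \<Longrightarrow> snd c q \<notin> cball z r"
proof -
  obtain d where d: "d \<in> A" "p \<in> fst d" using chart_at[OF assms(2)] by blast
  show thesis
  proof (rule that[OF d(1)])
    show "openin X (fst d - {p \<in> fst c. snd c p \<in> cball z r})"
      by (rule openin_diff[OF chart_openin_dom[OF d(1)] cell_closed[OF assms(1)]])
  qed (use d assms in auto)
qed

text \<open>For functions supported in a cell, so that extension by zero is smooth.\<close>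

definition extend :: "('a, real \<times> real) chart \<Rightarrow> (real \<times> real \<Rightarrow> real) \<Rightarrow> 'a \<Rightarrow> real" where
  "extend c g p = (if p \<in> fst c then g (snd c p) else 0)"

lemma pull_extend: "x \<in> chart_image c \<Longrightarrow> pull c (extend c g) x = g x"
  by (simp add: pull_def extend_def chart_inv_in chart_chart_inv)

lemma smoothM_extend:
  assumes cell: "cell c z r" and g: "smooth_on UNIV g" and supp: "\<And>x. x \<notin> ball z r \<Longrightarrow> g x = 0"
  shows "smoothM (extend c g)"
proof (rule smoothM_locally)
  have c: "c \<in> A" using cell by (simp add: cell_def)
  fix p assume p: "p \<in> topspace X"
  show "\<exists>c'\<in>A. \<exists>W. openin X W \<and> p \<in> W \<and> W \<subseteq> fst c' \<and> smooth_on (snd c' ` W) (pull c' (extend c g))"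
  proof (cases "p \<in> fst c")
    case True
    have "smooth_on (chart_image c) (pull c (extend c g))"
      by (rule smooth_on_cong[THEN iffD2, OF _ smooth_on_subset[OF g subset_UNIV]]) (rule pull_extend)
    then show ?thesis
      using c True chart_openin_dom[OF c] unfolding chart_image_def by blast
  next
    case False
    obtain d W where d: "d \<in> A" and W: "openin X W" "p \<in> W" "W \<subseteq> fst d"
      and out: "\<And>q. q \<in> W \<Longrightarrow> q \<in> fst c \<Longrightarrow> snd c q \<notin> cball z r"
      by (rule chart_avoiding_cell[OF cell p False]) blast
    have zero: "extend c g q = 0" if "q \<in> W" for q
      using out[OF that] supp[of "snd c q"] ball_subset_cball[of z r] unfolding extend_def by auto
    have "pull d (extend c g) y = 0" if "y \<in> snd d ` W" for y
      using that W(3) zero chart_inv_chart[OF d] unfolding pull_def by auto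
    then have "smooth_on (snd d ` W) (pull d (extend c g))"
      by (rule smooth_on_cong[THEN iffD2, OF _ smooth_on_const])
    then show ?thesis using d W by blast
  qed
qed

subsection \<open>Pushing points around\<close>

text \<open>The two properties of an embedding of codimension zero that matter for precomposition are
  injectivity and that no critical points are created; phrasing them through functions on the
  surface makes closure under composition immediate.\<close>

definition open_embeddings :: "('a \<Rightarrow> 'a) set" where
  "open_embeddings = {h. h ` topspace X \<subseteq> topspace X \<and> inj_on h (topspace X) \<and>
     (\<forall>f. smoothM f \<longrightarrow> smoothM (\<lambda>p. f (h p)) \<and> (\<forall>p\<in>crit (\<lambda>p. f (h p)). h p \<in> crit f))}"

lemma open_embedding_into: "h \<in> open_embeddings \<Longrightarrow> p \<in> topspace X \<Longrightarrow> h p \<in> topspace X"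
  and open_embedding_inj: "h \<in> open_embeddings \<Longrightarrow> inj_on h (topspace X)"
  and open_embedding_smooth: "h \<in> open_embeddings \<Longrightarrow> smoothM f \<Longrightarrow> smoothM (\<lambda>p. f (h p))"
  and open_embedding_crit: "h \<in> open_embeddings \<Longrightarrow> smoothM f \<Longrightarrow>
    p \<in> crit (\<lambda>p. f (h p)) \<Longrightarrow> h p \<in> crit f"
  unfolding open_embeddings_def by blast+

lemma open_embeddings_compose:
  assumes h: "h \<in> open_embeddings" and k: "k \<in> open_embeddings"
  shows "(\<lambda>p. h (k p)) \<in> open_embeddings"
  unfolding open_embeddings_def mem_Collect_eq
proof (intro conjI allI impI)
  show "(\<lambda>p. h (k p)) ` topspace X \<subseteq> topspace X"
    using open_embedding_into[OF h] open_embedding_into[OF k] by blast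
  show "inj_on (\<lambda>p. h (k p)) (topspace X)"
  proof (rule inj_onI)
    fix x y assume xy: "x \<in> topspace X" "y \<in> topspace X" "h (k x) = h (k y)"
    have "k x = k y"
      by (rule inj_onD[OF open_embedding_inj[OF h] xy(3)]) (rule open_embedding_into[OF k], fact)+
    then show "x = y" by (rule inj_onD[OF open_embedding_inj[OF k] _ xy(1,2)])
  qed
  fix f assume f: "smoothM f"
  note fh = open_embedding_smooth[OF h f]
  show "smoothM (\<lambda>p. f (h (k p)))" by (rule open_embedding_smooth[OF k fh])
  show "\<forall>p\<in>crit (\<lambda>p. f (h (k p))). h (k p) \<in> crit f"
    by (intro ballI open_embedding_crit[OF h f] open_embedding_crit[OF k fh])
qed

definition push :: "('a, real \<times> real) chart \<Rightarrow> (real \<times> real \<Rightarrow> real \<times> real) \<Rightarrow> 'a \<Rightarrow> 'a" where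
  "push c k p = (if p \<in> fst c then chart_inv c (k (snd c p)) else p)"

text \<open>Since \<open>k\<close> is injective and is the identity outside the disc, it maps the disc to itself. Inside the chart
  a critical point of \<open>f \<circ> push\<close> is mapped to one of \<open>f\<close> because the derivative of \<open>k\<close> is onto; outside
  the cell the two functions agree.\<close>

lemma push_open_embedding:
  assumes cell: "cell c z r" and k: "smooth_on UNIV k" "inj k"
    and surj: "\<And>x. surj (\<lambda>w. dir_deriv UNIV k w x)"
    and id: "\<And>x. x \<notin> ball z r \<Longrightarrow> k x = x"
    and half: "\<And>x. x \<in> halfspace \<Longrightarrow> k x \<in> cball z r \<Longrightarrow> k x \<in> halfspace"
  shows "push c k \<in> open_embeddings"
    and "\<And>p. p \<in> fst c \<Longrightarrow> snd c (push c k p) = k (snd c p)"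
proof -
  have c: "c \<in> A" and sub: "cball z r \<inter> halfspace \<subseteq> chart_image c" using cell by (auto simp: cell_def)
  have k_in: "k x \<in> chart_image c" if x: "x \<in> chart_image c" for x
  proof (cases "x \<in> ball z r")
    case True
    have "k x \<in> cball z r"
    proof (rule ccontr)
      assume "k x \<notin> cball z r"
      then have "k x \<notin> ball z r" using ball_subset_cball by blast
      then have "k (k x) = k x" by (rule id)
      then have "k x = x" by (rule injD[OF k(2)])
      then show False using \<open>k x \<notin> ball z r\<close> True by simp
    qed
    then show ?thesis using half[of x] sub chart_image_subset[OF c] x by blast
  qed (use x id in simp)
  have in_c: "push c k p \<in> fst c" if "p \<in> fst c" for p
    using that chart_inv_in[OF k_in[OF chart_in_image[OF that]]] by (simp add: push_def)
  show chart_push: "snd c (push c k p) = k (snd c p)" if "p \<in> fst c" for p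
    using that chart_chart_inv[OF k_in[OF chart_in_image[OF that]]] by (simp add: push_def)
  have iff: "p \<in> fst c \<longleftrightarrow> push c k p \<in> fst c" for p
    using in_c[of p] by (auto simp: push_def)
  have push_id: "push c k q = q" if "q \<in> fst c \<Longrightarrow> snd c q \<notin> cball z r" for q
  proof (cases "q \<in> fst c")
    case True
    then have "k (snd c q) = snd c q" using that ball_subset_cball by (intro id) blast
    then show ?thesis using True chart_inv_chart[OF c] by (simp add: push_def)
  qed (simp add: push_def)
  show "push c k \<in> open_embeddings"
    unfolding open_embeddings_def mem_Collect_eq
  proof (intro conjI allI impI ballI)
    show "push c k ` topspace X \<subseteq> topspace X"
      using in_c chart_dom_subset[OF c] by (auto simp: push_def)
    show "inj_on (push c k) (topspace X)"
    proof (rule inj_onI)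
      fix p q assume pq: "push c k p = push c k q"
      show "p = q"
      proof (cases "p \<in> fst c")
        case True
        then have "q \<in> fst c" using pq iff by metis
        then have "k (snd c p) = k (snd c q)" using True pq chart_push by metis
        then show ?thesis
          using injD[OF k(2)] True \<open>q \<in> fst c\<close> chart_inj[OF c] by (blast dest: inj_onD)
      next
        case False
        then have "q \<notin> fst c" using pq iff by metis
        then show ?thesis using pq False by (simp add: push_def)
      qed
    qed
    fix f assume f: "smoothM f"
    have pull_push: "pull c (\<lambda>p. f (push c k p)) x = pull c f (k x)" if "x \<in> chart_image c" for x
      using that by (simp add: pull_def push_def chart_inv_in chart_chart_inv)
    have kc: "smooth_on (chart_image c) k" "k ` chart_image c \<subseteq> chart_image c"
      using smooth_on_subset[OF k(1)] k_in by auto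
    have smc: "smooth_on (chart_image c) (\<lambda>x. pull c f (k x))"
      by (rule smooth_on_compose[OF smoothM_pull[OF f c] kc])
    have away: "pull d (\<lambda>p. f (push c k p)) y = pull d f y"
      if "d \<in> A" "W \<subseteq> fst d" "\<And>q. q \<in> W \<Longrightarrow> q \<in> fst c \<Longrightarrow> snd c q \<notin> cball z r" "y \<in> snd d ` W" for d W y
      using that push_id chart_inv_chart[OF that(1)] unfolding pull_def by (auto simp: subset_iff)
    show fp: "smoothM (\<lambda>p. f (push c k p))"
    proof (rule smoothM_locally)
      fix p assume p: "p \<in> topspace X"
      show "\<exists>d\<in>A. \<exists>W. openin X W \<and> p \<in> W \<and> W \<subseteq> fst d \<and> smooth_on (snd d ` W) (pull d (\<lambda>p. f (push c k p)))"
      proof (cases "p \<in> fst c")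
        case True
        have "smooth_on (chart_image c) (pull c (\<lambda>p. f (push c k p)))"
          by (rule smooth_on_cong[THEN iffD1, OF _ smc]) (rule pull_push[symmetric])
        then show ?thesis
          using c True chart_openin_dom[OF c] unfolding chart_image_def by blast
      next
        case False
        obtain d W where d: "d \<in> A" and W: "openin X W" "p \<in> W" "W \<subseteq> fst d"
          and out: "\<And>q. q \<in> W \<Longrightarrow> q \<in> fst c \<Longrightarrow> snd c q \<notin> cball z r"
          by (rule chart_avoiding_cell[OF cell p False]) blast
        have "smooth_on (snd d ` W) (pull d f)"
          using smooth_on_subset[OF smoothM_pull[OF f d]] W(3) unfolding chart_image_def by blast
        then have "smooth_on (snd d ` W) (pull d (\<lambda>p. f (push c k p)))"
          by (rule smooth_on_cong[THEN iffD1, rotated]) (rule away[OF d W(3) out, symmetric])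
        then show ?thesis using d W by blast
      qed
    qed
    fix p assume crit: "p \<in> crit (\<lambda>p. f (push c k p))"
    then have p: "p \<in> topspace X" by (simp add: crit_def)
    show "push c k p \<in> crit f"
    proof (cases "p \<in> fst c")
      case True
      let ?x = "snd c p"
      have x: "?x \<in> chart_image c" by (rule chart_in_image[OF True])
      have "chart_deriv c f w (k ?x) = 0" for w
      proof -
        obtain v where v: "w = dir_deriv UNIV k v ?x" using surj[of ?x] by (rule surjE)
        have "chart_deriv c (\<lambda>p. f (push c k p)) v ?x = 0"
          using crit unfolding crit_iff[OF fp c True] by (rule spec)
        then have "0 = chart_deriv c (\<lambda>p. f (push c k p)) v ?x" by (rule sym)
        also have "\<dots> = dir_deriv (chart_image c) (\<lambda>x. pull c f (k x)) v ?x"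
          by (rule dir_deriv_cong[OF pull_push x])
        also have "\<dots> = chart_deriv c f (dir_deriv (chart_image c) k v ?x) (k ?x)"
          by (rule dir_deriv_compose[OF thick_chart_image[OF c] thick_chart_image[OF c] kc(1)
                smoothM_pull[OF f c] kc(2) x])
        also have "dir_deriv (chart_image c) k v ?x = w"
          unfolding v using has_derivative_at_withinI[OF smooth_on_has_derivative[OF thick_UNIV k(1) UNIV_I]]
          by (rule dir_deriv_eq[OF thick_chart_image[OF c] x])
        finally show ?thesis by simp
      qed
      then show ?thesis
        unfolding crit_iff[OF f c in_c[OF True]] chart_push[OF True] by (rule allI)
    next
      case False
      obtain d W where d: "d \<in> A" and W: "openin X W" "p \<in> W" "W \<subseteq> fst d"
        and out: "\<And>q. q \<in> W \<Longrightarrow> q \<in> fst c \<Longrightarrow> snd c q \<notin> cball z r"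
        by (rule chart_avoiding_cell[OF cell p False]) blast
      have pd: "p \<in> fst d" using W by blast
      have Wo: "openin (top_of_set (chart_image d)) (snd d ` W)" by (rule chart_openin_image_of[OF d W(1,3)])
      have xW: "snd d p \<in> snd d ` W" using W(2) by blast
      have smW: "smooth_on (snd d ` W) (pull d f)"
        using smooth_on_subset[OF smoothM_pull[OF f d]] W(3) unfolding chart_image_def by blast
      have "chart_deriv d f v (snd d p) = 0" for v
      proof -
        have "chart_deriv d f v (snd d p) = dir_deriv (snd d ` W) (pull d f) v (snd d p)"
          by (rule dir_deriv_cong_openin[OF thick_chart_image[OF d] Wo xW smW refl])
        also have "\<dots> = chart_deriv d (\<lambda>p. f (push c k p)) v (snd d p)"
          by (rule dir_deriv_cong_openin[OF thick_chart_image[OF d] Wo xW smW away[OF d W(3) out], symmetric])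
        also have "\<dots> = 0" using crit unfolding crit_iff[OF fp d pd] by (rule spec)
        finally show ?thesis .
      qed
      then have "p \<in> crit f" by (intro crit_iff[OF f d pd, THEN iffD2] allI)
      moreover have "push c k p = p" using False by (simp add: push_def)
      ultimately show ?thesis by simp
    qed
  qed
qed

text \<open>Precomposition with such an \<open>h\<close> removes a critical point at \<open>p\<close>.\<close>

definition avoidable :: "'a \<Rightarrow> bool" where
  "avoidable p \<longleftrightarrow> (\<exists>h\<in>open_embeddings. p \<notin> h ` topspace X)"

text \<open>The map \<open>k v\<close> is translation by \<open>v\<close>, damped by a bump that is \<open>1\<close> on the half-size disc. If \<open>L\<close>
  bounds the gradient of the bump, \<open>bump_translation\<close> needs \<open>L * norm v < 1\<close>, which holds for
  \<open>norm v < 2 * a\<close> if \<open>a \<le> 1 / (2 * L)\<close>; and \<open>a \<le> r / 4\<close> keeps two steps of length \<open>a\<close> within the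
  half-size disc.\<close>

lemma translation_in_cell:
  assumes r: "r > 0" and cell: "cell c z r"
  obtains a k where "a > 0" "a \<le> r / 4" "\<And>v x. x \<in> cball z (r / 2) \<Longrightarrow> k v x = x + v"
    "\<And>v x. \<exists>s\<ge>0. k v x = x + s *\<^sub>R v" "\<And>v. norm v < 2 * a \<Longrightarrow> inj (k v)"
    "\<And>v. norm v < 2 * a \<Longrightarrow>
       (\<And>x. x \<in> halfspace \<Longrightarrow> k v x \<in> cball z r \<Longrightarrow> k v x \<in> halfspace) \<Longrightarrow>
       push c (k v) \<in> open_embeddings \<and>
       (\<forall>p\<in>fst c. snd c (push c (k v) p) = k v (snd c p))"
proof -
  have r2: "0 < r / 2" "r / 2 < r" using r by auto
  obtain \<psi> :: "real \<times> real \<Rightarrow> real" where \<psi>: "smooth_on UNIV \<psi>" "\<And>x. 0 \<le> \<psi> x"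
    "\<And>x. x \<in> cball z (r / 2) \<Longrightarrow> \<psi> x = 1" "\<And>x. x \<notin> ball z r \<Longrightarrow> \<psi> x = 0"
    by (rule bump_exists[OF r2, where z = z]) blast
  obtain L where L: "L > 0" "\<And>x v. \<bar>dir_deriv UNIV \<psi> v x\<bar> \<le> L * norm v"
    using bounded_dir_deriv_if_compact_support[OF \<psi>(1,4)] by blast
  define a where "a = min (r / 4) (1 / (2 * L))"
  define k where "k v x = x + \<psi> x *\<^sub>R v" for v x
  have Lv: "L * norm v < 1" if "norm v < 2 * a" for v :: "real \<times> real"
  proof -
    have "norm v < 1 / L" using that by (auto simp: a_def)
    then show ?thesis using mult_strict_left_mono[OF _ L(1), of "norm v" "1 / L"] L(1) by simp
  qed
  have k_eq: "k v = (\<lambda>x. x + \<psi> x *\<^sub>R v)" for v by (simp add: k_def[abs_def])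
  note kprops = bump_translation[OF \<psi>(1) L(2) Lv, folded k_eq]
  have k_id: "k v x = x" if "x \<notin> ball z r" for v x
    using \<psi>(4)[OF that] by (simp add: k_def zero_prod_def)
  show thesis
  proof (rule that[of a k])
    show "a > 0" "a \<le> r / 4" using r L(1) by (auto simp: a_def)
    show "k v x = x + v" if "x \<in> cball z (r / 2)" for v x by (simp add: k_def \<psi>(3)[OF that])
    show "\<exists>s\<ge>0. k v x = x + s *\<^sub>R v" for v x
      unfolding k_def by (intro exI[of _ "\<psi> x"] conjI refl \<psi>(2))
    fix v :: "real \<times> real" assume v: "norm v < 2 * a"
    show "inj (k v)" by (rule kprops(2)[OF v])
    assume half: "\<And>x. x \<in> halfspace \<Longrightarrow> k v x \<in> cball z r \<Longrightarrow> k v x \<in> halfspace"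
    have "push c (k v) \<in> open_embeddings"
      by (rule push_open_embedding(1)[OF cell kprops(1)[OF v] kprops(2)[OF v] kprops(3)[OF v]])
         (erule k_id half, assumption?)+
    moreover have "snd c (push c (k v) p) = k v (snd c p)" if "p \<in> fst c" for p
      by (rule push_open_embedding(2)[OF cell kprops(1)[OF v] kprops(2)[OF v] kprops(3)[OF v] _ _ that])
         (erule k_id half, assumption?)+
    ultimately show "push c (k v) \<in> open_embeddings \<and> (\<forall>p\<in>fst c. snd c (push c (k v) p) = k v (snd c p))"
      by blast
  qed
qed

text \<open>Pushing a boundary disc inwards by \<open>a\<close> uncovers the strip of points at distance less than \<open>a\<close>
  from the edge: on the full plane the preimage of such a point lies outside the half-plane.\<close>

lemma avoidable_near_boundary:
  assumes c: "c \<in> A" and p: "p \<in> fst c" and z0: "fst (snd c p) = 0"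
  obtains N where "openin X N" "p \<in> N" "\<And>q. q \<in> N \<Longrightarrow> avoidable q"
proof -
  let ?z = "snd c p"
  obtain r where r: "r > 0" and cell: "cell c ?z r" by (rule cell_exists[OF c p])
  obtain a k where a: "a > 0" "a \<le> r / 4" and shift: "\<And>v x. x \<in> cball ?z (r / 2) \<Longrightarrow> k v x = x + v"
    and nonneg: "\<And>v x. \<exists>s\<ge>0. k v x = x + s *\<^sub>R v" and inj: "\<And>v. norm v < 2 * a \<Longrightarrow> inj (k v)"
    and push: "\<And>v. norm v < 2 * a \<Longrightarrow>
       (\<And>x. x \<in> halfspace \<Longrightarrow> k v x \<in> cball ?z r \<Longrightarrow> k v x \<in> halfspace) \<Longrightarrow>
       push c (k v) \<in> open_embeddings \<and> (\<forall>p\<in>fst c. snd c (push c (k v) p) = k v (snd c p))"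
    by (rule translation_in_cell[OF r cell]) blast
  let ?v = "(a, 0) :: real \<times> real"
  have v: "norm ?v < 2 * a" using a(1) by (simp add: norm_Pair)
  have half: "k ?v x \<in> halfspace" if "x \<in> halfspace" for x
  proof -
    obtain s where "s \<ge> 0" "k ?v x = x + s *\<^sub>R ?v" using nonneg by blast
    then show ?thesis using that a(1) by (simp add: halfspace_def)
  qed
  note push_v = push[OF v half]
  show thesis
  proof (rule that)
    show "openin X {q \<in> fst c. snd c q \<in> ball ?z a}" by (rule chart_openin_preimage[OF c open_ball])
    show "p \<in> {q \<in> fst c. snd c q \<in> ball ?z a}" using p a by simp
    fix q assume q: "q \<in> {q \<in> fst c. snd c q \<in> ball ?z a}"
    have "q \<notin> push c (k ?v) ` topspace X"
    proof
      assume "q \<in> push c (k ?v) ` topspace X"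
      then obtain y where y: "q = push c (k ?v) y" by blast
      then have yc: "y \<in> fst c" using q by (auto simp: push_def split: if_splits)
      let ?x = "snd c q"
      have near: "dist ?x ?z < a" using q by (simp add: dist_commute)
      have e1: "?x = k ?v (snd c y)" using y yc push_v by blast
      have e2: "k ?v (?x - ?v) = ?x"
      proof -
        have "dist (?x - ?v) ?z \<le> dist (?x - ?v) ?x + dist ?x ?z" by (rule dist_triangle)
        also have "\<dots> \<le> a + a" using near a(1) by (intro add_mono) (simp_all add: dist_norm norm_Pair)
        finally have "?x - ?v \<in> cball ?z (r / 2)" using a(2) by (simp add: dist_commute)
        from shift[OF this] show ?thesis by simp
      qed
      have "snd c y = ?x - ?v" by (rule injD[OF inj[OF v] trans[OF e1[symmetric] e2[symmetric]]])
      moreover have "fst (snd c y) \<ge> 0"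
        using chart_in_image[OF yc] chart_image_subset[OF c] by (auto simp: halfspace_def)
      moreover have "\<bar>fst ?x - fst ?z\<bar> \<le> dist ?x ?z" using dist_fst_le[of ?x ?z] by (simp add: dist_real_def)
      ultimately show False using near z0 by simp
    qed
    then show "avoidable q" using push_v unfolding avoidable_def by blast
  qed
qed

text \<open>Translation by the difference of the coordinates carries a missed point \<open>q\<close> to \<open>q'\<close>.\<close>

lemma avoidable_near_interior:
  assumes c: "c \<in> A" and p: "p \<in> fst c" and z0: "fst (snd c p) > 0"
  obtains N where "openin X N" "p \<in> N" "\<And>q q'. q \<in> N \<Longrightarrow> q' \<in> N \<Longrightarrow> avoidable q \<Longrightarrow> avoidable q'"
proof -
  let ?z = "snd c p"
  obtain r0 where r0: "r0 > 0" and cell0: "cell c ?z r0" by (rule cell_exists[OF c p])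
  define r where "r = min r0 (fst ?z)"
  have r: "r > 0" and cell: "cell c ?z r" using r0 z0 cell_mono[OF cell0] by (auto simp: r_def)
  have interior: "x \<in> halfspace" if "x \<in> cball ?z r" for x
  proof -
    have "dist ?z x \<le> fst ?z" using that by (simp add: r_def)
    moreover have "\<bar>fst ?z - fst x\<bar> \<le> dist ?z x" using dist_fst_le[of ?z x] by (simp add: dist_real_def)
    ultimately show "x \<in> halfspace" by (simp add: halfspace_def)
  qed
  obtain a k where a: "a > 0" "a \<le> r / 4" and shift: "\<And>v x. x \<in> cball ?z (r / 2) \<Longrightarrow> k v x = x + v"
    and push: "\<And>v. norm v < 2 * a \<Longrightarrow>
       (\<And>x. x \<in> halfspace \<Longrightarrow> k v x \<in> cball ?z r \<Longrightarrow> k v x \<in> halfspace) \<Longrightarrow>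
       push c (k v) \<in> open_embeddings \<and> (\<forall>p\<in>fst c. snd c (push c (k v) p) = k v (snd c p))"
    by (rule translation_in_cell[OF r cell]) blast
  show thesis
  proof (rule that)
    show "openin X {q \<in> fst c. snd c q \<in> ball ?z a}" by (rule chart_openin_preimage[OF c open_ball])
    show "p \<in> {q \<in> fst c. snd c q \<in> ball ?z a}" using p a by simp
    fix q q' assume q: "q \<in> {q \<in> fst c. snd c q \<in> ball ?z a}" and q': "q' \<in> {q \<in> fst c. snd c q \<in> ball ?z a}"
      and "avoidable q"
    then obtain h where h: "h \<in> open_embeddings" "q \<notin> h ` topspace X" unfolding avoidable_def by blast
    define v where "v = snd c q' - snd c q"
    have "norm v \<le> dist (snd c q') ?z + dist ?z (snd c q)"
      unfolding v_def dist_norm[symmetric] by (rule dist_triangle)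
    also have "\<dots> < a + a" using q q' by (intro add_strict_mono) (auto simp: dist_commute)
    finally have v: "norm v < 2 * a" by simp
    have push_v: "push c (k v) \<in> open_embeddings" using push[OF v interior] by blast
    have "push c (k v) q = q'"
    proof -
      have "snd c q \<in> cball ?z (r / 2)" using q a r by simp
      from shift[OF this, of v] have "k v (snd c q) = snd c q'" by (simp add: v_def)
      then show ?thesis using q q' chart_inv_chart[OF c] by (simp add: push_def)
    qed
    have "q' \<notin> (\<lambda>p. push c (k v) (h p)) ` topspace X"
    proof
      assume "q' \<in> (\<lambda>p. push c (k v) (h p)) ` topspace X"
      then obtain x where x: "x \<in> topspace X" "push c (k v) (h x) = push c (k v) q"
        unfolding \<open>push c (k v) q = q'\<close> image_iff by (elim bexE) simp
      have "q \<in> topspace X" using q chart_dom_subset[OF c] by blast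
      then have "h x = q"
        by (rule inj_onD[OF open_embedding_inj[OF push_v] x(2) open_embedding_into[OF h(1) x(1)]])
      then show False using h(2) x(1) by blast
    qed
    then show "avoidable q'"
      using open_embeddings_compose[OF push_v h(1)] unfolding avoidable_def by blast
  qed
qed

text \<open>Every point has a neighbourhood on which avoidability is constant, and boundary points are
  avoidable, so connectedness gives the claim.\<close>

lemma all_avoidable:
  assumes "connected_space X" "manifold_boundary A \<noteq> {}" "p \<in> topspace X"
  shows "avoidable p"
proof -
  let ?G = "{p \<in> topspace X. avoidable p}"
  have nbhd: "\<exists>N. openin X N \<and> p \<in> N \<and>
      ((\<forall>q\<in>N. avoidable q) \<or> (\<forall>q\<in>N. \<forall>q'\<in>N. avoidable q \<longrightarrow> avoidable q'))" if pX: "p \<in> topspace X" for p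
  proof -
    obtain c where c: "c \<in> A" "p \<in> fst c" by (rule chart_at[OF pX])
    have "fst (snd c p) \<ge> 0"
      using chart_in_image[OF c(2)] chart_image_subset[OF c(1)] by (auto simp: halfspace_def)
    then consider "fst (snd c p) = 0" | "fst (snd c p) > 0" by linarith
    then show ?thesis
    proof cases
      case 1
      obtain N where "openin X N" "p \<in> N" "\<And>q. q \<in> N \<Longrightarrow> avoidable q"
        by (rule avoidable_near_boundary[OF c 1]) blast
      then show ?thesis by (intro exI[of _ N]) simp
    next
      case 2
      obtain N where "openin X N" "p \<in> N" "\<And>q q'. q \<in> N \<Longrightarrow> q' \<in> N \<Longrightarrow> avoidable q \<Longrightarrow> avoidable q'"
        by (rule avoidable_near_interior[OF c 2]) blast
      then have "openin X N \<and> p \<in> N \<and> (\<forall>q\<in>N. \<forall>q'\<in>N. avoidable q \<longrightarrow> avoidable q')" by blast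
      then show ?thesis by blast
    qed
  qed
  have open_pt: "\<exists>N. openin X N \<and> p \<in> N \<and> (\<forall>q\<in>N. avoidable q = avoidable p)"
    if pX: "p \<in> topspace X" for p
  proof -
    obtain N where N: "openin X N \<and> p \<in> N \<and>
      ((\<forall>q\<in>N. avoidable q) \<or> (\<forall>q\<in>N. \<forall>q'\<in>N. avoidable q \<longrightarrow> avoidable q'))"
      using nbhd[OF pX] by (elim exE)
    then have "\<forall>q\<in>N. avoidable q = avoidable p" by blast
    then show ?thesis using N by blast
  qed
  have "openin X ?G"
    unfolding openin_subopen[of X ?G]
  proof
    fix p assume p: "p \<in> ?G"
    then obtain N where N: "openin X N \<and> p \<in> N \<and> (\<forall>q\<in>N. avoidable q = avoidable p)"
      using open_pt[of p] by blast
    then have "N \<subseteq> ?G" using p openin_subset[of X N] by blast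
    then show "\<exists>T. openin X T \<and> p \<in> T \<and> T \<subseteq> ?G" using N by blast
  qed
  moreover have "openin X (topspace X - ?G)"
    unfolding openin_subopen[of X "topspace X - ?G"]
  proof
    fix p assume p: "p \<in> topspace X - ?G"
    then obtain N where N: "openin X N \<and> p \<in> N \<and> (\<forall>q\<in>N. avoidable q = avoidable p)"
      using open_pt[of p] by blast
    then have "N \<subseteq> topspace X - ?G" using p openin_subset[of X N] by blast
    then show "\<exists>T. openin X T \<and> p \<in> T \<and> T \<subseteq> topspace X - ?G" using N by blast
  qed
  ultimately have clopen: "?G = {} \<or> ?G = topspace X"
    using assms(1) unfolding connected_space_clopen_in closedin_def by blast
  obtain b c where b: "c \<in> A" "b \<in> fst c" "fst (snd c b) = 0"
    using assms(2) unfolding manifold_boundary_def by fastforce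
  obtain N where "b \<in> N" "\<And>q. q \<in> N \<Longrightarrow> avoidable q"
    by (rule avoidable_near_boundary[OF b]) blast
  then have "b \<in> ?G" using b(2) chart_dom_subset[OF b(1)] by blast
  then have "?G = topspace X" using clopen by blast
  then show ?thesis using assms(3) by blast
qed

text \<open>Precomposing with an embedding that misses a critical point lowers their number.\<close>

lemma finite_crit_removable:
  assumes avoid: "\<And>p. p \<in> topspace X \<Longrightarrow> avoidable p" and "smoothM f" "finite (crit f)"
  shows "\<exists>F. smoothM F \<and> crit F = {}"
  using assms(2,3)
proof (induction "card (crit f)" arbitrary: f rule: less_induct)
  case less
  show ?case
  proof (cases "crit f = {}")
    case False
    then obtain p where p: "p \<in> crit f" by blast
    then have "p \<in> topspace X" by (simp add: crit_def)
    then obtain h where h: "h \<in> open_embeddings" "p \<notin> h ` topspace X"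
      using avoid unfolding avoidable_def by blast
    let ?g = "\<lambda>p. f (h p)"
    note g = open_embedding_smooth[OF h(1) less.prems(1)] open_embedding_crit[OF h(1) less.prems(1)]
    have top: "crit ?g \<subseteq> topspace X" unfolding crit_def by blast
    have inj: "inj_on h (crit ?g)" by (rule inj_on_subset[OF open_embedding_inj[OF h(1)] top])
    have sub: "h ` crit ?g \<subseteq> crit f - {p}" using g(2) h(2) top by blast
    have "finite (crit ?g)"
      using inj_on_finite[OF inj sub] less.prems(2) by blast
    moreover have "card (crit ?g) < card (crit f)"
      using card_inj_on_le[OF inj sub] less.prems(2) card_Diff1_less[OF less.prems(2) p] by simp
    ultimately show ?thesis using less.hyps g(1) by blast
  qed (use less.prems in blast)
qed

end

section \<open>Second order jets\<close>

type_synonym jet = "real \<times> real \<times> real \<times> real \<times> real \<times> real"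

definition jet :: "(real \<times> real) set \<Rightarrow> (real \<times> real \<Rightarrow> real) \<Rightarrow> real \<times> real \<Rightarrow> jet" where
  "jet S f x =
    (let fx = dir_deriv S f (1, 0); fy = dir_deriv S f (0, 1)
     in (fx x, fy x, dir_deriv S fx (1, 0) x, dir_deriv S fx (0, 1) x,
         dir_deriv S fy (1, 0) x, dir_deriv S fy (0, 1) x))"

lemma dir_deriv_add_scale:
  fixes f g :: "'e::euclidean_space \<Rightarrow> real"
  assumes "thick S" "smooth_on S f" "smooth_on S g" "x \<in> S"
  shows "dir_deriv S (\<lambda>x. f x + a * g x) v x = dir_deriv S f v x + a * dir_deriv S g v x"
  by (rule dir_deriv_eq[OF assms(1,4)], rule has_derivative_add)
     (rule smooth_on_has_derivative[OF assms(1,2,4)],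
      rule has_derivative_mult_right[OF smooth_on_has_derivative[OF assms(1,3,4)]])

lemma dir_deriv2_add_scale:
  fixes f g :: "'e::euclidean_space \<Rightarrow> real"
  assumes "thick S" "smooth_on S f" "smooth_on S g" "x \<in> S"
  shows "dir_deriv S (dir_deriv S (\<lambda>x. f x + a * g x) v) w x =
    dir_deriv S (dir_deriv S f v) w x + a * dir_deriv S (dir_deriv S g v) w x"
proof -
  have "dir_deriv S (dir_deriv S (\<lambda>x. f x + a * g x) v) w x =
      dir_deriv S (\<lambda>x. dir_deriv S f v x + a * dir_deriv S g v x) w x"
    by (rule dir_deriv_cong[OF dir_deriv_add_scale[OF assms(1-3)] assms(4)])
  also have "\<dots> = dir_deriv S (dir_deriv S f v) w x + a * dir_deriv S (dir_deriv S g v) w x"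
    by (rule dir_deriv_add_scale[OF assms(1) smooth_on_dir_deriv[OF assms(1,2)]
          smooth_on_dir_deriv[OF assms(1,3)] assms(4)])
  finally show ?thesis .
qed

lemma jet_add_scale:
  assumes "thick S" "smooth_on S f" "smooth_on S g" "x \<in> S"
  shows "jet S (\<lambda>x. f x + a * g x) x = jet S f x + a *\<^sub>R jet S g x"
  by (simp add: jet_def Let_def dir_deriv_add_scale[OF assms] dir_deriv2_add_scale[OF assms])

lemma jet_continuous_on:
  assumes "thick S" "smooth_on S f"
  shows "continuous_on S (jet S f)"
proof -
  have 1: "continuous_on S (\<lambda>x. dir_deriv S f v x)" for v
    by (rule smooth_on_continuous_on[OF smooth_on_dir_deriv[OF assms]])
  have 2: "continuous_on S (\<lambda>x. dir_deriv S (dir_deriv S f v) w x)" for v w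
    by (rule smooth_on_continuous_on[OF smooth_on_dir_deriv[OF assms(1) smooth_on_dir_deriv[OF assms]]])
  show ?thesis unfolding jet_def[abs_def] Let_def
    by (intro continuous_on_Pair 1 2)
qed

text \<open>Uniform continuity in the parameters and the point, on a compact set.\<close>

lemma jet_condition_stable:
  assumes S: "thick S" and K: "compact K" "K \<subseteq> S"
    and f: "smooth_on S f" and g: "smooth_on S g1" "smooth_on S g2"
    and \<Phi>: "continuous_on UNIV \<Phi>" and nz: "\<And>x. x \<in> K \<Longrightarrow> \<Phi> (jet S f x) \<noteq> (0::real)"
  obtains e where "e > 0"
    "\<And>t x. norm t < e \<Longrightarrow> x \<in> K \<Longrightarrow> \<Phi> (jet S (\<lambda>x. (f x + fst t * g1 x) + snd t * g2 x) x) \<noteq> 0"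
proof (cases "K = {}")
  case False
  define J where "J z = \<Phi> ((jet S f (snd z) + fst (fst z) *\<^sub>R jet S g1 (snd z)) + snd (fst z) *\<^sub>R jet S g2 (snd z))"
    for z :: "(real \<times> real) \<times> real \<times> real"
  have JJ: "\<Phi> (jet S (\<lambda>x. (f x + fst t * g1 x) + snd t * g2 x) x) = J (t, x)" if "x \<in> K" for t x
  proof -
    have x: "x \<in> S" using that K(2) by blast
    have fg: "smooth_on S (\<lambda>x. f x + fst t * g1 x)"
      by (rule smooth_on_add[OF f smooth_on_mult[OF smooth_on_const g(1)]])
    show ?thesis
      unfolding J_def fst_conv snd_conv jet_add_scale[OF S fg g(2) x] jet_add_scale[OF S f g(1) x] ..
  qed
  let ?P = "cball (0 :: real \<times> real) 1 \<times> K"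
  have jc: "continuous_on ?P (\<lambda>z. jet S h (snd z))" if "smooth_on S h" for h
    by (rule continuous_on_compose2[OF jet_continuous_on[OF S that] continuous_on_snd[OF continuous_on_id]])
       (use K(2) in auto)
  have "continuous_on ?P J"
    unfolding J_def[abs_def]
    by (rule continuous_on_compose2[OF \<Phi>]) (intro continuous_intros jc f g, simp)
  then have unif: "uniformly_continuous_on ?P J"
    by (intro compact_uniformly_continuous compact_Times compact_cball K(1))
  have "continuous_on K (\<lambda>x. \<bar>\<Phi> (jet S f x)\<bar>)"
    by (intro continuous_on_rabs continuous_on_compose2[OF \<Phi>] continuous_on_subset[OF jet_continuous_on[OF S f] K(2)]) simp
  from continuous_attains_inf[OF K(1) False this]
  obtain x0 where x0: "x0 \<in> K" "\<And>x. x \<in> K \<Longrightarrow> \<bar>\<Phi> (jet S f x0)\<bar> \<le> \<bar>\<Phi> (jet S f x)\<bar>" by blast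
  define m where "m = \<bar>\<Phi> (jet S f x0)\<bar>"
  have "m > 0" using nz[OF x0(1)] by (simp add: m_def)
  obtain d where d: "d > 0" "\<And>z z'. z \<in> ?P \<Longrightarrow> z' \<in> ?P \<Longrightarrow> dist z' z < d \<Longrightarrow> dist (J z') (J z) < m"
    using unif \<open>m > 0\<close> unfolding uniformly_continuous_on_def by meson
  show thesis
  proof (rule that[of "min d 1"])
    fix t :: "real \<times> real" and x assume t: "norm t < min d 1" and x: "x \<in> K"
    have "dist (J (t, x)) (J (0, x)) < m"
      by (rule d(2)) (use t x in \<open>auto simp: dist_Pair_Pair\<close>)
    moreover have "J (0, x) = \<Phi> (jet S f x)" by (simp add: J_def)
    moreover have "m \<le> \<bar>\<Phi> (jet S f x)\<bar>" using x0(2)[OF x] by (simp add: m_def)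
    ultimately have "J (t, x) \<noteq> 0" by (auto simp: dist_real_def)
    then show "\<Phi> (jet S (\<lambda>x. (f x + fst t * g1 x) + snd t * g2 x) x) \<noteq> 0" using JJ[OF x] by simp
  qed (use \<open>d > 0\<close> in auto)
qed (use that[of 1] in auto)

text \<open>Only the values near \<open>x\<close> matter, so a cut-off perturbation can be replaced by the function
  that it agrees with there.\<close>

lemma dir_deriv_local_add:
  fixes f g l :: "'e::euclidean_space \<Rightarrow> real"
  assumes S: "thick S" and f: "smooth_on S f" and W: "openin (top_of_set S) W" "x \<in> W"
    and g: "\<And>y. y \<in> W \<Longrightarrow> g y = f y + l y" and l: "(l has_derivative l') (at x)"
  shows "dir_deriv S g v x = dir_deriv S f v x + l' v"
proof -
  have x: "x \<in> S" using W openin_imp_subset by blast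
  have "((\<lambda>y. f y + l y) has_derivative (\<lambda>v. dir_deriv S f v x + l' v)) (at x within S)"
    by (rule has_derivative_add[OF smooth_on_has_derivative[OF S f x] has_derivative_at_withinI[OF l]])
  then have "((\<lambda>y. f y + l y) has_derivative (\<lambda>v. dir_deriv S f v x + l' v)) (at x within W)"
    unfolding has_derivative_within_openin_iff[OF W] .
  then have "(g has_derivative (\<lambda>v. dir_deriv S f v x + l' v)) (at x within W)"
    by (rule has_derivative_transform[OF W(2), rotated]) (rule g)
  then have "(g has_derivative (\<lambda>v. dir_deriv S f v x + l' v)) (at x within S)"
    unfolding has_derivative_within_openin_iff[OF W] .
  then show ?thesis by (rule dir_deriv_eq[OF S x])
qed

lemma jet_local_add_linear:
  assumes S: "thick S" and f: "smooth_on S f" and W: "openin (top_of_set S) W" "x \<in> W"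
    and g: "\<And>y. y \<in> W \<Longrightarrow> g y = f y + (a * fst y + b * snd y)"
  shows "jet S g x = jet S f x + (a, b, 0, 0, 0, 0)"
proof -
  have l: "((\<lambda>y. a * fst y + b * snd y) has_derivative (\<lambda>v. a * fst v + b * snd v)) (at y)" for y
    by (auto intro!: derivative_eq_intros)
  have 1: "dir_deriv S g v y = dir_deriv S f v y + (a * fst v + b * snd v)" if "y \<in> W" for v y
    by (rule dir_deriv_local_add[OF S f W(1) that g l])
  have 2: "dir_deriv S (dir_deriv S g v) w x = dir_deriv S (dir_deriv S f v) w x + 0" for v w
    by (rule dir_deriv_local_add[OF S smooth_on_dir_deriv[OF S f] W 1 has_derivative_const])
  show ?thesis by (simp add: jet_def Let_def 1[OF W(2)] 2)
qed

section \<open>Perturbing functions on a surface\<close>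

abbreviation chart_jet :: "('a, real \<times> real) chart \<Rightarrow> ('a \<Rightarrow> real) \<Rightarrow> real \<times> real \<Rightarrow> jet" where
  "chart_jet c f \<equiv> jet (chart_image c) (pull c f)"

context compact_surface
begin

text \<open>The conditions that perturbations are to achieve: they persist under small two-parameter
  perturbations, and can be attained by arbitrarily small ones with fixed directions \<open>g1\<close>, \<open>g2\<close>.\<close>

definition stable :: "(('a \<Rightarrow> real) \<Rightarrow> bool) \<Rightarrow> bool" where
  "stable P \<longleftrightarrow> (\<forall>f g1 g2. smoothM f \<and> smoothM g1 \<and> smoothM g2 \<and> P f \<longrightarrow>
     (\<exists>e>0. \<forall>t. norm t < e \<longrightarrow> P (\<lambda>p. (f p + fst t * g1 p) + snd t * g2 p)))"

definition reachable :: "(('a \<Rightarrow> real) \<Rightarrow> bool) \<Rightarrow> bool" where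
  "reachable P \<longleftrightarrow> (\<forall>f. smoothM f \<longrightarrow> (\<exists>g1 g2. smoothM g1 \<and> smoothM g2 \<and>
     (\<forall>e>0. \<exists>t. norm t < e \<and> P (\<lambda>p. (f p + fst t * g1 p) + snd t * g2 p))))"

lemma stable_conj:
  assumes "stable P" "stable Q" shows "stable (\<lambda>f. P f \<and> Q f)"
  unfolding stable_def
proof (intro allI impI)
  fix f g1 g2 assume fg: "smoothM f \<and> smoothM g1 \<and> smoothM g2 \<and> P f \<and> Q f"
  let ?h = "\<lambda>t p. (f p + fst t * g1 p) + snd t * g2 p"
  obtain d where d: "d > 0" "\<forall>t. norm t < d \<longrightarrow> P (?h t)"
    using assms(1)[unfolded stable_def, rule_format, of f g1 g2] fg by blast
  obtain e where e: "e > 0" "\<forall>t. norm t < e \<longrightarrow> Q (?h t)"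
    using assms(2)[unfolded stable_def, rule_format, of f g1 g2] fg by blast
  have "\<forall>t. norm t < min d e \<longrightarrow> P (?h t) \<and> Q (?h t)" using d(2) e(2) by simp
  then show "\<exists>e>0. \<forall>t. norm t < e \<longrightarrow> P (?h t) \<and> Q (?h t)"
    using d(1) e(1) by (intro exI[of _ "min d e"]) simp
qed

lemma stable_Ball:
  assumes "finite I" "\<And>i. i \<in> I \<Longrightarrow> stable (P i)" shows "stable (\<lambda>f. \<forall>i\<in>I. P i f)"
  using assms
proof (induction I rule: finite_induct)
  case empty
  then show ?case by (auto simp: stable_def intro: exI[of _ 1])
next
  case (insert i I)
  then have "stable (\<lambda>f. P i f \<and> (\<forall>i\<in>I. P i f))" by (intro stable_conj) simp_all
  then show ?case by simp
qed

text \<open>The conditions are attained one by one; each perturbation is so small that it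
  preserves the stable ones attained before, which are collected in \<open>Q\<close>.\<close>

lemma reachable_simultaneously:
  assumes "finite I" "\<And>i. i \<in> I \<Longrightarrow> stable (P i)" "\<And>i. i \<in> I \<Longrightarrow> reachable (P i)"
    and "smoothM f" "stable Q" "Q f"
  shows "\<exists>F. smoothM F \<and> Q F \<and> (\<forall>i\<in>I. P i F)"
  using assms
proof (induction I arbitrary: f Q rule: finite_induct)
  case empty
  then show ?case by blast
next
  case (insert i I)
  obtain g1 g2 where g: "smoothM g1" "smoothM g2"
    "\<forall>e>0. \<exists>t. norm t < e \<and> P i (\<lambda>p. (f p + fst t * g1 p) + snd t * g2 p)"
    using insert.prems(2)[of i] insert.prems(3) unfolding reachable_def by blast
  obtain e where e: "e > 0" "\<forall>t. norm t < e \<longrightarrow> Q (\<lambda>p. (f p + fst t * g1 p) + snd t * g2 p)"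
    using insert.prems(4)[unfolded stable_def, rule_format, of f g1 g2] insert.prems(3,5) g by blast
  obtain t where t: "norm t < e" "P i (\<lambda>p. (f p + fst t * g1 p) + snd t * g2 p)"
    using g(3)[rule_format, OF e(1)] by blast
  let ?f = "\<lambda>p. (f p + fst t * g1 p) + snd t * g2 p"
  have "smoothM ?f" by (intro smoothM_add smoothM_cmult insert.prems(3) g(1,2))
  moreover have "stable (\<lambda>f. Q f \<and> P i f)" by (rule stable_conj) (use insert.prems in auto)
  moreover have "Q ?f \<and> P i ?f" using t e(2) by blast
  ultimately have "\<exists>F. smoothM F \<and> (Q F \<and> P i F) \<and> (\<forall>i\<in>I. P i F)"
    by (intro insert.IH[of ?f "\<lambda>f. Q f \<and> P i f"]) (use insert.prems in auto)
  then show ?case by auto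
qed

lemma half_disc_subset: "0 < r \<Longrightarrow> cell c z (3 * r) \<Longrightarrow> half_disc z r \<subseteq> chart_image c"
  using cell_mono[of c z "3 * r" r] unfolding half_disc_def cell_def by simp

lemma cell_chart: "cell c z r \<Longrightarrow> c \<in> A"
  by (simp add: cell_def)

text \<open>The room between the radii \<open>r\<close> and \<open>3 * r\<close> is for a bump that is \<open>1\<close> on a neighbourhood of the
  half-disc of radius \<open>r\<close>.\<close>

definition cell_cover :: "(('a, real \<times> real) chart \<times> (real \<times> real) \<times> real) set \<Rightarrow> bool" where
  "cell_cover I \<longleftrightarrow> finite I \<and> (\<forall>(c, z, r)\<in>I. 0 < r \<and> cell c z (3 * r)) \<and>
     (\<forall>p\<in>topspace X. \<exists>(c, z, r)\<in>I. p \<in> fst c \<and> snd c p \<in> half_disc z r)"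

lemma cell_cover_exists: obtains I where "cell_cover I"
proof -
  let ?T = "{(c, z, r). 0 < r \<and> cell c z (3 * r)}"
  let ?U = "\<lambda>(c, z, r). {p \<in> fst c. snd c p \<in> ball z r}"
  have op: "openin X (?U i)" if "i \<in> ?T" for i
    using that chart_openin_preimage[OF cell_chart open_ball] by auto
  have "topspace X \<subseteq> \<Union> (?U ` ?T)"
  proof
    fix p assume p: "p \<in> topspace X"
    obtain c where c: "c \<in> A" "p \<in> fst c" by (rule chart_at[OF p])
    obtain r where r: "r > 0" "cell c (snd c p) r" by (rule cell_exists[OF c])
    have "(c, snd c p, r / 3) \<in> ?T" using r by simp
    moreover have "p \<in> ?U (c, snd c p, r / 3)" using c r by simp
    ultimately show "p \<in> \<Union> (?U ` ?T)" by blast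
  qed
  moreover have "\<forall>U\<in>?U ` ?T. openin X U" using op by blast
  ultimately obtain F where F: "finite F" "F \<subseteq> ?U ` ?T" "topspace X \<subseteq> \<Union> F"
    using compact unfolding compact_space_alt by meson
  obtain I where I: "I \<subseteq> ?T" "finite I" "F = ?U ` I"
    using finite_subset_image[OF F(1,2)] by blast
  have "cell_cover I"
    unfolding cell_cover_def
  proof (intro conjI ballI)
    show "finite I" by (rule I(2))
    show "case i of (c, z, r) \<Rightarrow> 0 < r \<and> cell c z (3 * r)" if "i \<in> I" for i
      using that I(1) by auto
    fix p assume p: "p \<in> topspace X"
    then obtain i where i: "i \<in> I" "p \<in> ?U i" using F(3) I(3) by blast
    obtain c z r where czr: "i = (c, z, r)" by (cases i)
    have "c \<in> A" using i(1) I(1) czr cell_chart[of c z "3 * r"] by auto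
    then have "snd c p \<in> halfspace"
      using i(2) czr chart_in_image[of p c] chart_image_subset[of c] by auto
    then show "\<exists>(c, z, r)\<in>I. p \<in> fst c \<and> snd c p \<in> half_disc z r"
      using i czr unfolding half_disc_def by (intro bexI[of _ i]) auto
  qed
  then show thesis by (rule that)
qed

lemma pull_perturbed:
  "pull c (\<lambda>p. (f p + a * g1 p) + b * g2 p) = (\<lambda>x. (pull c f x + a * pull c g1 x) + b * pull c g2 x)"
  unfolding pull_def[abs_def] ..

lemma stable_jet_condition:
  assumes "c \<in> A" "compact K" "K \<subseteq> chart_image c" "continuous_on UNIV \<Phi>"
  shows "stable (\<lambda>f. \<forall>x\<in>K. \<Phi> (chart_jet c f x) \<noteq> (0::real))"
  unfolding stable_def
proof (intro allI impI, elim conjE)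
  fix f g1 g2
  assume f: "smoothM f" and g: "smoothM g1" "smoothM g2"
    and nz: "\<forall>x\<in>K. \<Phi> (chart_jet c f x) \<noteq> 0"
  obtain e where e: "e > 0" "\<And>t x. norm t < e \<Longrightarrow> x \<in> K \<Longrightarrow>
     \<Phi> (jet (chart_image c) (\<lambda>x. (pull c f x + fst t * pull c g1 x) + snd t * pull c g2 x) x) \<noteq> 0"
    using jet_condition_stable[OF thick_chart_image[OF assms(1)] assms(2,3) smoothM_pull[OF f assms(1)]
        smoothM_pull[OF g(1) assms(1)] smoothM_pull[OF g(2) assms(1)] assms(4) nz[rule_format]] by blast
  show "\<exists>e>0. \<forall>t. norm t < e \<longrightarrow> (\<forall>x\<in>K.
      \<Phi> (chart_jet c (\<lambda>p. (f p + fst t * g1 p) + snd t * g2 p) x) \<noteq> 0)"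
    unfolding pull_perturbed using e by (intro exI[of _ e] conjI allI impI ballI)
qed

text \<open>The perturbations are the two coordinate functions, cut off outside the half-disc: adding
  them shifts the gradient and keeps the second derivatives.\<close>

lemma reachable_jet_condition:
  assumes r: "0 < r" and cell: "cell c z (3 * r)" and K: "K \<subseteq> half_disc z r"
    and small: "\<And>f e. smoothM f \<Longrightarrow> e > 0 \<Longrightarrow>
      \<exists>t. norm t < e \<and> (\<forall>x\<in>K. \<Phi> (chart_jet c f x + (fst t, snd t, 0, 0, 0, 0)) \<noteq> (0::real))"
  shows "reachable (\<lambda>f. \<forall>x\<in>K. \<Phi> (chart_jet c f x) \<noteq> 0)"
  unfolding reachable_def
proof (intro allI impI)
  fix f assume f: "smoothM f"
  have c: "c \<in> A" by (rule cell_chart[OF cell])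
  have r23: "0 < 2 * r" "2 * r < 3 * r" using r by auto
  obtain \<beta> :: "real \<times> real \<Rightarrow> real" where \<beta>: "smooth_on UNIV \<beta>" "\<And>x. 0 \<le> \<beta> x"
    "\<And>x. x \<in> cball z (2 * r) \<Longrightarrow> \<beta> x = 1" "\<And>x. x \<notin> ball z (3 * r) \<Longrightarrow> \<beta> x = 0"
    by (rule bump_exists[OF r23, where z = z]) blast
  let ?g1 = "extend c (\<lambda>x. \<beta> x * fst x)" and ?g2 = "extend c (\<lambda>x. \<beta> x * snd x)"
  let ?h = "\<lambda>t p. (f p + fst t * ?g1 p) + snd t * ?g2 p"
  have g: "smoothM ?g1" "smoothM ?g2"
    by (rule smoothM_extend[OF cell smooth_on_mult[OF \<beta>(1) smooth_on_fst[OF smooth_on_ident]]],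
        simp add: \<beta>(4),
        rule smoothM_extend[OF cell smooth_on_mult[OF \<beta>(1) smooth_on_snd[OF smooth_on_ident]]],
        simp add: \<beta>(4))
  have jet: "chart_jet c (?h t) x = chart_jet c f x + (fst t, snd t, 0, 0, 0, 0)" if x: "x \<in> K" for t x
  proof -
    let ?W = "chart_image c \<inter> ball z (2 * r)"
    have xW: "x \<in> ?W" using x K half_disc_subset[OF r cell] r unfolding half_disc_def by auto
    have Wo: "openin (top_of_set (chart_image c)) ?W" by (simp add: openin_open_Int)
    show ?thesis
    proof (rule jet_local_add_linear[OF thick_chart_image[OF c] smoothM_pull[OF f c] Wo xW])
      fix y assume y: "y \<in> ?W"
      then have "\<beta> y = 1" by (intro \<beta>(3)) simp
      then show "pull c (?h t) y = pull c f y + (fst t * fst y + snd t * snd y)"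
        using y by (simp add: pull_perturbed pull_extend)
    qed
  qed
  have "\<exists>t. norm t < e \<and> (\<forall>x\<in>K. \<Phi> (chart_jet c (?h t) x) \<noteq> 0)" if e: "e > 0" for e
  proof -
    obtain t where t: "norm t < e" "\<forall>x\<in>K. \<Phi> (chart_jet c f x + (fst t, snd t, 0, 0, 0, 0)) \<noteq> 0"
      using small[OF f e] by blast
    have "\<Phi> (chart_jet c (?h t) x) \<noteq> 0" if x: "x \<in> K" for x
      unfolding jet[OF x] using t(2) x by (rule bspec)
    then show ?thesis using t(1) by blast
  qed
  then show "\<exists>g1 g2. smoothM g1 \<and> smoothM g2 \<and> (\<forall>e>0. \<exists>t. norm t < e \<and>
      (\<forall>x\<in>K. \<Phi> (chart_jet c (\<lambda>p. (f p + fst t * g1 p) + snd t * g2 p) x) \<noteq> 0))"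
    using g by (intro exI[of _ ?g1] exI[of _ ?g2] conjI allI impI)
qed

text \<open>The conditions on jets are written as sums of squares whose nonvanishing is required: a
  critical point has nonsingular Hessian; there is no critical point; a point that is critical along
  the vertical direction has nonzero second derivative in it.\<close>

definition nondegenerate :: "jet \<Rightarrow> real" where
  "nondegenerate = (\<lambda>(fx, fy, fxx, fxy, fyx, fyy). fx\<^sup>2 + fy\<^sup>2 + (fxx * fyy - fxy * fyx)\<^sup>2)"

definition nonsingular :: "jet \<Rightarrow> real" where
  "nonsingular = (\<lambda>(fx, fy, fxx, fxy, fyx, fyy). fx\<^sup>2 + fy\<^sup>2)"

definition boundary_nondegenerate :: "jet \<Rightarrow> real" where
  "boundary_nondegenerate = (\<lambda>(fx, fy, fxx, fxy, fyx, fyy). fy\<^sup>2 + fyy\<^sup>2)"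

lemma continuous_jet_conditions:
  "continuous_on UNIV nondegenerate" "continuous_on UNIV nonsingular"
  "continuous_on UNIV boundary_nondegenerate"
  unfolding nondegenerate_def nonsingular_def boundary_nondegenerate_def split_beta
  by (intro continuous_intros)+

text \<open>A parameter \<open>t\<close> is bad iff it is the value of minus the gradient at a point where the Hessian is
  singular, that is, a critical value of that map.\<close>

lemma reachable_nondegenerate:
  assumes r: "0 < r" and cell: "cell c z (3 * r)"
  shows "reachable (\<lambda>f. \<forall>x\<in>half_disc z r. nondegenerate (chart_jet c f x) \<noteq> 0)"
proof (rule reachable_jet_condition[OF r cell order_refl])
  fix f and e :: real assume f: "smoothM f" and "e > 0"
  have c: "c \<in> A" by (rule cell_chart[OF cell])
  let ?S = "chart_image c"
  note S = thick_chart_image[OF c]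
  define fx fy where "fx = chart_deriv c f (1, 0)" and "fy = chart_deriv c f (0, 1)"
  have sm: "smooth_on ?S fx" "smooth_on ?S fy"
    unfolding fx_def fy_def by (intro smooth_on_dir_deriv[OF S] smoothM_pull[OF f c])+
  let ?det = "\<lambda>x. dir_deriv ?S fx (1, 0) x * dir_deriv ?S fy (0, 1) x
    - dir_deriv ?S fx (0, 1) x * dir_deriv ?S fy (1, 0) x"
  let ?Z = "{x \<in> half_disc z r. ?det x = 0}"
  have Z: "?Z \<subseteq> ?S" using half_disc_subset[OF r cell] by blast
  define G where "G x = (- fx x, - fy x)" for x
  obtain t where t: "norm t < e" "t \<notin> G ` ?Z"
  proof (rule Sard_plane[OF _ _ \<open>e > 0\<close>])
    fix x assume x: "x \<in> ?Z"
    then have xS: "x \<in> ?S" using Z by blast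
    show "(G has_derivative (\<lambda>v. (- dir_deriv ?S fx v x, - dir_deriv ?S fy v x))) (at x within ?Z)"
      unfolding G_def[abs_def]
      by (rule has_derivative_Pair[OF
            has_derivative_minus[OF has_derivative_subset[OF smooth_on_has_derivative[OF S sm(1) xS] Z]]
            has_derivative_minus[OF has_derivative_subset[OF smooth_on_has_derivative[OF S sm(2) xS] Z]]])
    have "?det x = 0" using x by blast
    then obtain w where w: "w \<noteq> 0"
      "fst w * dir_deriv ?S fx (1, 0) x + snd w * dir_deriv ?S fx (0, 1) x = 0"
      "fst w * dir_deriv ?S fy (1, 0) x + snd w * dir_deriv ?S fy (0, 1) x = 0"
      unfolding singular_2x2[symmetric] by blast
    then have "dir_deriv ?S fx w x = 0" "dir_deriv ?S fy w x = 0"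
      using dir_deriv_plane[OF S sm(1) xS, of w] dir_deriv_plane[OF S sm(2) xS, of w] by simp_all
    then show "\<exists>w. w \<noteq> 0 \<and> (- dir_deriv ?S fx w x, - dir_deriv ?S fy w x) = 0"
      using w(1) by (intro exI[of _ w]) (simp add: zero_prod_def)
  qed blast
  have "nondegenerate (chart_jet c f x + (fst t, snd t, 0, 0, 0, 0)) \<noteq> 0" if x: "x \<in> half_disc z r" for x
  proof
    assume "nondegenerate (chart_jet c f x + (fst t, snd t, 0, 0, 0, 0)) = 0"
    then have "(fx x + fst t)\<^sup>2 + (fy x + snd t)\<^sup>2 + (?det x)\<^sup>2 = 0"
      by (simp add: nondegenerate_def jet_def Let_def fx_def fy_def)
    then have "fx x + fst t = 0" "fy x + snd t = 0" "?det x = 0"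
      by (simp_all add: add_nonneg_eq_0_iff)
    then have "x \<in> ?Z" "t = G x" using x by (auto simp: G_def prod_eq_iff)
    then show False using t(2) by blast
  qed
  then show "\<exists>t. norm t < e \<and> (\<forall>x\<in>half_disc z r.
      nondegenerate (chart_jet c f x + (fst t, snd t, 0, 0, 0, 0)) \<noteq> 0)"
    using t(1) by blast
qed

text \<open>Here the bad parameters are the critical values of \<open>y \<mapsto> - \<partial>\<^sub>y f (0, y)\<close>. Taking the product with the
  identity in the first coordinate turns this map into one of the plane.\<close>

lemma reachable_boundary_nondegenerate:
  assumes r: "0 < r" and cell: "cell c z (3 * r)"
  shows "reachable (\<lambda>f. \<forall>x\<in>half_disc z r \<inter> {x. fst x = 0}. boundary_nondegenerate (chart_jet c f x) \<noteq> 0)"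
proof (rule reachable_jet_condition[OF r cell Int_lower1])
  fix f and e :: real assume f: "smoothM f" and "e > 0"
  have c: "c \<in> A" by (rule cell_chart[OF cell])
  let ?S = "chart_image c"
  note S = thick_chart_image[OF c]
  define fy where "fy = chart_deriv c f (0, 1)"
  have sm: "smooth_on ?S fy"
    unfolding fy_def by (intro smooth_on_dir_deriv[OF S] smoothM_pull[OF f c])
  let ?Z = "{x :: real \<times> real. (0, snd x) \<in> half_disc z r \<and> dir_deriv ?S fy (0, 1) (0, snd x) = 0}"
  define G where "G x = (fst x, - fy (0, snd x))" for x :: "real \<times> real"
  obtain t where t: "norm t < e" "t \<notin> G ` ?Z"
  proof (rule Sard_plane[OF _ _ \<open>e > 0\<close>])
    fix x assume x: "x \<in> ?Z"
    have im: "(\<lambda>x. (0, snd x)) ` ?Z \<subseteq> ?S" using half_disc_subset[OF r cell] by blast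
    have xS: "(0, snd x) \<in> ?S" using x im by blast
    have "((\<lambda>x. (0, snd x)) has_derivative (\<lambda>v. (0, snd v))) (at x within ?Z)"
      by (rule has_derivative_Pair[OF has_derivative_const has_derivative_snd[OF has_derivative_ident]])
    from has_derivative_in_compose[OF this
        has_derivative_subset[OF smooth_on_has_derivative[OF S sm xS] im]]
    show "(G has_derivative (\<lambda>v. (fst v, - dir_deriv ?S fy (0, snd v) (0, snd x)))) (at x within ?Z)"
      unfolding G_def[abs_def]
      by (rule has_derivative_Pair[OF has_derivative_fst[OF has_derivative_ident] has_derivative_minus])
    show "\<exists>w. w \<noteq> 0 \<and> (fst w, - dir_deriv ?S fy (0, snd w) (0, snd x)) = 0"
      using x by (intro exI[of _ "(0, 1)"]) (simp add: zero_prod_def)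
  qed blast
  have "boundary_nondegenerate (chart_jet c f x + (0, snd t, 0, 0, 0, 0)) \<noteq> 0"
    if x: "x \<in> half_disc z r" "fst x = 0" for x
  proof
    assume "boundary_nondegenerate (chart_jet c f x + (0, snd t, 0, 0, 0, 0)) = 0"
    then have "(fy x + snd t)\<^sup>2 + (dir_deriv ?S fy (0, 1) x)\<^sup>2 = 0"
      by (simp add: boundary_nondegenerate_def jet_def Let_def fy_def)
    then have e: "fy x + snd t = 0" "dir_deriv ?S fy (0, 1) x = 0" by simp_all
    have x0: "(0, snd x) = x" using x(2) by (simp add: prod_eq_iff)
    have "(fst t, snd x) \<in> ?Z" using x e(2) by (simp add: x0)
    moreover have "t = G (fst t, snd x)" using e(1) by (simp add: G_def x0 prod_eq_iff)
    ultimately show False using t(2) by blast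
  qed
  \<comment> \<open>Only the second coordinate of \<open>t\<close> is needed, and dropping the first decreases the norm.\<close>
  moreover have "norm (0 :: real, snd t) < e"
    using t(1) norm_snd_le[of "snd t" "fst t"] by (simp add: norm_Pair)
  ultimately show "\<exists>t. norm t < e \<and> (\<forall>x\<in>half_disc z r \<inter> {x. fst x = 0}.
      boundary_nondegenerate (chart_jet c f x + (fst t, snd t, 0, 0, 0, 0)) \<noteq> 0)"
    by (intro exI[of _ "(0, snd t)"]) auto
qed

section \<open>Functions without critical points\<close>

lemma crit_in_chart:
  assumes f: "smoothM f" and c: "c \<in> A" and p: "p \<in> fst c"
  shows "p \<in> crit f \<longleftrightarrow> nonsingular (chart_jet c f (snd c p)) = 0"
proof -
  have x: "snd c p \<in> chart_image c" by (rule chart_in_image[OF p])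
  let ?D = "\<lambda>v. chart_deriv c f v (snd c p)"
  have lin: "?D v = fst v * ?D (1, 0) + snd v * ?D (0, 1)" for v
    using dir_deriv_plane[OF thick_chart_image[OF c] smoothM_pull[OF f c] x, of v] by simp
  have "(\<forall>v. ?D v = 0) \<longleftrightarrow> ?D (1, 0) = 0 \<and> ?D (0, 1) = 0"
  proof
    assume z: "?D (1, 0) = 0 \<and> ?D (0, 1) = 0"
    show "\<forall>v. ?D v = 0"
    proof
      fix v show "?D v = 0" using lin[of v] z by (metis add_0 mult_zero_right)
    qed
  qed blast
  then show ?thesis
    unfolding crit_iff[OF f c p] by (simp add: nonsingular_def jet_def Let_def)
qed

text \<open>An accumulation point of critical points would be critical itself, yet the gradient has an injective
  derivative there and so an isolated zero.\<close>

lemma finite_crit_in_half_disc: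
  assumes r: "0 < r" and cell: "cell c z (3 * r)" and f: "smoothM f"
    and nd: "\<And>x. x \<in> half_disc z r \<Longrightarrow> nondegenerate (chart_jet c f x) \<noteq> 0"
  shows "finite {x \<in> half_disc z r. nonsingular (chart_jet c f x) = 0}"
proof (rule ccontr)
  let ?S = "chart_image c" and ?K = "half_disc z r"
  have c: "c \<in> A" by (rule cell_chart[OF cell])
  note S = thick_chart_image[OF c]
  have KS: "?K \<subseteq> ?S" by (rule half_disc_subset[OF r cell])
  define fx fy where "fx = chart_deriv c f (1, 0)" and "fy = chart_deriv c f (0, 1)"
  have sm: "smooth_on ?S fx" "smooth_on ?S fy"
    unfolding fx_def fy_def by (intro smooth_on_dir_deriv[OF S] smoothM_pull[OF f c])+
  define G where "G x = (fx x, fy x)" for x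
  let ?Z = "{x \<in> ?K. nonsingular (jet ?S (pull c f) x) = 0}"
  have Z: "?Z = {x \<in> ?K. G x = 0}"
    by (simp add: nonsingular_def jet_def Let_def G_def fx_def fy_def zero_prod_def)
  assume "infinite ?Z"
  then obtain x where x: "x \<in> ?K" "x islimpt ?Z"
    using compact_half_disc[of z r] unfolding compact_eq_Bolzano_Weierstrass by blast
  have xS: "x \<in> ?S" using x(1) KS by blast
  have "continuous_on ?K G" unfolding G_def[abs_def]
    by (intro continuous_on_Pair continuous_on_subset[OF smooth_on_continuous_on KS] sm)
  then have "closed ?Z" unfolding Z
    using continuous_closed_preimage_constant[of ?K G 0] compact_imp_closed[OF compact_half_disc] by blast
  then have "x \<in> ?Z" using x(2) unfolding closed_limpt by blast
  then have Gx: "G x = 0" unfolding Z by blast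
  let ?D = "\<lambda>v. (dir_deriv ?S fx v x, dir_deriv ?S fy v x)"
  have der: "(G has_derivative ?D) (at x within ?S)"
    unfolding G_def[abs_def]
    by (rule has_derivative_Pair[OF smooth_on_has_derivative[OF S sm(1) xS] smooth_on_has_derivative[OF S sm(2) xS]])
  have "inj ?D"
    unfolding linear_injective_0[OF has_derivative_linear[OF der]]
  proof (intro allI impI)
    fix w assume w: "?D w = 0"
    have "fst w * dir_deriv ?S fx (1, 0) x + snd w * dir_deriv ?S fx (0, 1) x = 0"
      "fst w * dir_deriv ?S fy (1, 0) x + snd w * dir_deriv ?S fy (0, 1) x = 0"
      using dir_deriv_plane[OF S sm(1) xS, of w] dir_deriv_plane[OF S sm(2) xS, of w] w
      by (auto simp: zero_prod_def)
    moreover have "dir_deriv ?S fx (1, 0) x * dir_deriv ?S fy (0, 1) x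
        - dir_deriv ?S fx (0, 1) x * dir_deriv ?S fy (1, 0) x \<noteq> 0"
      using nd[OF x(1)] Gx
      by (auto simp: nondegenerate_def jet_def Let_def G_def fx_def fy_def zero_prod_def)
    ultimately show "w = 0" unfolding singular_2x2[symmetric] by blast
  qed
  then obtain d where d: "d > 0" "\<And>y. y \<in> ?S \<Longrightarrow> y \<noteq> x \<Longrightarrow> dist y x < d \<Longrightarrow> G y \<noteq> 0"
    using isolated_zero[OF der _ Gx] by blast
  obtain y where "y \<in> ?Z" "y \<noteq> x" "dist y x < d"
    using x(2) d(1) unfolding islimpt_approachable by blast
  then show False using d(2)[of y] KS unfolding Z by blast
qed

lemma finite_crit:
  assumes f: "smoothM f" and I: "cell_cover I"
    and nd: "\<And>c z r x. (c, z, r) \<in> I \<Longrightarrow> x \<in> half_disc z r \<Longrightarrow>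
      nondegenerate (chart_jet c f x) \<noteq> 0"
  shows "finite (crit f)"
proof -
  let ?Z = "\<lambda>(c, z, r). chart_inv c ` {x \<in> half_disc z r. nonsingular (chart_jet c f x) = 0}"
  have "finite (?Z i)" if "i \<in> I" for i
  proof -
    obtain c z r where i: "i = (c, z, r)" by (cases i)
    then have "0 < r" "cell c z (3 * r)" using I that unfolding cell_cover_def by auto
    then show ?thesis using finite_crit_in_half_disc[OF _ _ f nd] that unfolding i by simp
  qed
  moreover have "finite I" using I by (simp add: cell_cover_def)
  ultimately have "finite (\<Union>i\<in>I. ?Z i)" by blast
  moreover have "crit f \<subseteq> (\<Union>i\<in>I. ?Z i)"
  proof
    fix p assume p: "p \<in> crit f"
    then have "p \<in> topspace X" by (simp add: crit_def)
    then obtain c z r where i: "(c, z, r) \<in> I" "p \<in> fst c" "snd c p \<in> half_disc z r"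
      using I unfolding cell_cover_def by blast
    have "cell c z (3 * r)" using I i(1) unfolding cell_cover_def by auto
    then have c: "c \<in> A" by (rule cell_chart)
    have "nonsingular (chart_jet c f (snd c p)) = 0"
      using p crit_in_chart[OF f c i(2)] by simp
    then have "p \<in> ?Z (c, z, r)" using i(3) chart_inv_chart[OF c i(2)] by force
    then show "p \<in> (\<Union>i\<in>I. ?Z i)" using i(1) by blast
  qed
  ultimately show ?thesis by (rule rev_finite_subset)
qed

text \<open>The embeddings used to remove the critical points move the boundary, hence nondegeneracy
  along the boundary can only be arranged afterwards, while keeping the surface free of critical points.\<close>

lemma good_function_exists:
  assumes "connected_space X" "manifold_boundary A \<noteq> {}"
  obtains F where "smoothM F" "crit F = {}"
    "\<And>p. p \<in> topspace X \<Longrightarrow> \<exists>c\<in>A. p \<in> fst c \<and> (fst (snd c p) = 0 \<longrightarrow>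
       boundary_nondegenerate (chart_jet c F (snd c p)) \<noteq> 0)"
proof -
  obtain I where I: "cell_cover I" by (rule cell_cover_exists)
  then have fin: "finite I" by (simp add: cell_cover_def)
  have cellI: "0 < r" "cell c z (3 * r)" if "(c, z, r) \<in> I" for c z r
    using I that unfolding cell_cover_def by auto
  define N where "N = (\<lambda>(c :: ('a, real \<times> real) chart, z, r) f. \<forall>x\<in>half_disc z r. nondegenerate (chart_jet c f x) \<noteq> 0)"
  define Q where "Q = (\<lambda>(c :: ('a, real \<times> real) chart, z, r) f. \<forall>x\<in>half_disc z r. nonsingular (chart_jet c f x) \<noteq> 0)"
  define B where "B = (\<lambda>(c :: ('a, real \<times> real) chart, z, r) f. \<forall>x\<in>half_disc z r \<inter> {x. fst x = 0}.
    boundary_nondegenerate (chart_jet c f x) \<noteq> 0)"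
  have NQB: "stable (N i) \<and> reachable (N i) \<and> stable (Q i) \<and> stable (B i) \<and> reachable (B i)" if "i \<in> I" for i
  proof -
    obtain c z r where i: "i = (c, z, r)" by (cases i)
    note cell = cellI[OF that[unfolded i]]
    have c: "c \<in> A" by (rule cell_chart[OF cell(2)])
    have K: "half_disc z r \<subseteq> chart_image c" by (rule half_disc_subset[OF cell])
    have "closed {x :: real \<times> real. fst x = 0}"
      by (intro closed_Collect_eq continuous_intros)
    then have K': "compact (half_disc z r \<inter> {x. fst x = 0})"
      by (rule compact_Int_closed[OF compact_half_disc])
    have K'S: "half_disc z r \<inter> {x. fst x = 0} \<subseteq> chart_image c" using K by blast
    show ?thesis
      unfolding i N_def Q_def B_def prod.case
      using stable_jet_condition[OF c compact_half_disc K continuous_jet_conditions(1)]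
        stable_jet_condition[OF c compact_half_disc K continuous_jet_conditions(2)]
        stable_jet_condition[OF c K' K'S continuous_jet_conditions(3)]
        reachable_nondegenerate[OF cell] reachable_boundary_nondegenerate[OF cell]
      by (intro conjI)
  qed
  \<comment> \<open>A Morse function, found as a perturbation of the zero function.\<close>
  have "\<exists>F. smoothM F \<and> True \<and> (\<forall>i\<in>I. N i F)"
    by (rule reachable_simultaneously[OF fin, where f = "\<lambda>p. 0"])
       (use NQB smoothM_const in \<open>auto simp: stable_def intro: exI[of _ 1]\<close>)
  then obtain f where f: "smoothM f" "\<forall>i\<in>I. N i f" by blast
  have "finite (crit f)"
    by (rule finite_crit[OF f(1) I]) (use f(2) in \<open>force simp: N_def\<close>)
  then obtain f0 where f0: "smoothM f0" "crit f0 = {}"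
    using finite_crit_removable[OF all_avoidable[OF assms] f(1)] by blast
  have "\<forall>i\<in>I. Q i f0"
  proof
    fix i assume i: "i \<in> I"
    obtain c z r where czr: "i = (c, z, r)" by (cases i)
    note cell = cellI[OF i[unfolded czr]]
    have c: "c \<in> A" by (rule cell_chart[OF cell(2)])
    have "nonsingular (chart_jet c f0 x) \<noteq> 0" if "x \<in> half_disc z r" for x
    proof -
      have x: "x \<in> chart_image c" using that half_disc_subset[OF cell] by blast
      show ?thesis
        using crit_in_chart[OF f0(1) c chart_inv_in[OF x]] f0(2) by (simp add: chart_chart_inv[OF x])
    qed
    then show "Q i f0" unfolding czr Q_def by simp
  qed
  moreover have "stable (\<lambda>f. \<forall>i\<in>I. Q i f)" by (rule stable_Ball[OF fin]) (use NQB in blast)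
  ultimately have "\<exists>F. smoothM F \<and> (\<forall>i\<in>I. Q i F) \<and> (\<forall>i\<in>I. B i F)"
    by (intro reachable_simultaneously[OF fin _ _ f0(1)]) (use NQB in blast)+
  then obtain F where F: "smoothM F" "\<forall>i\<in>I. Q i F" "\<forall>i\<in>I. B i F" by blast
  have cover: "\<exists>c z r. (c, z, r) \<in> I \<and> c \<in> A \<and> p \<in> fst c \<and> snd c p \<in> half_disc z r"
    if "p \<in> topspace X" for p
  proof -
    obtain c z r where i: "(c, z, r) \<in> I" "p \<in> fst c" "snd c p \<in> half_disc z r"
      using I \<open>p \<in> topspace X\<close> unfolding cell_cover_def by blast
    then show ?thesis using cell_chart[OF cellI(2)[OF i(1)]] by blast
  qed
  show thesis
  proof (rule that[OF F(1)])
    show "crit F = {}"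
    proof (rule equals0I)
      fix p assume p: "p \<in> crit F"
      then have "p \<in> topspace X" by (simp add: crit_def)
      then obtain c z r where i: "(c, z, r) \<in> I" "c \<in> A" "p \<in> fst c" "snd c p \<in> half_disc z r"
        using cover by blast
      have "Q (c, z, r) F" using F(2) i(1) by blast
      then have "nonsingular (chart_jet c F (snd c p)) \<noteq> 0"
        using i(4) unfolding Q_def by simp
      then show False using p crit_in_chart[OF F(1) i(2,3)] by simp
    qed
    fix p assume "p \<in> topspace X"
    then obtain c z r where i: "(c, z, r) \<in> I" "c \<in> A" "p \<in> fst c" "snd c p \<in> half_disc z r"
      using cover by blast
    have "B (c, z, r) F" using F(3) i(1) by blast
    then have "fst (snd c p) = 0 \<longrightarrow> boundary_nondegenerate (chart_jet c F (snd c p)) \<noteq> 0"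
      using i(4) unfolding B_def by simp
    then show "\<exists>c\<in>A. p \<in> fst c \<and> (fst (snd c p) = 0 \<longrightarrow>
       boundary_nondegenerate (chart_jet c F (snd c p)) \<noteq> 0)"
      using i(2,3) by blast
  qed
qed

lemma smoothM_continuous:
  assumes "smoothM f" shows "continuous_map X euclideanreal f"
  unfolding continuous_map_def
proof (intro conjI allI impI)
  fix T :: "real set" assume "openin euclidean T"
  then have T: "open T" by simp
  let ?P = "{p \<in> topspace X. f p \<in> T}"
  show "openin X ?P"
    unfolding openin_subopen[of X ?P]
  proof
    fix p assume p: "p \<in> ?P"
    then obtain c where c: "c \<in> A" "p \<in> fst c" using chart_at by blast
    have "continuous_on (chart_image c) (pull c f)"
      by (rule smooth_on_continuous_on[OF smoothM_pull[OF assms c(1)]])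
    then obtain V where V: "open V" "V \<inter> chart_image c = pull c f -` T \<inter> chart_image c"
      using T unfolding continuous_on_open_invariant by blast
    have inV: "snd c q \<in> V \<longleftrightarrow> f q \<in> T" if q: "q \<in> fst c" for q
    proof -
      have "pull c f (snd c q) = f q" by (simp add: pull_def chart_inv_chart[OF c(1) q])
      moreover have "snd c q \<in> V \<inter> chart_image c \<longleftrightarrow> snd c q \<in> pull c f -` T \<inter> chart_image c"
        unfolding V(2) ..
      ultimately show ?thesis by (simp add: chart_in_image[OF q])
    qed
    let ?N = "{q \<in> fst c. snd c q \<in> V}"
    have "openin X ?N" by (rule chart_openin_preimage[OF c(1) V(1)])
    moreover have "p \<in> ?N" using p c(2) inV by simp
    moreover have "?N \<subseteq> ?P" using inV chart_dom_subset[OF c(1)] by auto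
    ultimately show "\<exists>N. openin X N \<and> p \<in> N \<and> N \<subseteq> ?P" by blast
  qed
qed auto

section \<open>The boundary curve\<close>

text \<open>A chart change is a diffeomorphism into the half-plane. If it sent an interior point of the
  half-plane to the edge, its first coordinate would have a minimum, hence a vanishing derivative there.\<close>

lemma boundary_invariant:
  assumes c: "c \<in> A" and d: "d \<in> A" and p: "p \<in> fst c" "p \<in> fst d" and d0: "fst (snd d p) = 0"
  shows "fst (snd c p) = 0"
proof (rule ccontr)
  assume "fst (snd c p) \<noteq> 0"
  moreover have "fst (snd c p) \<ge> 0"
    using chart_in_image[OF p(1)] chart_image_subset[OF c] by (auto simp: halfspace_def)
  ultimately have pos: "fst (snd c p) > 0" by simp
  let ?V = "snd c ` (fst c \<inter> fst d)" and ?U = "snd d ` (fst d \<inter> fst c)"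
  let ?\<tau> = "\<lambda>y. snd d (chart_inv c y)" and ?\<sigma> = "\<lambda>y. snd c (chart_inv d y)"
  let ?x = "snd c p"
  have Vo: "openin (top_of_set (chart_image c)) ?V"
    by (rule chart_openin_image_of[OF c openin_Int[OF chart_openin_dom[OF c] chart_openin_dom[OF d]]]) blast
  have Uo: "openin (top_of_set (chart_image d)) ?U"
    by (rule chart_openin_image_of[OF d openin_Int[OF chart_openin_dom[OF d] chart_openin_dom[OF c]]]) blast
  have V: "thick ?V" and U: "thick ?U"
    by (rule thick_openin[OF thick_chart_image[OF c] Vo], rule thick_openin[OF thick_chart_image[OF d] Uo])
  have xV: "?x \<in> ?V" and yU: "snd d p \<in> ?U" using p by auto
  have \<tau>: "smooth_on ?V ?\<tau>" by (rule transition_smooth[OF c d])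
  have \<sigma>: "smooth_on ?U ?\<sigma>" by (rule transition_smooth[OF d c])
  have \<sigma>U: "?\<sigma> ` ?U \<subseteq> ?V" by (auto simp: chart_inv_chart[OF d])
  have \<tau>\<sigma>: "?\<tau> (?\<sigma> y) = y" if y: "y \<in> ?U" for y
  proof -
    obtain q where "q \<in> fst d" "q \<in> fst c" "y = snd d q" using y by blast
    then show ?thesis by (simp add: chart_inv_chart[OF c] chart_inv_chart[OF d])
  qed
  have sp: "?\<sigma> (snd d p) = ?x" by (simp add: chart_inv_chart[OF d p(2)])
  \<comment> \<open>The direction that the chart change maps to the inward normal.\<close>
  let ?v = "dir_deriv ?U ?\<sigma> (1, 0) (snd d p)"
  have "dir_deriv ?V ?\<tau> ?v ?x = dir_deriv ?U (\<lambda>y. ?\<tau> (?\<sigma> y)) (1, 0) (snd d p)"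
    using dir_deriv_compose[OF U V \<sigma> \<tau> \<sigma>U yU, of "(1, 0)"] unfolding sp by (rule sym)
  also have "\<dots> = dir_deriv ?U (\<lambda>y. y) (1, 0) (snd d p)"
    by (rule dir_deriv_cong[OF \<tau>\<sigma> yU])
  also have "\<dots> = (1, 0)" by (rule dir_deriv_eq[OF U yU has_derivative_ident])
  finally have one: "fst (dir_deriv ?V ?\<tau> ?v ?x) = 1" by simp
  obtain T where T: "open T" "?V = chart_image c \<inter> T" using Vo unfolding openin_open by blast
  obtain T' where T': "open T'" "chart_image c = halfspace \<inter> T'"
    using chart_openin_image[OF c] unfolding openin_open by blast
  let ?W = "T \<inter> T' \<inter> {y. 0 < fst y}"
  have "open {y :: real \<times> real. 0 < fst y}" by (intro open_Collect_less continuous_intros)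
  then have W: "open ?W" using T(1) T'(1) by blast
  have WV: "?W \<subseteq> ?V" unfolding T(2) T'(2) by (auto simp: halfspace_def)
  have xW: "?x \<in> ?W" using xV pos unfolding T(2) T'(2) by blast
  have "(?\<tau> has_derivative (\<lambda>v. dir_deriv ?V ?\<tau> v ?x)) (at ?x)"
    using has_derivative_subset[OF smooth_on_has_derivative[OF V \<tau> xV] WV]
    unfolding at_within_open[OF xW W] .
  then have der: "((\<lambda>y. fst (?\<tau> y)) has_derivative (\<lambda>v. fst (dir_deriv ?V ?\<tau> v ?x))) (at ?x)"
    by (rule has_derivative_fst)
  have "\<forall>y\<in>?W. fst (?\<tau> ?x) \<le> fst (?\<tau> y)"
  proof
    fix y assume "y \<in> ?W"
    then obtain q where q: "q \<in> fst c" "q \<in> fst d" "y = snd c q" using WV by blast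
    have "fst (?\<tau> y) \<ge> 0"
      using chart_in_image[OF q(2)] chart_image_subset[OF d] q
      by (auto simp: halfspace_def chart_inv_chart[OF c])
    then show "fst (?\<tau> ?x) \<le> fst (?\<tau> y)" using d0 by (simp add: chart_inv_chart[OF c p(1)])
  qed
  then have "(\<lambda>v. fst (dir_deriv ?V ?\<tau> v ?x)) = (\<lambda>v. 0)"
    using differential_zero_maxmin[OF xW W der] by blast
  from fun_cong[OF this, of ?v] one show False by simp
qed

lemma in_boundary_iff:
  assumes "c \<in> A" "p \<in> fst c"
  shows "p \<in> manifold_boundary A \<longleftrightarrow> fst (snd c p) = 0"
proof
  assume "p \<in> manifold_boundary A"
  then obtain d where "d \<in> A" "p \<in> fst d" "fst (snd d p) = 0"
    unfolding manifold_boundary_def by fastforce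
  then show "fst (snd c p) = 0" using boundary_invariant[OF assms(1) _ assms(2)] by blast
next
  assume "fst (snd c p) = 0"
  then show "p \<in> manifold_boundary A"
    using assms unfolding manifold_boundary_def by (auto intro!: bexI[of _ c] split: prod.splits)
qed

definition edge_image :: "('a, real \<times> real) chart \<Rightarrow> real set" where
  "edge_image c = {y. (0, y) \<in> chart_image c}"

definition edge_inv :: "('a, real \<times> real) chart \<Rightarrow> real \<Rightarrow> 'a" where
  "edge_inv c y = chart_inv c (0, y)"

text \<open>The image of \<open>c\<close> under the map that defines \<open>boundary_atlas\<close>.\<close>

definition edge_chart :: "('a, real \<times> real) chart \<Rightarrow> ('a, real) chart" where
  "edge_chart c = (fst c \<inter> manifold_boundary A, snd \<circ> snd c)"

lemma boundary_atlas_eq: "boundary_atlas A = edge_chart ` A"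
  unfolding boundary_atlas_def edge_chart_def by (auto simp: split_beta image_iff)

lemma open_edge_image: assumes "c \<in> A" shows "open (edge_image c)"
proof -
  obtain T where T: "open T" "chart_image c = halfspace \<inter> T"
    using chart_openin_image[OF assms] unfolding openin_open by blast
  have "edge_image c = Pair 0 -` T" unfolding edge_image_def T(2) by (auto simp: halfspace_def)
  moreover have "open (Pair (0::real) -` T)"
    by (rule open_vimage[OF T(1)]) (intro continuous_intros)
  ultimately show ?thesis by simp
qed

lemma edge_inv_in:
  assumes "c \<in> A" "y \<in> edge_image c"
  shows "edge_inv c y \<in> fst c \<inter> manifold_boundary A" "snd c (edge_inv c y) = (0, y)"
proof -
  have y: "(0, y) \<in> chart_image c" using assms(2) by (simp add: edge_image_def)
  show s: "snd c (edge_inv c y) = (0, y)" unfolding edge_inv_def by (rule chart_chart_inv[OF y])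
  have "edge_inv c y \<in> fst c" unfolding edge_inv_def by (rule chart_inv_in[OF y])
  then show "edge_inv c y \<in> fst c \<inter> manifold_boundary A"
    using in_boundary_iff[OF assms(1)] s by simp
qed

lemma chart_on_edge:
  assumes "c \<in> A" "p \<in> fst c \<inter> manifold_boundary A"
  shows "snd c p = (0, snd (snd c p))" "snd (snd c p) \<in> edge_image c" "edge_inv c (snd (snd c p)) = p"
proof -
  show e: "snd c p = (0, snd (snd c p))"
    using in_boundary_iff[OF assms(1), of p] assms(2) by (simp add: prod_eq_iff)
  have "snd c p \<in> chart_image c" using assms(2) by (intro chart_in_image) simp
  then show "snd (snd c p) \<in> edge_image c" unfolding edge_image_def mem_Collect_eq e[symmetric] .
  show "edge_inv c (snd (snd c p)) = p"
    unfolding edge_inv_def e[symmetric] using assms by (intro chart_inv_chart) auto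
qed

lemma edge_chart_image: assumes "c \<in> A" shows "snd (edge_chart c) ` fst (edge_chart c) = edge_image c"
proof
  show "snd (edge_chart c) ` fst (edge_chart c) \<subseteq> edge_image c"
    using chart_on_edge(2)[OF assms] unfolding edge_chart_def by auto
  show "edge_image c \<subseteq> snd (edge_chart c) ` fst (edge_chart c)"
  proof
    fix y assume y: "y \<in> edge_image c"
    have "y = (snd \<circ> snd c) (edge_inv c y)" by (simp add: edge_inv_in(2)[OF assms y])
    then show "y \<in> snd (edge_chart c) ` fst (edge_chart c)"
      using edge_inv_in(1)[OF assms y] unfolding edge_chart_def fst_conv snd_conv by (rule image_eqI)
  qed
qed

lemma edge_chart_inv:
  assumes "c \<in> A" "y \<in> edge_image c"
  shows "inv_into (fst (edge_chart c)) (snd (edge_chart c)) y = edge_inv c y"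
proof -
  have "inj_on (snd \<circ> snd c) (fst c \<inter> manifold_boundary A)"
  proof (rule inj_onI)
    fix p q assume p: "p \<in> fst c \<inter> manifold_boundary A" and q: "q \<in> fst c \<inter> manifold_boundary A"
      and "(snd \<circ> snd c) p = (snd \<circ> snd c) q"
    then have "edge_inv c (snd (snd c p)) = edge_inv c (snd (snd c q))" by simp
    then show "p = q" by (simp only: chart_on_edge(3)[OF assms(1) p] chart_on_edge(3)[OF assms(1) q])
  qed
  moreover have "(snd \<circ> snd c) (edge_inv c y) = y" by (simp add: edge_inv_in(2)[OF assms])
  ultimately show ?thesis
    using edge_inv_in(1)[OF assms] inv_into_f_f unfolding edge_chart_def fst_conv snd_conv by metis
qed

lemma smooth_on_into_edge: "smooth_on S (\<lambda>y::real. (0::real, y))"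
  by (rule smooth_on_Pair[OF smooth_on_const smooth_on_ident])

lemma edge_transition_smooth:
  assumes "c \<in> A" "d \<in> A" "S \<subseteq> edge_image c" "\<And>y. y \<in> S \<Longrightarrow> edge_inv c y \<in> fst d"
  shows "smooth_on S (\<lambda>y. snd (snd d (edge_inv c y)))"
proof -
  have "(\<lambda>y. (0::real, y)) ` S \<subseteq> snd c ` (fst c \<inter> fst d)"
  proof
    fix x assume "x \<in> (\<lambda>y. (0::real, y)) ` S"
    then obtain y where y: "y \<in> S" "x = (0, y)" by blast
    then have "x = snd c (edge_inv c y)" using edge_inv_in(2)[OF assms(1)] assms(3) by auto
    moreover have "edge_inv c y \<in> fst c \<inter> fst d"
      using edge_inv_in(1)[OF assms(1)] assms(3,4) y(1) by blast
    ultimately show "x \<in> snd c ` (fst c \<inter> fst d)" by (rule image_eqI)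
  qed
  from smooth_on_compose[OF transition_smooth[OF assms(1,2)] smooth_on_into_edge this]
  show ?thesis unfolding edge_inv_def by (rule smooth_on_snd)
qed

definition on_edge :: "('a, real \<times> real) chart \<Rightarrow> ('a \<Rightarrow> real) \<Rightarrow> real \<Rightarrow> real" where
  "on_edge c F y = F (edge_inv c y)"

lemma edge_image_into: "(\<lambda>y. (0, y)) ` edge_image c \<subseteq> chart_image c"
  by (auto simp: edge_image_def)

lemma on_edge_smooth:
  assumes "smoothM F" "c \<in> A" shows "smooth_on (edge_image c) (on_edge c F)"
  using smooth_on_compose[OF smoothM_pull[OF assms] smooth_on_into_edge edge_image_into]
  unfolding on_edge_def[abs_def] edge_inv_def pull_def .

lemma dir_deriv_on_edge:
  fixes g :: "real \<times> real \<Rightarrow> real"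
  assumes "c \<in> A" "smooth_on (chart_image c) g" "y \<in> edge_image c"
  shows "dir_deriv (edge_image c) (\<lambda>y. g (0, y)) 1 y = dir_deriv (chart_image c) g (0, 1) (0, y)"
proof -
  have E: "thick (edge_image c)" by (rule thick_open[OF open_edge_image[OF assms(1)]])
  have "dir_deriv (edge_image c) (\<lambda>y. (0::real, y)) 1 y = (0, 1)"
    by (rule dir_deriv_eq[OF E assms(3) has_derivative_Pair[OF has_derivative_const has_derivative_ident]])
  then show ?thesis
    using dir_deriv_compose[OF E thick_chart_image[OF assms(1)] smooth_on_into_edge assms(2) edge_image_into assms(3), of 1]
    by simp
qed

lemma local_rep_edge:
  assumes "c \<in> A" "y \<in> edge_image c"
  shows "local_rep (edge_chart c) (UNIV, id) F y = on_edge c F y"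
  by (simp add: local_rep_def on_edge_def edge_chart_inv[OF assms])

lemma rep_dom_UNIV: "rep_dom c (UNIV, d) F = snd c ` fst c"
  by (simp add: rep_dom_def)

lemma smooth_map_surface:
  assumes "smoothM F" shows "smooth_map X A euclideanreal real_line_atlas F"
  unfolding smooth_map_def
proof (intro conjI ballI)
  show "continuous_map X euclideanreal F" by (rule smoothM_continuous[OF assms])
  fix c and d :: "(real, real) chart" assume c: "c \<in> A" and "d \<in> real_line_atlas"
  then have d: "d = (UNIV, id)" by (simp add: real_line_atlas_def)
  have "local_rep c d F = pull c F"
    unfolding d local_rep_def pull_def[abs_def] chart_inv_def by simp
  then show "smooth_on (rep_dom c d F) (local_rep c d F)"
    using smoothM_pull[OF assms c] unfolding d rep_dom_UNIV chart_image_def by simp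
qed

lemma smooth_map_boundary:
  assumes "smoothM F"
  shows "smooth_map (subtopology X (manifold_boundary A)) (boundary_atlas A) euclideanreal real_line_atlas F"
  unfolding smooth_map_def
proof (intro conjI ballI)
  show "continuous_map (subtopology X (manifold_boundary A)) euclideanreal F"
    by (rule continuous_map_from_subtopology[OF smoothM_continuous[OF assms]])
  fix b and d :: "(real, real) chart" assume "b \<in> boundary_atlas A" "d \<in> real_line_atlas"
  then obtain c where c: "c \<in> A" "b = edge_chart c" and d: "d = (UNIV, id)"
    unfolding boundary_atlas_eq real_line_atlas_def by blast
  have "smooth_on (edge_image c) (local_rep (edge_chart c) (UNIV, id) F)"
    by (rule smooth_on_cong[THEN iffD2, OF _ on_edge_smooth[OF assms c(1)]]) (rule local_rep_edge[OF c(1)])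
  then show "smooth_on (rep_dom b d F) (local_rep b d F)"
    unfolding c(2) d rep_dom_UNIV edge_chart_image[OF c(1)] .
qed

lemma rank_less_one_imp_zero:
  fixes L :: "'e::euclidean_space \<Rightarrow> real"
  assumes "dim (range L) < DIM(real)" shows "L v = 0"
proof -
  have "dim (range L) = 0" using assms by simp
  then have "range L \<subseteq> {0}" unfolding dim_eq_0 .
  then show ?thesis by blast
qed

lemma submersion_if_no_crit:
  assumes F: "smoothM F" and "crit F = {}"
  shows "submersion X A euclideanreal real_line_atlas F"
  unfolding submersion_def
proof
  show "smooth_map X A euclideanreal real_line_atlas F" by (rule smooth_map_surface[OF F])
  show "singular_set A real_line_atlas F = {}"
  proof (rule equals0I)
    fix p assume "p \<in> singular_set A real_line_atlas F"
    then obtain c where c: "c \<in> A" "p \<in> fst c"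
      and rank: "rank_in_charts c (UNIV :: real set, id) F p < DIM(real)"
      unfolding singular_set_def real_line_atlas_def by blast
    have "local_rep c (UNIV :: real set, id) F = pull c F"
      unfolding local_rep_def pull_def[abs_def] chart_inv_def by simp
    then have "chart_deriv c F v (snd c p) = 0" for v
      using rank_less_one_imp_zero[OF rank[unfolded rank_in_charts_def rep_dom_UNIV], of v]
      unfolding dir_deriv_def chart_image_def by simp
    then have "p \<in> crit F" by (intro crit_iff[OF F c, THEN iffD2] allI)
    then show False using assms(2) by simp
  qed
qed

text \<open>The chart in which a point is found to be singular need not be the one in which the second
  derivative is known not to vanish.\<close>

lemma edge_critical_change_chart:
  assumes F: "smoothM F" and c: "c \<in> A" and d: "d \<in> A"
    and p: "p \<in> fst c" "p \<in> fst d" "p \<in> manifold_boundary A"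
    and crit: "\<And>v. dir_deriv (edge_image c) (on_edge c F) v (snd (snd c p)) = 0"
  shows "dir_deriv (edge_image d) (on_edge d F) v (snd (snd d p)) = 0"
proof -
  let ?S = "{y \<in> edge_image d. edge_inv d y \<in> fst c}"
  let ?\<tau> = "\<lambda>y. snd (snd c (edge_inv d y))"
  have pc: "p \<in> fst c \<inter> manifold_boundary A" and pd: "p \<in> fst d \<inter> manifold_boundary A"
    using p by auto
  have \<tau>: "smooth_on ?S ?\<tau>" by (rule edge_transition_smooth[OF d c]) auto
  have eq: "on_edge d F y = on_edge c F (?\<tau> y)" and im: "?\<tau> y \<in> edge_image c" if y: "y \<in> ?S" for y
  proof -
    have "edge_inv d y \<in> fst c \<inter> manifold_boundary A" using y edge_inv_in(1)[OF d] by blast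
    note e = chart_on_edge[OF c this]
    show "on_edge d F y = on_edge c F (?\<tau> y)" unfolding on_edge_def e(3) ..
    show "?\<tau> y \<in> edge_image c" by (rule e(2))
  qed
  have So: "openin (top_of_set (edge_image d)) ?S"
  proof -
    have "openin X (fst d \<inter> fst c)" by (rule openin_Int[OF chart_openin_dom[OF d] chart_openin_dom[OF c]])
    from chart_openin_image_of[OF d this] obtain T where
      T: "open T" "snd d ` (fst d \<inter> fst c) = chart_image d \<inter> T" unfolding openin_open by blast
    have "?S = edge_image d \<inter> Pair 0 -` T"
    proof (intro set_eqI iffI)
      fix y assume y: "y \<in> ?S"
      then have "edge_inv d y \<in> fst d \<inter> fst c" using edge_inv_in(1)[OF d] by blast
      then have "snd d (edge_inv d y) \<in> chart_image d \<inter> T" unfolding T(2)[symmetric] by blast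
      then show "y \<in> edge_image d \<inter> Pair 0 -` T" using y edge_inv_in(2)[OF d] by simp
    next
      fix y assume y: "y \<in> edge_image d \<inter> Pair 0 -` T"
      then have "(0, y) \<in> snd d ` (fst d \<inter> fst c)" unfolding T(2) edge_image_def by blast
      then obtain q where q: "q \<in> fst d" "q \<in> fst c" "snd d q = (0, y)" by force
      then have "edge_inv d y = q" using chart_inv_chart[OF d q(1)] by (simp add: edge_inv_def)
      then show "y \<in> ?S" using y q by simp
    qed
    moreover have "open (Pair (0::real) -` T)"
      by (rule open_vimage[OF T(1)]) (intro continuous_intros)
    ultimately show ?thesis by (simp add: openin_open_Int)
  qed
  have E: "thick (edge_image e)" if "e \<in> A" for e by (rule thick_open[OF open_edge_image[OF that]])
  have S: "thick ?S" by (rule thick_openin[OF E[OF d] So])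
  let ?y = "snd (snd d p)"
  have yS: "?y \<in> ?S" using chart_on_edge[OF d pd] p(1) by simp
  have imS: "?\<tau> ` ?S \<subseteq> edge_image c" using im by blast
  have \<tau>y: "?\<tau> ?y = snd (snd c p)" using chart_on_edge(3)[OF d pd] by simp
  have "dir_deriv (edge_image d) (on_edge d F) v ?y = dir_deriv ?S (\<lambda>y. on_edge c F (?\<tau> y)) v ?y"
    by (rule dir_deriv_cong_openin[OF E[OF d] So yS smooth_on_compose[OF on_edge_smooth[OF F c] \<tau> imS] eq])
  also have "\<dots> = dir_deriv (edge_image c) (on_edge c F) (dir_deriv ?S ?\<tau> v ?y) (?\<tau> ?y)"
    by (rule dir_deriv_compose[OF S E[OF c] \<tau> on_edge_smooth[OF F c] imS yS])
  also have "\<dots> = 0" unfolding \<tau>y by (rule crit)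
  finally show ?thesis .
qed

text \<open>The coordinate of the Morse lemma composed with a boundary chart is again a boundary chart: the transition
  maps are those of the boundary atlas composed with \<open>u\<close> or its inverse, both smooth.\<close>

lemma fold_chart:
  assumes c: "c \<in> A" and I: "open I" "I \<subseteq> edge_image c" and u: "C_inf I u" "inj_on u I"
    and im: "open (u ` I)" "C_inf (u ` I) (inv_into I u)"
  shows "({p \<in> fst c \<inter> manifold_boundary A. snd (snd c p) \<in> I}, u \<circ> (snd \<circ> snd c)) \<in>
    local_coordinates UNIV (subtopology X (manifold_boundary A)) (boundary_atlas A)"
proof -
  let ?B = "manifold_boundary A"
  let ?U = "{p \<in> fst c \<inter> ?B. snd (snd c p) \<in> I}" and ?\<phi> = "u \<circ> (snd \<circ> snd c)"
  let ?v = "inv_into I u"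
  have vI: "?v x \<in> I" "u (?v x) = x" if "x \<in> u ` I" for x
    using that by (auto simp: inv_into_into f_inv_into_f)
  have eU: "edge_inv c y \<in> ?U" "?\<phi> (edge_inv c y) = u y" if "y \<in> I" for y
    using that I(2) edge_inv_in[OF c, of y] by auto
  have imU: "?\<phi> ` ?U = u ` I"
  proof
    show "?\<phi> ` ?U \<subseteq> u ` I" by auto
    show "u ` I \<subseteq> ?\<phi> ` ?U"
    proof
      fix x assume "x \<in> u ` I"
      then obtain y where "y \<in> I" "x = u y" by blast
      show "x \<in> ?\<phi> ` ?U"
        by (rule image_eqI[OF _ eU(1)[OF \<open>y \<in> I\<close>]]) (simp only: eU(2)[OF \<open>y \<in> I\<close>] \<open>x = u y\<close>)
    qed
  qed
  have inv: "edge_inv c (?v (?\<phi> p)) = p" if "p \<in> ?U" for p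
  proof -
    have p: "p \<in> fst c \<inter> ?B" "snd (snd c p) \<in> I" using that by auto
    show ?thesis
      unfolding comp_def inv_into_f_f[OF u(2) p(2)] by (rule chart_on_edge(3)[OF c p(1)])
  qed
  have inj: "inj_on ?\<phi> ?U" by (rule inj_on_inverseI[of _ "\<lambda>x. edge_inv c (?v x)"]) (rule inv)
  have inv_into: "inv_into ?U ?\<phi> x = edge_inv c (?v x)" if "x \<in> u ` I" for x
  proof (rule inv_into_f_eq[OF inj])
    show "edge_inv c (?v x) \<in> ?U" by (rule eU(1)[OF vI(1)[OF that]])
    show "?\<phi> (edge_inv c (?v x)) = x" using eU(2)[OF vI(1)[OF that]] vI(2)[OF that] by simp
  qed
  have UX: "?U \<subseteq> topspace X" using chart_dom_subset[OF c] by blast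
  have sub: "subtopology (subtopology X ?B) ?U = subtopology X ?U"
    unfolding subtopology_subtopology by (rule arg_cong[of _ _ "subtopology X"]) blast
  have "is_chart UNIV (subtopology X ?B) (?U, ?\<phi>)"
    unfolding is_chart_def prod.case
  proof (intro conjI)
    have "openin X {p \<in> fst c. snd c p \<in> UNIV \<times> I}"
      by (rule chart_openin_preimage[OF c open_Times[OF open_UNIV I(1)]])
    moreover have "?U = {p \<in> fst c. snd c p \<in> UNIV \<times> I} \<inter> ?B" by (auto simp: mem_Times_iff)
    ultimately show "openin (subtopology X ?B) ?U" unfolding openin_subtopology by blast
    show "openin (top_of_set UNIV) (?\<phi> ` ?U)" unfolding imU using im(1) by simp
    show "homeomorphic_map (subtopology (subtopology X ?B) ?U) (top_of_set (?\<phi> ` ?U)) ?\<phi>"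
      unfolding sub imU homeomorphic_map_maps homeomorphic_maps_def
    proof (intro exI[of _ "\<lambda>x. edge_inv c (?v x)"] conjI ballI)
      have "continuous_map (subtopology X (fst c)) (top_of_set (chart_image c)) (snd c)"
        by (rule homeomorphic_imp_continuous_map[OF chart_homeomorphic[OF c]])
      then have "continuous_map (subtopology X (fst c)) euclidean (snd c)"
        by (rule continuous_map_into_fulltopology)
      then have "continuous_map (subtopology X ?U) euclidean (snd c)"
        by (rule continuous_map_from_subtopology_mono) blast
      moreover have "continuous_map euclidean euclidean (snd :: real \<times> real \<Rightarrow> real)"
        unfolding continuous_map_iff_continuous2 by (rule continuous_on_snd[OF continuous_on_id])
      ultimately have "continuous_map (subtopology X ?U) euclidean (snd \<circ> snd c)"
        by (rule continuous_map_compose)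
      then have "continuous_map (subtopology X ?U) euclidean (\<lambda>p. snd (snd c p))"
        by (simp only: comp_def)
      then have 1: "continuous_map (subtopology X ?U) (top_of_set I) (\<lambda>p. snd (snd c p))"
        by (auto simp: continuous_map_in_subtopology)
      have 2: "continuous_map (top_of_set I) (top_of_set (u ` I)) u"
        using C_inf_continuous_on[OF u(1)] by (auto simp: continuous_map_in_subtopology)
      show "continuous_map (subtopology X ?U) (top_of_set (u ` I)) ?\<phi>"
        using continuous_map_compose[OF 1 2] by (simp add: o_def)
      have 3: "continuous_map (top_of_set (u ` I)) (top_of_set I) ?v"
        using C_inf_continuous_on[OF im(2)] vI(1) by (auto simp: continuous_map_in_subtopology)
      have 4: "continuous_map (top_of_set I) (top_of_set (chart_image c)) (\<lambda>y. (0, y))"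
        using I(2) edge_image_into[of c] by (auto simp: continuous_map_in_subtopology intro!: continuous_intros)
      from continuous_map_compose[OF continuous_map_compose[OF 3 4] chart_continuous_inv[OF c]]
      have "continuous_map (top_of_set (u ` I)) X (\<lambda>x. edge_inv c (?v x))"
        by (simp add: o_def edge_inv_def)
      then show "continuous_map (top_of_set (u ` I)) (subtopology X ?U) (\<lambda>x. edge_inv c (?v x))"
        using eU(1)[OF vI(1)] unfolding continuous_map_in_subtopology by auto
      show "edge_inv c (?v (?\<phi> p)) = p" if "p \<in> topspace (subtopology X ?U)" for p
        using that by (intro inv) simp
      show "?\<phi> (edge_inv c (?v x)) = x" if "x \<in> topspace (top_of_set (u ` I))" for x
        using that eU(2)[OF vI(1), of x] vI(2)[of x] by simp
    qed
  qed
  moreover have "compatible (?U, ?\<phi>) b" if b: "b \<in> boundary_atlas A" for b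
  proof -
    obtain d where d: "d \<in> A" "b = edge_chart d" using b unfolding boundary_atlas_eq by blast
    let ?W = "rep_dom (?U, ?\<phi>) b id" and ?W' = "rep_dom b (?U, ?\<phi>) id"
    have W: "?W = ?\<phi> ` (?U \<inter> (fst d \<inter> ?B))" unfolding rep_dom_def d(2) edge_chart_def by simp
    have W_sub: "?W \<subseteq> u ` I" unfolding W imU[symmetric] by blast
    have vW: "?v ` ?W \<subseteq> {y \<in> I. edge_inv c y \<in> fst d}"
    proof
      fix y assume "y \<in> ?v ` ?W"
      then obtain p where p: "p \<in> ?U" "p \<in> fst d" "y = ?v (?\<phi> p)" unfolding W by blast
      have "?\<phi> p \<in> u ` I" using p(1) by auto
      then show "y \<in> {y \<in> I. edge_inv c y \<in> fst d}" using vI(1) inv[OF p(1)] p(2,3) by simp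
    qed
    have "smooth_on {y \<in> I. edge_inv c y \<in> fst d} (\<lambda>y. snd (snd d (edge_inv c y)))"
      by (rule edge_transition_smooth[OF c d(1)]) (use I(2) in auto)
    from smooth_on_compose[OF this smooth_on_subset[OF C_inf_imp_smooth_on[OF im] W_sub] vW]
    have sm: "smooth_on ?W (\<lambda>x. snd (snd d (edge_inv c (?v x))))" .
    have rep: "local_rep (?U, ?\<phi>) b id x = snd (snd d (edge_inv c (?v x)))" if "x \<in> ?W" for x
    proof -
      have "x \<in> u ` I" using that W_sub by blast
      from inv_into[OF this] show ?thesis
        unfolding local_rep_def d(2) edge_chart_def fst_conv snd_conv id_def comp_def by simp
    qed
    have 1: "smooth_on ?W (local_rep (?U, ?\<phi>) b id)"
      by (rule smooth_on_cong[THEN iffD2, OF _ sm]) (rule rep)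
    have W': "?W' = (snd \<circ> snd d) ` ((fst d \<inter> ?B) \<inter> ?U)" unfolding rep_dom_def d(2) edge_chart_def by simp
    have ed: "edge_inv d y \<in> ?U" "y \<in> edge_image d" if y: "y \<in> ?W'" for y
    proof -
      obtain p where p: "p \<in> fst d \<inter> ?B" "p \<in> ?U" "y = snd (snd d p)" using y unfolding W' by auto
      then show "edge_inv d y \<in> ?U" "y \<in> edge_image d" using chart_on_edge(2,3)[OF d(1) p(1)] by simp_all
    qed
    have "smooth_on ?W' (\<lambda>y. snd (snd c (edge_inv d y)))"
      by (rule edge_transition_smooth[OF d(1) c]) (use ed in auto)
    moreover have "(\<lambda>y. snd (snd c (edge_inv d y))) ` ?W' \<subseteq> I" using ed(1) by auto
    ultimately have sm': "smooth_on ?W' (\<lambda>y. u (snd (snd c (edge_inv d y))))"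
      by (rule smooth_on_compose[OF C_inf_imp_smooth_on[OF I(1) u(1)]])
    have rep': "local_rep b (?U, ?\<phi>) id y = u (snd (snd c (edge_inv d y)))" if "y \<in> ?W'" for y
      using edge_chart_inv[OF d(1) ed(2)[OF that]] unfolding local_rep_def d(2) by simp
    have 2: "smooth_on ?W' (local_rep b (?U, ?\<phi>) id)"
      by (rule smooth_on_cong[THEN iffD2, OF _ sm']) (rule rep')
    show ?thesis unfolding compatible_def using 1 2 by (rule conjI)
  qed
  ultimately show ?thesis unfolding local_coordinates_def by blast
qed

lemma translation_local_coordinates:
  "(UNIV, \<lambda>y. y - a) \<in> local_coordinates UNIV euclideanreal real_line_atlas"
proof -
  let ?c = "(UNIV :: real set, \<lambda>y. y - a)"
  have inv: "inv_into UNIV (\<lambda>y. y - a) x = x + a" for x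
    by (rule inv_into_f_eq) (auto intro!: injI)
  have surj: "range (\<lambda>y. y - a) = UNIV" by (rule surjI[of _ "\<lambda>x. x + a"]) simp
  have "homeomorphic_map euclideanreal euclideanreal (\<lambda>y. y - a)"
    unfolding homeomorphic_map_maps homeomorphic_maps_def
    by (intro exI[of _ "\<lambda>y. y + a"]) (auto intro!: continuous_intros)
  then have "is_chart UNIV euclideanreal ?c"
    unfolding is_chart_def prod.case surj by simp
  moreover have "compatible ?c (UNIV, id)"
    unfolding compatible_def rep_dom_UNIV local_rep_def
    using smooth_on_add[OF smooth_on_ident smooth_on_const[of _ a]]
      smooth_on_add[OF smooth_on_ident smooth_on_const[of _ "- a"]]
    by (simp add: inv)
  ultimately show ?thesis unfolding local_coordinates_def real_line_atlas_def by simp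
qed

lemma definite_fold_form_1d:
  "definite_fold_form (\<lambda>i. 1 :: real) (\<lambda>i. 1 :: real) s x = s * x\<^sup>2"
  by (simp add: definite_fold_form_def)

text \<open>In the chart where the second derivative is known, a singular point of the restriction is a
  nondegenerate critical point of a function of one variable.\<close>

lemma boundary_definite_fold:
  assumes F: "smoothM F"
    and nd: "\<And>p. p \<in> topspace X \<Longrightarrow> \<exists>c\<in>A. p \<in> fst c \<and> (fst (snd c p) = 0 \<longrightarrow>
       boundary_nondegenerate (chart_jet c F (snd c p)) \<noteq> 0)"
  shows "definite_fold_map (subtopology X (manifold_boundary A)) (boundary_atlas A)
    euclideanreal real_line_atlas F"
  unfolding definite_fold_map_def
proof (intro conjI ballI)
  let ?B = "manifold_boundary A"
  show "smooth_map (subtopology X ?B) (boundary_atlas A) euclideanreal real_line_atlas F"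
    by (rule smooth_map_boundary[OF F])
  fix p assume "p \<in> singular_set (boundary_atlas A) real_line_atlas F"
  then obtain d where d: "d \<in> A" "p \<in> fst (edge_chart d)"
    and rank: "rank_in_charts (edge_chart d) (UNIV :: real set, id) F p < DIM(real)"
    unfolding singular_set_def real_line_atlas_def boundary_atlas_eq by blast
  have pd: "p \<in> fst d \<inter> ?B" using d(2) by (simp add: edge_chart_def)
  have snd_edge: "snd (edge_chart d) p = snd (snd d p)" by (simp add: edge_chart_def)
  have crit_d: "dir_deriv (edge_image d) (on_edge d F) v (snd (snd d p)) = 0" for v
  proof -
    have "dir_deriv (edge_image d) (on_edge d F) v (snd (snd d p)) =
        dir_deriv (edge_image d) (local_rep (edge_chart d) (UNIV, id) F) v (snd (snd d p))"
      by (rule dir_deriv_cong[OF local_rep_edge[OF d(1), symmetric] chart_on_edge(2)[OF d(1) pd]])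
    also have "\<dots> = 0"
      using rank_less_one_imp_zero[OF rank[unfolded rank_in_charts_def rep_dom_UNIV], of v]
      unfolding dir_deriv_def edge_chart_image[OF d(1)] snd_edge .
    finally show ?thesis .
  qed
  have "p \<in> topspace X" using pd chart_dom_subset[OF d(1)] by blast
  then obtain c where c: "c \<in> A" "p \<in> fst c"
    and ndc: "fst (snd c p) = 0 \<longrightarrow> boundary_nondegenerate (chart_jet c F (snd c p)) \<noteq> 0"
    using nd by blast
  have pc: "p \<in> fst c \<inter> ?B" using c(2) pd by blast
  let ?y = "snd (snd c p)" and ?e = "on_edge c F"
  note edge = chart_on_edge[OF c(1) pc]
  define fy where "fy = chart_deriv c F (0, 1)"
  have fy: "smooth_on (chart_image c) fy"
    unfolding fy_def by (rule smooth_on_dir_deriv[OF thick_chart_image[OF c(1)] smoothM_pull[OF F c(1)]])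
  have e1: "dir_deriv (edge_image c) ?e 1 y = fy (0, y)" if "y \<in> edge_image c" for y
    using dir_deriv_on_edge[OF c(1) smoothM_pull[OF F c(1)] that]
    unfolding fy_def pull_def[abs_def] on_edge_def[abs_def] edge_inv_def .
  have e0: "dir_deriv (edge_image c) ?e 1 ?y = 0"
    by (rule edge_critical_change_chart[OF F d(1) c(1) _ c(2) _ crit_d]) (use pd in auto)
  have e2: "dir_deriv (edge_image c) (dir_deriv (edge_image c) ?e 1) 1 ?y \<noteq> 0"
  proof -
    have "dir_deriv (edge_image c) (dir_deriv (edge_image c) ?e 1) 1 ?y
        = dir_deriv (edge_image c) (\<lambda>y. fy (0, y)) 1 ?y"
      by (rule dir_deriv_cong[OF e1 edge(2)])
    also have "\<dots> = dir_deriv (chart_image c) fy (0, 1) (0, ?y)"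
      by (rule dir_deriv_on_edge[OF c(1) fy edge(2)])
    finally have eq: "dir_deriv (edge_image c) (dir_deriv (edge_image c) ?e 1) 1 ?y
        = dir_deriv (chart_image c) fy (0, 1) (snd c p)" unfolding edge(1)[symmetric] .
    have "fst (snd c p) = 0" using edge(1) by (metis fst_conv)
    then have "boundary_nondegenerate (chart_jet c F (snd c p)) \<noteq> 0" using ndc by blast
    moreover have "fy (snd c p) = 0" using e1[OF edge(2)] e0 unfolding edge(1)[symmetric] by simp
    ultimately show ?thesis
      unfolding eq by (simp add: boundary_nondegenerate_def jet_def Let_def fy_def)
  qed
  obtain I u s where I: "open I" "?y \<in> I" "I \<subseteq> edge_image c" and u: "C_inf I u" "inj_on u I"
    and im: "open (u ` I)" "C_inf (u ` I) (inv_into I u)" and u0: "u ?y = 0" and s: "s \<in> {1, -1}"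
    and normal: "\<And>y. y \<in> I \<Longrightarrow> ?e y = ?e ?y + s * (u y)\<^sup>2"
    by (rule Morse_lemma_1d[OF open_edge_image[OF c(1)] on_edge_smooth[OF F c(1)] edge(2) e0 e2]) blast
  let ?U = "{p \<in> fst c \<inter> ?B. snd (snd c p) \<in> I}" and ?\<phi> = "u \<circ> (snd \<circ> snd c)"
  have local1: "(?U, ?\<phi>) \<in> local_coordinates UNIV (subtopology X ?B) (boundary_atlas A)"
    by (rule fold_chart[OF c(1) I(1,3) u im])
  note local2 = translation_local_coordinates[of "F p"]
  have form: "F q - F p = s * (?\<phi> q)\<^sup>2" if "q \<in> ?U" for q
  proof -
    have q: "q \<in> fst c \<inter> ?B" "snd (snd c q) \<in> I" using that by auto
    have "?e (snd (snd c q)) = F q" "?e ?y = F p"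
      unfolding on_edge_def chart_on_edge(3)[OF c(1) q(1)] edge(3) by (rule refl)+
    then show ?thesis using normal[OF q(2)] by simp
  qed
  have bij: "bij_betw (\<lambda>i. 1 :: real) {1..DIM(real)} Basis" by (simp add: bij_betw_def)
  show "\<exists>(U, \<phi>)\<in>local_coordinates UNIV (subtopology X ?B) (boundary_atlas A).
          \<exists>(V, \<psi>)\<in>local_coordinates UNIV euclideanreal real_line_atlas.
          p \<in> U \<and> \<phi> p = 0 \<and> F p \<in> V \<and> \<psi> (F p) = 0 \<and> F ` U \<subseteq> V \<and>
          (\<exists>b e s. bij_betw b {1..DIM(real)} Basis \<and> bij_betw e {1..DIM(real)} Basis \<and>
                   s \<in> {1, -1} \<and> (\<forall>q\<in>U. \<psi> (F q) = definite_fold_form b e s (\<phi> q)))"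
    unfolding split_beta
  proof (intro bexI[OF _ local1] bexI[OF _ local2] conjI, unfold fst_conv snd_conv)
    show "p \<in> ?U" using pc I(2) by simp
    show "?\<phi> p = 0" using u0 by simp
    show "\<exists>b e s. bij_betw b {1..DIM(real)} Basis \<and> bij_betw e {1..DIM(real)} Basis \<and>
       s \<in> {1, -1} \<and> (\<forall>q\<in>?U. F q - F p = definite_fold_form b e s (?\<phi> q))"
      using bij s form
      by (intro exI[of _ "\<lambda>i. 1 :: real"] exI[of _ s] conjI ballI) (simp_all only: definite_fold_form_1d)
  qed simp_all
qed

end

theorem proposition3p1:
  fixes X :: "'a topology" and A :: "('a, real \<times> real) chart set"
  assumes "smooth_manifold halfspace X A"
    and "compact_space X" and "connected_space X"
    and "manifold_boundary A \<noteq> {}"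
  shows "\<exists>F :: 'a \<Rightarrow> real.
           submersion_with_definite_folds X A euclideanreal real_line_atlas F"
proof -
  interpret compact_surface X A using assms(1,2) by unfold_locales
  obtain F where F: "smoothM F" "crit F = {}"
    and nd: "\<And>p. p \<in> topspace X \<Longrightarrow> \<exists>c\<in>A. p \<in> fst c \<and> (fst (snd c p) = 0 \<longrightarrow>
       boundary_nondegenerate (chart_jet c F (snd c p)) \<noteq> 0)"
    by (rule good_function_exists[OF assms(3,4)]) blast
  have "submersion_with_definite_folds X A euclideanreal real_line_atlas F"
    unfolding submersion_with_definite_folds_def
    using submersion_if_no_crit[OF F] boundary_definite_fold[OF F(1) nd] by (rule conjI)
  then show ?thesis by (rule exI[of _ F])
qed

end
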